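(* Let $R = R_0[x_1,\ldots,x_d]$ be a commutative Noetherian $\mathbb{N}$-graded algebra, where $R_0$ is the degree-$0$ component of $R$ and the $x_i$ are homogeneous with $\deg(x_i)\ge 1$ for $1\le i\le d$. Let $M$ be a finitely generated $\mathbb{Z}$-graded $R$-module, $N$ a graded submodule of $M$, and $I$ a homogeneous ideal of $R$. Let $J$ be a reduction ideal of $I$ (possibly $J=I$), generated by homogeneous elements $y_1,\ldots,y_c$ of degrees $d_1\le\cdots\le d_c$ respectively. Assume that $(0:_M I)=0$. (1) Let $\mathfrak{p}\in\mathcal{A}_N^M(I)$ be such that $I\subseteq\mathfrak{p}$. Then there exist $a\in\{d_1,\ldots,d_c\}$ and $b\in\mathbb{Z}$ such that $v_{\mathfrak{p}}(M/I^nN) = an+b$ for all $n\gg 0$. Moreover, if $\mathcal{B}_{IN}^M(I) = \mathcal{A}_N^M(I)$, then $v_{\mathfrak{p}}(I^nM/I^{n+1}N) = v_{\mathfrak{p}}(M/I^{n+1}N)$ for all $n \gg 0$. (2) Let $\mathcal{A}_N^M(I)\neq \emptyset$, and suppose $I^{n_0}M\subseteq N$ for some $n_0$ (e.g., $N=M$, or $N=\mathfrak{a}M$ for some homogeneous ideal $\mathfrak{a}$ satisfying $I \subseteq \sqrt{\mathfrak{a}}$). Then the functions $$\mathrm{indeg}\big( I^nM/I^{n+1}N \big),\quad v\big( I^nM/I^{n+1}N \big)\quad\text{and}\quad v\big( M/I^{n+1}N \big)$$ are all eventually linear in $n$ with the same leading coefficient $d_{\gamma} \in \{d_1,\ldots,d_c\}$.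 In fact, the last two functions are equal for all $n\gg0$ when $\mathcal{B}_{IN}^M(I) = \mathcal{A}_N^M(I)$. (3) In the situation of (2), when $(0 :_M y_1) = 0$ and $d_1\ge 1$, the leading coefficient in (2) is $d_{\gamma} = d_1$.
   Context: For a finitely generated $\mathbb{Z}$-graded $R$-module $L=\bigoplus_{u}L_u$: $\mathrm{indeg}(L) := \inf\{n : L_n\neq 0\}$, with $\mathrm{indeg}(0)=\infty$. For $\mathfrak{p}\in\mathrm{Ass}_R(L)$, the v-number of $L$ at $\mathfrak{p}$ is $v_{\mathfrak{p}}(L) := \inf\{ u : \text{there exists } x\in L_u \text{ such that } \mathfrak{p} = (0:_R x)\}$. The v-number of $L$ is $v(L) := \inf\{v_{\mathfrak{p}}(L) : \mathfrak{p}\in\mathrm{Ass}_R(L)\}$, with $v(0)=\infty$. For an ideal $\mathfrak{b}$ (or element) of $R$, $(0:_M\mathfrak{b}) := \{x\in M:\mathfrak{b}x=0\}$. It is known that, for any graded submodule $N$ of $M$, the sets $\mathrm{Ass}_R(I^nM/I^nN)$ and $\mathrm{Ass}_R(M/I^nN)$ are each the same for all $n\gg 0$. Their eventual values are denoted $\mathcal{B}_N^M(I) := \mathrm{Ass}_R(I^nM/I^nN)$ and $\mathcal{A}_N^M(I) := \mathrm{Ass}_R(M/I^nN)$ for all $n\gg0$. In particular $\mathcal{B}_{IN}^M(I)=\mathrm{Ass}_R(I^nM/I^{n+1}N)$ for all $n\gg0$. An ideal $J\subseteq I$ is a reduction of $I$ if $JI^m=I^{m+1}$ for some $m\ge 0$.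 A function $f(n)$ is eventually linear with leading coefficient $a$ if there is $b\in\mathbb{Z}$ with $f(n)=an+b$ for all $n\gg 0$. *)

theory Defs
  imports "HOL-Algebra.Algebra" "HOL-Library.Extended_Real"
begin

section \<open>Gradings\<close>

text \<open>Every element of \<open>G\<close> is uniquely a finite sum of elements of the subgroups \<open>D i\<close>.\<close>

definition internal_direct_sum :: "('a, 'm) ring_scheme \<Rightarrow> ('i \<Rightarrow> 'a set) \<Rightarrow> bool" where
  "internal_direct_sum G D \<longleftrightarrow>
     (\<forall>i. additive_subgroup (D i) G) \<and>
     (\<forall>x\<in>carrier G. \<exists>!f. (\<forall>i. f i \<in> D i) \<and> finite {i. f i \<noteq> \<zero>\<^bsub>G\<^esub>} \<and>
        x = (\<Oplus>\<^bsub>G\<^esub>i\<in>{i. f i \<noteq> \<zero>\<^bsub>G\<^esub>}. f i))"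

locale graded_cring = cring R for R :: "('a, 'r) ring_scheme" (structure) and A :: "nat \<Rightarrow> 'a set" +
  assumes ring_direct_sum: "internal_direct_sum R A"
    and graded_mult: "\<lbrakk>a \<in> A i; b \<in> A j\<rbrakk> \<Longrightarrow> a \<otimes> b \<in> A (i + j)"

locale graded_module = graded_cring R A + module R M
  for R :: "('a, 'r) ring_scheme" (structure) and A :: "nat \<Rightarrow> 'a set"
    and M :: "('a, 'b, 'm) module_scheme" (structure) and D :: "int \<Rightarrow> 'b set" +
  assumes module_direct_sum: "internal_direct_sum M D"
    and graded_smult: "\<lbrakk>a \<in> A i; x \<in> D u\<rbrakk> \<Longrightarrow> a \<odot>\<^bsub>M\<^esub> x \<in> D (int i + u)"

definition graded_submodule ::
    "('a, 'r) ring_scheme \<Rightarrow> ('a, 'b, 'm) module_scheme \<Rightarrow> (int \<Rightarrow> 'b set) \<Rightarrow> 'b set \<Rightarrow> bool" where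
  "graded_submodule R M D N \<longleftrightarrow>
     submodule N R M \<and> internal_direct_sum (M\<lparr>carrier := N\<rparr>) (\<lambda>u. N \<inter> D u)"

definition homogeneous_ideal :: "('a, 'r) ring_scheme \<Rightarrow> (nat \<Rightarrow> 'a set) \<Rightarrow> 'a set \<Rightarrow> bool" where
  "homogeneous_ideal R A I \<longleftrightarrow> ideal I R \<and> (\<exists>S \<subseteq> (\<Union>i. A i). I = Idl\<^bsub>R\<^esub> S)"


section \<open>Submodules, quotients and products\<close>

definition gen_submodule ::
    "('a, 'r) ring_scheme \<Rightarrow> ('a, 'b, 'm) module_scheme \<Rightarrow> 'b set \<Rightarrow> 'b set" where
  "gen_submodule R M S = \<Inter>{H. submodule H R M \<and> S \<subseteq> H}"

definition fin_gen_module :: "('a, 'r) ring_scheme \<Rightarrow> ('a, 'b, 'm) module_scheme \<Rightarrow> bool" where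
  "fin_gen_module R M \<longleftrightarrow>
     (\<exists>S \<subseteq> carrier M. finite S \<and> carrier M = gen_submodule R M S)"

definition ideal_smult ::
    "('a, 'r) ring_scheme \<Rightarrow> ('a, 'b, 'm) module_scheme \<Rightarrow> 'a set \<Rightarrow> 'b set \<Rightarrow> 'b set" where
  "ideal_smult R M I N = gen_submodule R M {a \<odot>\<^bsub>M\<^esub> x | a x. a \<in> I \<and> x \<in> N}"

abbreviation ideal_pow :: "('a, 'r) ring_scheme \<Rightarrow> 'a set \<Rightarrow> nat \<Rightarrow> 'a set" where
  "ideal_pow R I n \<equiv> I [^]\<^bsub>ideals_set R\<^esub> n"

text \<open>\<open>I\<^sup>n N\<close>\<close>

abbreviation pow_smult ::
    "('a, 'r) ring_scheme \<Rightarrow> ('a, 'b, 'm) module_scheme \<Rightarrow> 'a set \<Rightarrow> nat \<Rightarrow> 'b set \<Rightarrow> 'b set" where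
  "pow_smult R M I n N \<equiv> ideal_smult R M (ideal_pow R I n) N"

text \<open>
  The quotient module \<open>M/K\<close>, following the library's quotient ring. A module record also has
  ring fields \<open>mult\<close> and \<open>one\<close>, which are irrelevant for modules.
\<close>

definition quot_module :: "('a, 'b, 'm) module_scheme \<Rightarrow> 'b set \<Rightarrow> ('a, 'b set) module" where
  "quot_module M K =
     \<lparr>carrier = a_rcosets\<^bsub>M\<^esub> K, monoid.mult = undefined, one = undefined,
      ring.zero = K, add = set_add M,
      smult = (\<lambda>a C. \<Union>x\<in>C. K +>\<^bsub>M\<^esub> (a \<odot>\<^bsub>M\<^esub> x))\<rparr>"

lemma quot_module_smult:
  assumes "module R M" "submodule K R M" "a \<in> carrier R" "x \<in> carrier M"
  shows "a \<odot>\<^bsub>quot_module M K\<^esub> (K +>\<^bsub>M\<^esub> x) = K +>\<^bsub>M\<^esub> (a \<odot>\<^bsub>M\<^esub> x)"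
proof -
  interpret module R M by fact
  have KM: "K \<subseteq> carrier M"
    and Kz: "\<zero>\<^bsub>M\<^esub> \<in> K"
    using assms(2) by (auto simp: submodule_def subgroup_def)
  have sub: "subgroup K (add_monoid M)"
    using assms(2) by (simp add: submodule_def)
  have eq: "K +>\<^bsub>M\<^esub> (a \<odot>\<^bsub>M\<^esub> z) = K +>\<^bsub>M\<^esub> (a \<odot>\<^bsub>M\<^esub> x)" if z: "z \<in> K +>\<^bsub>M\<^esub> x" for z
  proof -
    obtain k where k: "k \<in> K" "z = k \<oplus>\<^bsub>M\<^esub> x"
      using z by (auto simp: a_r_coset_def r_coset_def)
    have "a \<odot>\<^bsub>M\<^esub> z = a \<odot>\<^bsub>M\<^esub> k \<oplus>\<^bsub>M\<^esub> a \<odot>\<^bsub>M\<^esub> x"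
      using k KM assms by (auto simp: smult_r_distr)
    moreover have "a \<odot>\<^bsub>M\<^esub> k \<in> K"
      using assms(2,3) k by (simp add: submodule.smult_closed)
    ultimately have "a \<odot>\<^bsub>M\<^esub> z \<in> K +>\<^bsub>M\<^esub> (a \<odot>\<^bsub>M\<^esub> x)"
      by (auto simp: a_r_coset_def r_coset_def)
    moreover have "a \<odot>\<^bsub>M\<^esub> x \<in> carrier M"
      using assms by simp
    ultimately show ?thesis
      unfolding a_r_coset_def using M.add.repr_independence[OF _ _ sub] by simp
  qed
  have "x \<in> K +>\<^bsub>M\<^esub> x"
    using Kz assms by (force simp: a_r_coset_def r_coset_def)
  then have "(\<Union>z\<in>K +>\<^bsub>M\<^esub> x. K +>\<^bsub>M\<^esub> (a \<odot>\<^bsub>M\<^esub> z)) = K +>\<^bsub>M\<^esub> (a \<odot>\<^bsub>M\<^esub> x)"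
    using eq by (intro SUP_eq_const) blast+
  then show ?thesis
    by (simp add: quot_module_def)
qed

text \<open>For submodules \<open>K \<subseteq> L\<close> of \<open>M\<close>: the module \<open>L/K\<close> and its induced grading.\<close>

abbreviation subquot :: "('a, 'b, 'm) module_scheme \<Rightarrow> 'b set \<Rightarrow> 'b set \<Rightarrow> ('a, 'b set) module" where
  "subquot M L K \<equiv> quot_module (M\<lparr>carrier := L\<rparr>) K"

definition subquot_grading ::
    "('a, 'b, 'm) module_scheme \<Rightarrow> (int \<Rightarrow> 'b set) \<Rightarrow> 'b set \<Rightarrow> 'b set \<Rightarrow> int \<Rightarrow> 'b set set" where
  "subquot_grading M D L K u = (\<lambda>x. K +>\<^bsub>M\<^esub> x) ` (L \<inter> D u)"


section \<open>Annihilators, associated primes and v-numbers\<close>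

text \<open>\<open>(0 :\<^sub>R x)\<close> and \<open>(0 :\<^sub>M S)\<close>\<close>

definition elt_ann :: "('a, 'r) ring_scheme \<Rightarrow> ('a, 'b, 'm) module_scheme \<Rightarrow> 'b \<Rightarrow> 'a set" where
  "elt_ann R L x = {a \<in> carrier R. a \<odot>\<^bsub>L\<^esub> x = \<zero>\<^bsub>L\<^esub>}"

definition zero_colon :: "('a, 'b, 'm) module_scheme \<Rightarrow> 'a set \<Rightarrow> 'b set" where
  "zero_colon M S = {x \<in> carrier M. \<forall>a\<in>S. a \<odot>\<^bsub>M\<^esub> x = \<zero>\<^bsub>M\<^esub>}"

definition Ass :: "('a, 'r) ring_scheme \<Rightarrow> ('a, 'b, 'm) module_scheme \<Rightarrow> 'a set set" where
  "Ass R L = {p. primeideal p R \<and> (\<exists>x\<in>carrier L. p = elt_ann R L x)}"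

text \<open>The infima are taken in the extended reals, so that the infimum of the empty set is \<open>\<infinity>\<close>.\<close>

definition indeg :: "('a, 'b, 'm) module_scheme \<Rightarrow> (int \<Rightarrow> 'b set) \<Rightarrow> ereal" where
  "indeg L D = (INF u\<in>{u. D u \<noteq> {\<zero>\<^bsub>L\<^esub>}}. ereal (of_int u))"

definition local_v_number ::
    "('a, 'r) ring_scheme \<Rightarrow> ('a, 'b, 'm) module_scheme \<Rightarrow> (int \<Rightarrow> 'b set) \<Rightarrow> 'a set \<Rightarrow> ereal" where
  "local_v_number R L D p = (INF u\<in>{u. \<exists>x\<in>D u. p = elt_ann R L x}. ereal (of_int u))"

definition v_number ::
    "('a, 'r) ring_scheme \<Rightarrow> ('a, 'b, 'm) module_scheme \<Rightarrow> (int \<Rightarrow> 'b set) \<Rightarrow> ereal" where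
  "v_number R L D = (INF p\<in>Ass R L. local_v_number R L D p)"

abbreviation indeg_subquot ::
    "('a, 'b, 'm) module_scheme \<Rightarrow> (int \<Rightarrow> 'b set) \<Rightarrow> 'b set \<Rightarrow> 'b set \<Rightarrow> ereal" where
  "indeg_subquot M D L K \<equiv> indeg (subquot M L K) (subquot_grading M D L K)"

abbreviation local_v_subquot ::
    "('a, 'r) ring_scheme \<Rightarrow> ('a, 'b, 'm) module_scheme \<Rightarrow> (int \<Rightarrow> 'b set) \<Rightarrow>
     'b set \<Rightarrow> 'b set \<Rightarrow> 'a set \<Rightarrow> ereal" where
  "local_v_subquot R M D L K p \<equiv> local_v_number R (subquot M L K) (subquot_grading M D L K) p"

abbreviation v_subquot ::
    "('a, 'r) ring_scheme \<Rightarrow> ('a, 'b, 'm) module_scheme \<Rightarrow> (int \<Rightarrow> 'b set) \<Rightarrow>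
     'b set \<Rightarrow> 'b set \<Rightarrow> ereal" where
  "v_subquot R M D L K \<equiv> v_number R (subquot M L K) (subquot_grading M D L K)"


section \<open>Asymptotic notions\<close>

text \<open>Meaningful for eventually constant sequences only.\<close>

definition eventual_value :: "(nat \<Rightarrow> 'c) \<Rightarrow> 'c" where
  "eventual_value f = (THE c. \<forall>\<^sub>F n in sequentially. f n = c)"

lemma eventual_value_eqI:
  assumes "\<forall>\<^sub>F n in sequentially. f n = c"
  shows "eventual_value f = c"
  unfolding eventual_value_def
proof (rule the_equality)
  fix c' assume "\<forall>\<^sub>F n in sequentially. f n = c'"
  with assms have "\<forall>\<^sub>F n in sequentially. c' = c"
    by eventually_elim simp
  then show "c' = c" by simp
qed (rule assms)

text \<open>\<open>\<A>\<^sub>N\<^sup>M(I)\<close> and \<open>\<B>\<^sub>N\<^sup>M(I)\<close>\<close>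

definition A_ass ::
    "('a, 'r) ring_scheme \<Rightarrow> ('a, 'b, 'm) module_scheme \<Rightarrow> 'b set \<Rightarrow> 'a set \<Rightarrow> 'a set set" where
  "A_ass R M N I = eventual_value (\<lambda>n. Ass R (subquot M (carrier M) (pow_smult R M I n N)))"

definition B_ass ::
    "('a, 'r) ring_scheme \<Rightarrow> ('a, 'b, 'm) module_scheme \<Rightarrow> 'b set \<Rightarrow> 'a set \<Rightarrow> 'a set set" where
  "B_ass R M N I =
     eventual_value (\<lambda>n. Ass R (subquot M (pow_smult R M I n (carrier M)) (pow_smult R M I n N)))"

definition reduction :: "('a, 'r) ring_scheme \<Rightarrow> 'a set \<Rightarrow> 'a set \<Rightarrow> bool" where
  "reduction R I J \<longleftrightarrow> ideal J R \<and> J \<subseteq> I \<and>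
     (\<exists>m. ideal_prod R J (ideal_pow R I m) = ideal_pow R I (m + 1))"

definition eventually_linear :: "(nat \<Rightarrow> ereal) \<Rightarrow> int \<Rightarrow> bool" where
  "eventually_linear f a \<longleftrightarrow>
     (\<exists>b::int. \<forall>\<^sub>F n in sequentially. f n = ereal (of_int (a * int n + b)))"

end

(*
  Let J = (y_1, ..., y_c). Everything happens in families (H_n) of submodules of M with
  y_i H_n contained in H_{n+1}; these are the graded modules over the Rees algebra of J, and the
  argument of Hilbert's basis theorem shows that the subfamilies of (J^n M) satisfy the ascending
  chain condition. Since (0 :_M I) = 0, finitely many multiplications embed the family
  (I^{n+1}N :_M I) jointly into such families, so it is eventually generated in degree one, whence
  (I^{n+1}N :_M I) = I^n N for n >> 0. So the elements of M/I^{n+1}N with annihilator containing I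
  lie in I^n N/I^{n+1}N, which makes the local v-numbers of M/I^{n+1}N and I^n M/I^{n+1}N agree.

  A local v-number is the initial degree of a quotient of two Noetherian families, so it remains
  to prove that initial degrees f(n) of a quotient V_n/W_n are eventually linear. Generators acting
  nilpotently on V/W can be dropped from V_{n+1} = sum of y_i V_n; if d is the least degree of the
  remaining ones, then f(n+1) >= f(n) + d, while a homogeneous element on which a generator of
  degree d is not nilpotent gives f(n) <= d n + const. Hence f(n) - d n is eventually constant.
*)
theory Submission
  imports Defs
begin

section \<open>Submodules\<close>

text \<open>The Rees algebra itself is never built: finiteness comes from \<open>noeth\<close>, the
  chain condition for families, and from \<open>noeth_extension\<close>, which pulls it back along
  multiplication by one scalar. The equation defining a reduction holds only from an exponent
  \<open>m\<close> on, so families of powers begin at \<open>I^m\<close> and results are shifted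
  back afterwards.

  The sets of eventual associated primes are limits, so stabilization has to be proved. For primes
  containing \<open>I\<close> it follows from finiteness of the candidates and a dichotomy: a fixed
  prime is either eventually absent or has an eventually linear v-number, hence is eventually
  present. The associated primes of \<open>M/I^n N\<close> not containing \<open>I\<close> are those
  of \<open>M/N\<close>.

  For a prime \<open>p\<close>, the quotient behind the local v-number is the part killed by
  \<open>p\<close> modulo the elements also killed by a homogeneous scalar outside \<open>p\<close>.

  In (2), v is at least indeg, which compares the slopes in one direction. For the other, an element
  on which a least-degree generator is not nilpotent is kept as a witness: one homogeneous scalar
  turns its multiples by high powers of that generator into elements realizing one fixed associated
  prime.\<close>

context module
begin

abbreviation smult_M (infixl \<open>\<bullet>\<close> 70) where "a \<bullet> x \<equiv> a \<odot>\<^bsub>M\<^esub> x"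

lemma submodule_closedI:
  assumes "H \<subseteq> carrier M" "\<zero>\<^bsub>M\<^esub> \<in> H"
    and "\<And>x y. x \<in> H \<Longrightarrow> y \<in> H \<Longrightarrow> x \<oplus>\<^bsub>M\<^esub> y \<in> H"
    and "\<And>a x. a \<in> carrier R \<Longrightarrow> x \<in> H \<Longrightarrow> a \<bullet> x \<in> H"
  shows "submodule H R M"
proof (rule submoduleI)
  fix x assume x: "x \<in> H"
  then have "(\<ominus> \<one>) \<bullet> x \<in> H" using assms(4) by simp
  moreover have "(\<ominus> \<one>) \<bullet> x = \<ominus>\<^bsub>M\<^esub> x"
    using x assms(1) smult_l_minus[of \<one> x] by auto
  ultimately show "\<ominus>\<^bsub>M\<^esub> x \<in> H" by simp
qed (use assms in auto)

lemma sub_carrier: "submodule H R M \<Longrightarrow> x \<in> H \<Longrightarrow> x \<in> carrier M"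
  using submoduleE(1) by blast

lemma sub_zero: "submodule H R M \<Longrightarrow> \<zero>\<^bsub>M\<^esub> \<in> H"
  by (metis submodule.axioms(1) subgroup.one_closed monoid.simps(2))

lemmas sub_add = submoduleE(5)
lemmas sub_smult = submoduleE(4)

lemma sub_minus: "submodule H R M \<Longrightarrow> x \<in> H \<Longrightarrow> y \<in> H \<Longrightarrow> x \<ominus>\<^bsub>M\<^esub> y \<in> H"
  unfolding a_minus_def using submoduleE(3,5) by metis

lemma sub_add_cancel:
  assumes "submodule H R M" "y \<in> H" "x \<in> carrier M" "x \<oplus>\<^bsub>M\<^esub> y \<in> H"
  shows "x \<in> H"
proof -
  have "y \<in> carrier M" using assms sub_carrier by blast
  then have "x = (x \<oplus>\<^bsub>M\<^esub> y) \<ominus>\<^bsub>M\<^esub> y"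
    using assms(3) by (simp add: a_minus_def M.add.m_assoc M.r_neg)
  then show ?thesis using sub_minus[OF assms(1,4,2)] by simp
qed

lemma submodule_zero: "submodule {\<zero>\<^bsub>M\<^esub>} R M"
  by (rule submodule_closedI) auto

lemma submodule_Int:
  "submodule H R M \<Longrightarrow> submodule K R M \<Longrightarrow> submodule (H \<inter> K) R M"
  by (rule submodule_closedI) (auto intro: sub_carrier sub_zero sub_add sub_smult)

lemma submodule_gen: "S \<subseteq> carrier M \<Longrightarrow> submodule (gen_submodule R M S) R M"
  unfolding gen_submodule_def
  by (rule submodule_closedI) (use carrier_is_submodule in \<open>auto intro: sub_carrier sub_zero sub_add sub_smult\<close>)

lemma gen_incl: "S \<subseteq> gen_submodule R M S"
  unfolding gen_submodule_def by auto

lemma gen_least: "submodule H R M \<Longrightarrow> S \<subseteq> H \<Longrightarrow> gen_submodule R M S \<subseteq> H"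
  unfolding gen_submodule_def by auto

lemma mem_set_add: "x \<in> H <+>\<^bsub>M\<^esub> K \<longleftrightarrow> (\<exists>h\<in>H. \<exists>k\<in>K. x = h \<oplus>\<^bsub>M\<^esub> k)"
  by (auto simp: set_add_def')

lemma submodule_sum:
  assumes H: "submodule H R M" and K: "submodule K R M"
  shows "submodule (H <+>\<^bsub>M\<^esub> K) R M"
proof (rule submodule_closedI)
  show "H <+>\<^bsub>M\<^esub> K \<subseteq> carrier M"
    using sub_carrier[OF H] sub_carrier[OF K] by (auto simp: mem_set_add)
  show "\<zero>\<^bsub>M\<^esub> \<in> H <+>\<^bsub>M\<^esub> K"
    using sub_zero[OF H] sub_zero[OF K] by (force simp: mem_set_add)
next
  fix x y assume "x \<in> H <+>\<^bsub>M\<^esub> K" "y \<in> H <+>\<^bsub>M\<^esub> K"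
  then obtain h k h' k' where *: "h \<in> H" "k \<in> K" "h' \<in> H" "k' \<in> K"
    "x = h \<oplus>\<^bsub>M\<^esub> k" "y = h' \<oplus>\<^bsub>M\<^esub> k'" by (auto simp: mem_set_add)
  then have "x \<oplus>\<^bsub>M\<^esub> y = (h \<oplus>\<^bsub>M\<^esub> h') \<oplus>\<^bsub>M\<^esub> (k \<oplus>\<^bsub>M\<^esub> k')"
    using sub_carrier[OF H] sub_carrier[OF K] by (simp add: M.add.m_ac)
  then show "x \<oplus>\<^bsub>M\<^esub> y \<in> H <+>\<^bsub>M\<^esub> K"
    using * sub_add[OF H] sub_add[OF K] unfolding mem_set_add by blast
next
  fix a x assume a: "a \<in> carrier R" and "x \<in> H <+>\<^bsub>M\<^esub> K"
  then obtain h k where *: "h \<in> H" "k \<in> K" "x = h \<oplus>\<^bsub>M\<^esub> k" by (auto simp: mem_set_add)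
  then have "a \<bullet> x = a \<bullet> h \<oplus>\<^bsub>M\<^esub> a \<bullet> k"
    using a sub_carrier[OF H] sub_carrier[OF K] by (simp add: smult_r_distr)
  then show "a \<bullet> x \<in> H <+>\<^bsub>M\<^esub> K"
    using * a sub_smult[OF H] sub_smult[OF K] unfolding mem_set_add by blast
qed

lemma sum_upper1: "submodule K R M \<Longrightarrow> H \<subseteq> carrier M \<Longrightarrow> H \<subseteq> H <+>\<^bsub>M\<^esub> K"
  using sub_zero by (force simp: mem_set_add)

lemma sum_upper2: "submodule H R M \<Longrightarrow> K \<subseteq> carrier M \<Longrightarrow> K \<subseteq> H <+>\<^bsub>M\<^esub> K"
  using sub_zero by (force simp: mem_set_add)

lemma sum_least: "submodule L R M \<Longrightarrow> H \<subseteq> L \<Longrightarrow> K \<subseteq> L \<Longrightarrow> H <+>\<^bsub>M\<^esub> K \<subseteq> L"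
  using sub_add by (fastforce simp: mem_set_add)

lemma smult_commute:
  "a \<in> carrier R \<Longrightarrow> b \<in> carrier R \<Longrightarrow> x \<in> carrier M \<Longrightarrow>
    a \<bullet> (b \<bullet> x) = b \<bullet> (a \<bullet> x)"
  by (metis R.m_comm smult_assoc1)

lemma smult_minus:
  "a \<in> carrier R \<Longrightarrow> x \<in> carrier M \<Longrightarrow> y \<in> carrier M \<Longrightarrow>
    a \<bullet> (x \<ominus>\<^bsub>M\<^esub> y) = a \<bullet> x \<ominus>\<^bsub>M\<^esub> a \<bullet> y"
  by (simp add: a_minus_def smult_r_distr smult_r_minus)

lemma submodule_image:
  assumes H: "submodule H R M" and a: "a \<in> carrier R"
  shows "submodule ((\<lambda>x. a \<bullet> x) ` H) R M"
proof (rule submodule_closedI)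
  show "(\<lambda>x. a \<bullet> x) ` H \<subseteq> carrier M" using a sub_carrier[OF H] by auto
  show "\<zero>\<^bsub>M\<^esub> \<in> (\<lambda>x. a \<bullet> x) ` H"
    using a sub_zero[OF H] by (metis imageI smult_r_null)
next
  fix x y assume "x \<in> (\<lambda>x. a \<bullet> x) ` H" "y \<in> (\<lambda>x. a \<bullet> x) ` H"
  then obtain u v where "u \<in> H" "v \<in> H" "x = a \<bullet> u" "y = a \<bullet> v" by auto
  then show "x \<oplus>\<^bsub>M\<^esub> y \<in> (\<lambda>x. a \<bullet> x) ` H"
    using a sub_carrier[OF H] sub_add[OF H] by (auto simp: smult_r_distr[symmetric])
next
  fix b x assume b: "b \<in> carrier R" and "x \<in> (\<lambda>x. a \<bullet> x) ` H"
  then obtain u where "u \<in> H" "x = a \<bullet> u" by auto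
  then show "b \<bullet> x \<in> (\<lambda>x. a \<bullet> x) ` H"
    using a b sub_carrier[OF H] sub_smult[OF H b] smult_commute[of b a u] by auto
qed

lemma submodule_preimage:
  assumes H: "submodule H R M" and K: "submodule K R M" and a: "a \<in> carrier R"
  shows "submodule {x \<in> H. a \<bullet> x \<in> K} R M"
proof (rule submodule_closedI)
  fix b x assume "b \<in> carrier R" "x \<in> {x \<in> H. a \<bullet> x \<in> K}"
  then show "b \<bullet> x \<in> {x \<in> H. a \<bullet> x \<in> K}"
    using a smult_commute[of a b x] sub_carrier[OF H] sub_smult[OF H] sub_smult[OF K] by auto
qed (use a sub_carrier[OF H] sub_zero[OF H] sub_zero[OF K] sub_add[OF H] sub_add[OF K]
      in \<open>auto simp: smult_r_distr\<close>)

lemma submodule_colon: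
  assumes H: "submodule H R M" and K: "submodule K R M" and S: "S \<subseteq> carrier R"
  shows "submodule {x \<in> H. \<forall>a\<in>S. a \<bullet> x \<in> K} R M"
proof (rule submodule_closedI)
  fix b x assume b: "b \<in> carrier R" and x: "x \<in> {x \<in> H. \<forall>a\<in>S. a \<bullet> x \<in> K}"
  have "a \<bullet> (b \<bullet> x) \<in> K" if "a \<in> S" for a
    using smult_commute[of a b x] b x that S sub_carrier[OF H] sub_smult[OF K] by auto
  then show "b \<bullet> x \<in> {x \<in> H. \<forall>a\<in>S. a \<bullet> x \<in> K}"
    using b x sub_smult[OF H] by auto
next
  fix x y
  assume "x \<in> {x \<in> H. \<forall>a\<in>S. a \<bullet> x \<in> K}" "y \<in> {x \<in> H. \<forall>a\<in>S. a \<bullet> x \<in> K}"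
  then show "x \<oplus>\<^bsub>M\<^esub> y \<in> {x \<in> H. \<forall>a\<in>S. a \<bullet> x \<in> K}"
    using S smult_r_distr sub_add[OF H] sub_add[OF K] sub_carrier[OF H] by (auto simp: subset_iff)
next
  show "\<zero>\<^bsub>M\<^esub> \<in> {x \<in> H. \<forall>a\<in>S. a \<bullet> x \<in> K}"
    using S sub_zero[OF H] sub_zero[OF K] by (auto simp: subset_iff)
qed (use sub_carrier[OF H] in auto)

text \<open>The annihilator of the coset of \<open>x\<close> modulo \<open>K\<close>. Stated on
  elements of \<open>M\<close>, it lets associated primes and v-numbers of subquotients be studied
  without cosets until the final translation.\<close>

definition colon :: "'c set \<Rightarrow> 'c \<Rightarrow> 'a set" where
  "colon K x = {a \<in> carrier R. a \<bullet> x \<in> K}"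

lemma ideal_colon:
  assumes K: "submodule K R M" and x: "x \<in> carrier M"
  shows "ideal (colon K x) R"
proof (rule idealI)
  show "ring R" by (rule R.ring_axioms)
  show "subgroup (colon K x) (add_monoid R)"
  proof (rule R.add.subgroupI)
    show "colon K x \<noteq> {}"
      unfolding colon_def using x sub_zero[OF K] by (auto intro!: exI[of _ \<zero>])
  next
    fix a assume a: "a \<in> colon K x"
    then show "\<ominus> a \<in> colon K x"
      using x smult_l_minus[of a x] submoduleE(3)[OF K] by (auto simp: colon_def)
  qed (use x sub_add[OF K] in \<open>auto simp: colon_def smult_l_distr\<close>)
next
  fix a r assume a: "a \<in> colon K x" "r \<in> carrier R"
  then show "r \<otimes> a \<in> colon K x"
    using x sub_smult[OF K] by (auto simp: colon_def smult_assoc1)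
  then show "a \<otimes> r \<in> colon K x" using a R.m_comm by (simp add: colon_def)
qed

lemma submodule_ideal_smult:
  "I \<subseteq> carrier R \<Longrightarrow> K \<subseteq> carrier M \<Longrightarrow> submodule (ideal_smult R M I K) R M"
  unfolding ideal_smult_def by (rule submodule_gen) auto

lemma ideal_smult_incl: "a \<in> I \<Longrightarrow> x \<in> K \<Longrightarrow> a \<bullet> x \<in> ideal_smult R M I K"
  unfolding ideal_smult_def using gen_incl[of "{a \<bullet> x | a x. a \<in> I \<and> x \<in> K}"] by blast

lemma ideal_smult_least:
  assumes "submodule H R M" "\<And>a x. a \<in> I \<Longrightarrow> x \<in> K \<Longrightarrow> a \<bullet> x \<in> H"
  shows "ideal_smult R M I K \<subseteq> H"
  unfolding ideal_smult_def by (rule gen_least) (use assms in auto)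

lemma ideal_smult_mono:
  assumes "I \<subseteq> I'" "K \<subseteq> K'" "I' \<subseteq> carrier R" "K' \<subseteq> carrier M"
  shows "ideal_smult R M I K \<subseteq> ideal_smult R M I' K'"
  by (rule ideal_smult_least[OF submodule_ideal_smult[OF assms(3,4)] ideal_smult_incl])
    (use assms in auto)

lemma ideal_smult_sub:
  "I \<subseteq> carrier R \<Longrightarrow> submodule K R M \<Longrightarrow> ideal_smult R M I K \<subseteq> K"
  by (rule ideal_smult_least) (auto intro: sub_smult)

lemma ideal_smult_carrier:
  assumes "submodule K R M" shows "ideal_smult R M (carrier R) K = K"
proof
  show "K \<subseteq> ideal_smult R M (carrier R) K"
    using ideal_smult_incl[of \<one> "carrier R" _ K] sub_carrier[OF assms] by force
qed (use assms ideal_smult_sub in auto)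

text \<open>For fixed \<open>x\<close> the scalars carrying \<open>x\<close> into \<open>H\<close>
  form an ideal, so testing a generating set is enough. Inclusions for products with
  \<open>J\<close> reduce to the \<open>y_i\<close> in this way.\<close>

lemma ideal_smult_Idl_least:
  assumes S: "S \<subseteq> carrier R" and K: "K \<subseteq> carrier M" and H: "submodule H R M"
    and *: "\<And>a x. a \<in> S \<Longrightarrow> x \<in> K \<Longrightarrow> a \<bullet> x \<in> H"
  shows "ideal_smult R M (Idl S) K \<subseteq> H"
proof (rule ideal_smult_least[OF H])
  fix a x assume a: "a \<in> Idl S" and x: "x \<in> K"
  have "Idl S \<subseteq> colon H x"
    by (rule R.genideal_minimal[OF ideal_colon]) (use x H K S * in \<open>auto simp: colon_def\<close>)
  then show "a \<bullet> x \<in> H" using a by (auto simp: colon_def)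
qed

lemma ideal_smult_prod:
  assumes I: "ideal I R" and J: "ideal J R" and K: "submodule K R M"
  shows "ideal_smult R M (ideal_prod R I J) K = ideal_smult R M I (ideal_smult R M J K)"
proof
  have Ic: "I \<subseteq> carrier R" and Jc: "J \<subseteq> carrier R" and Kc: "K \<subseteq> carrier M"
    using ideal.Icarr[OF I] ideal.Icarr[OF J] sub_carrier[OF K] by auto
  have JK: "submodule (ideal_smult R M J K) R M" by (rule submodule_ideal_smult[OF Jc Kc])
  have IJK: "submodule (ideal_smult R M I (ideal_smult R M J K)) R M"
    by (rule submodule_ideal_smult[OF Ic]) (use sub_carrier[OF JK] in auto)
  have L: "submodule (ideal_smult R M (ideal_prod R I J) K) R M"
    by (rule submodule_ideal_smult[OF R.ideal_prod_in_carrier[OF I J] Kc])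
  show "ideal_smult R M (ideal_prod R I J) K \<subseteq> ideal_smult R M I (ideal_smult R M J K)"
  proof (rule ideal_smult_least[OF IJK])
    fix a x assume a: "a \<in> ideal_prod R I J" and x: "x \<in> K"
    have IJc: "\<And>a. a \<in> ideal_prod R I J \<Longrightarrow> a \<in> carrier R"
      using R.ideal_prod_in_carrier[OF I J] by blast
    show "a \<bullet> x \<in> ideal_smult R M I (ideal_smult R M J K)"
      using a
    proof induct
      case (prod i j)
      then show ?case using x Ic Jc Kc ideal_smult_incl
        by (auto simp: smult_assoc1 subset_iff)
    next
      case (sum s1 s2)
      then show ?case using x Kc IJc sub_add[OF IJK] by (auto simp: smult_l_distr subset_iff)
    qed
  qed
  show "ideal_smult R M I (ideal_smult R M J K) \<subseteq> ideal_smult R M (ideal_prod R I J) K"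
  proof (rule ideal_smult_least[OF L])
    fix a x assume a: "a \<in> I" and x: "x \<in> ideal_smult R M J K"
    have "ideal_smult R M J K \<subseteq> {x \<in> carrier M. a \<bullet> x \<in> ideal_smult R M (ideal_prod R I J) K}"
    proof (rule ideal_smult_least)
      show "submodule {x \<in> carrier M. a \<bullet> x \<in> ideal_smult R M (ideal_prod R I J) K} R M"
        by (rule submodule_preimage[OF carrier_is_submodule L]) (use a Ic in auto)
      fix b y assume "b \<in> J" "y \<in> K"
      then show "b \<bullet> y \<in> {x \<in> carrier M. a \<bullet> x \<in> ideal_smult R M (ideal_prod R I J) K}"
        using a Ic Jc Kc ideal_smult_incl[OF ideal_prod.prod[of a I b J R], of y K]
        by (auto simp: smult_assoc1 subset_iff)
    qed
    then show "a \<bullet> x \<in> ideal_smult R M (ideal_prod R I J) K" using x by auto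
  qed
qed

section \<open>Powers of an ideal applied to a submodule\<close>

definition ipow :: "'a set \<Rightarrow> nat \<Rightarrow> 'c set \<Rightarrow> 'c set" where
  "ipow I n K = pow_smult R M I n K"

lemma ideal_pow_0: "ideal_pow R I 0 = carrier R"
  by (simp add: ideals_set_def nat_pow_def)

lemma ideal_pow_Suc: "ideal_pow R I (Suc n) = ideal_prod R (ideal_pow R I n) I"
  by (simp add: ideals_set_def nat_pow_def)

lemma ideal_ideal_pow: "ideal I R \<Longrightarrow> ideal (ideal_pow R I n) R"
proof (induct n)
  case 0
  show ?case unfolding ideal_pow_0 by (rule R.oneideal)
next
  case (Suc n)
  then show ?case unfolding ideal_pow_Suc by (simp only: R.ideal_prod_is_ideal)
qed

lemma submodule_ipow: "ideal I R \<Longrightarrow> submodule K R M \<Longrightarrow> submodule (ipow I n K) R M"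
  unfolding ipow_def
  by (rule submodule_ideal_smult) (use ideal.Icarr[OF ideal_ideal_pow] sub_carrier in auto)

lemma submodule_ideal_smult_ideal:
  "ideal I R \<Longrightarrow> submodule K R M \<Longrightarrow> submodule (ideal_smult R M I K) R M"
  by (rule submodule_ideal_smult) (use ideal.Icarr sub_carrier in auto)

lemma ipow_0: "submodule K R M \<Longrightarrow> ipow I 0 K = K"
  unfolding ipow_def ideal_pow_0 by (rule ideal_smult_carrier)

lemma ipow_Suc':
  "ideal I R \<Longrightarrow> submodule K R M \<Longrightarrow> ipow I (Suc n) K = ipow I n (ideal_smult R M I K)"
  unfolding ipow_def ideal_pow_Suc by (rule ideal_smult_prod[OF ideal_ideal_pow])

text \<open>The monoid power multiplies on the right, which puts the new factor innermost in
  \<open>ipow_Suc'\<close>. Induction with \<open>K\<close> arbitrary moves it outermost, the form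
  in which powers become a family.\<close>

lemma ipow_Suc:
  assumes "ideal I R" "submodule K R M"
  shows "ipow I (Suc n) K = ideal_smult R M I (ipow I n K)"
  using assms(2)
proof (induct n arbitrary: K)
  case 0
  then show ?case using assms(1) by (simp add: ipow_Suc' ipow_0 submodule_ideal_smult_ideal)
next
  case (Suc n)
  then show ?case using assms(1) by (metis ipow_Suc' submodule_ideal_smult_ideal)
qed

lemma ipow_add:
  assumes "ideal I R" "submodule K R M"
  shows "ipow I (m + n) K = ipow I m (ipow I n K)"
  by (induct m) (simp_all add: assms ipow_0 ipow_Suc submodule_ipow)

lemma ipow_decreasing:
  assumes "ideal I R" "submodule K R M" "m \<le> n"
  shows "ipow I n K \<subseteq> ipow I m K"
  using assms(3)
proof (induct n rule: dec_induct)
  case (step n)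
  have "ipow I (Suc n) K \<subseteq> ipow I n K"
    unfolding ipow_Suc[OF assms(1,2)]
    by (rule ideal_smult_sub) (use submodule_ipow assms ideal.Icarr[OF assms(1)] in auto)
  then show ?case using step by auto
qed simp

lemma ipow_mono:
  assumes "ideal I R" "submodule L R M" "K \<subseteq> L"
  shows "ipow I n K \<subseteq> ipow I n L"
  unfolding ipow_def
  by (rule ideal_smult_mono)
     (use assms ideal.Icarr[OF ideal_ideal_pow[OF assms(1)]] sub_carrier[OF assms(2)] in auto)

end


section \<open>Noetherian families of submodules\<close>

context module
begin

text \<open>Closure is asked only for the scalars in \<open>B\<close>, so that a single generator
  can be adjoined to \<open>B\<close>, as Hilbert's argument needs. The index plays the role of the
  degree; one element of \<open>M\<close> may occur at several levels.\<close>

definition family :: "'a set \<Rightarrow> (nat \<Rightarrow> 'c set) \<Rightarrow> bool" where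
  "family B H \<longleftrightarrow> (\<forall>n. submodule (H n) R M) \<and> (\<forall>b\<in>B. \<forall>n. \<forall>x\<in>H n. b \<bullet> x \<in> H (Suc n))"

text \<open>Only the members of the chain are families; the bound \<open>E\<close> is any sequence
  of sets. Hence the condition passes to every pointwise smaller sequence.\<close>

definition noeth :: "'a set \<Rightarrow> (nat \<Rightarrow> 'c set) \<Rightarrow> bool" where
  "noeth B E \<longleftrightarrow> (\<forall>H. (\<forall>m. family B (H m) \<and> H m \<le> E \<and> H m \<le> H (Suc m)) \<longrightarrow>
     (\<exists>m0. \<forall>m\<ge>m0. H m = H m0))"

lemma familyI:
  "(\<And>n. submodule (H n) R M) \<Longrightarrow>
    (\<And>b n x. b \<in> B \<Longrightarrow> x \<in> H n \<Longrightarrow> b \<bullet> x \<in> H (Suc n)) \<Longrightarrow> family B H"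
  by (simp add: family_def)

lemma family_sub: "family B H \<Longrightarrow> submodule (H n) R M"
  by (simp add: family_def)

lemma family_mult: "family B H \<Longrightarrow> b \<in> B \<Longrightarrow> x \<in> H n \<Longrightarrow> b \<bullet> x \<in> H (Suc n)"
  by (simp add: family_def)

lemma smult_pow_Suc:
  assumes "a \<in> carrier R" "x \<in> carrier M"
  shows "(a [^] Suc k) \<bullet> x = a \<bullet> ((a [^] k) \<bullet> x)"
  using assms by (simp add: smult_assoc1 R.m_comm[of "a [^] k" a])

lemma family_mult_pow:
  assumes "family B H" "b \<in> B" "b \<in> carrier R" "x \<in> H n"
  shows "(b [^] k) \<bullet> x \<in> H (n + k)"
proof (induct k)
  case 0
  then show ?case using assms sub_carrier[OF family_sub] by auto
next
  case (Suc k)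
  have "(b [^] Suc k) \<bullet> x = b \<bullet> ((b [^] k) \<bullet> x)"
    by (rule smult_pow_Suc[OF assms(3) sub_carrier[OF family_sub[OF assms(1)] assms(4)]])
  then show ?case using Suc family_mult[OF assms(1,2)] by simp
qed

lemma noethE:
  assumes "noeth B E" "\<And>m. family B (H m)" "\<And>m. H m \<le> E" "\<And>m. H m \<le> H (Suc m)"
  obtains m0 where "\<And>m. m \<ge> m0 \<Longrightarrow> H m = H m0"
  using assms unfolding noeth_def by meson

lemma noeth_mono: "noeth B E \<Longrightarrow> E' \<le> E \<Longrightarrow> noeth B E'"
  unfolding noeth_def by (meson order_trans)

text \<open>The kernel-image argument for multiplication by \<open>a\<close>: the kernel lies in
  \<open>K'\<close>, the image in \<open>E\<close>. Once both traces of a chain are constant, an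
  element \<open>x\<close> of a later member has the same image as some \<open>u\<close> of an
  earlier one, and \<open>x - u\<close> lies in the stable kernel.\<close>

lemma noeth_extension:
  assumes K': "noeth B K'" and E: "noeth B E" and B: "B \<subseteq> carrier R" and a: "a \<in> carrier R"
    and KE: "\<And>n k. k \<in> K n \<Longrightarrow> a \<bullet> k \<in> E n"
    and ker: "\<And>n k. k \<in> K n \<Longrightarrow> a \<bullet> k = \<zero>\<^bsub>M\<^esub> \<Longrightarrow> k \<in> K' n"
  shows "noeth B K"
  unfolding noeth_def
proof (intro allI impI)
  fix H assume H: "\<forall>m. family B (H m) \<and> H m \<le> K \<and> H m \<le> H (Suc m)"
  have Hs: "submodule (H m n) R M" for m n using H family_sub by blast
  have HK: "x \<in> K n" if "x \<in> H m n" for m n x using H that by (auto simp: le_fun_def)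
  define H1 where "H1 m n = {x \<in> H m n. a \<bullet> x \<in> {\<zero>\<^bsub>M\<^esub>}}" for m n
  define H2 where "H2 m n = (\<lambda>x. a \<bullet> x) ` H m n" for m n
  have comm: "a \<bullet> (b \<bullet> x) = b \<bullet> (a \<bullet> x)" if "b \<in> B" "x \<in> H m n" for b x m n
    using that smult_commute[of a b x] B a sub_carrier[OF Hs] by auto
  have "family B (H1 m)" for m
  proof (rule familyI)
    show "submodule (H1 m n) R M" for n
      unfolding H1_def by (rule submodule_preimage[OF Hs submodule_zero a])
    show "b \<bullet> x \<in> H1 m (Suc n)" if "b \<in> B" "x \<in> H1 m n" for b n x
      using that H comm[of b x m n] B by (auto simp: H1_def family_def)
  qed
  moreover have "H1 m \<le> K'" for m
    using ker HK by (auto simp: H1_def le_fun_def)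
  moreover have "H1 m \<le> H1 (Suc m)" for m
    using H unfolding H1_def le_fun_def by blast
  ultimately obtain m1 where m1: "\<And>m. m \<ge> m1 \<Longrightarrow> H1 m = H1 m1" using noethE[OF K'] by metis
  have "family B (H2 m)" for m
  proof (rule familyI)
    show "submodule (H2 m n) R M" for n
      unfolding H2_def by (rule submodule_image[OF Hs a])
    show "b \<bullet> x \<in> H2 m (Suc n)" if bx: "b \<in> B" "x \<in> H2 m n" for b n x
    proof -
      obtain u where u: "u \<in> H m n" "x = a \<bullet> u" using bx by (auto simp: H2_def)
      then have "b \<bullet> u \<in> H m (Suc n)" using bx H family_mult by blast
      then show ?thesis using comm[OF bx(1) u(1)] u by (force simp: H2_def)
    qed
  qed
  moreover have "H2 m \<le> E" for m
    using KE HK by (auto simp: H2_def le_fun_def)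
  moreover have "H2 m \<le> H2 (Suc m)" for m
    using H unfolding H2_def le_fun_def by blast
  ultimately obtain m2 where m2: "\<And>m. m \<ge> m2 \<Longrightarrow> H2 m = H2 m2" using noethE[OF E] by metis
  define m0 where "m0 = max m1 m2"
  have up: "H i n \<subseteq> H j n" if "i \<le> j" for i j n
    using lift_Suc_mono_le[of H i j] H that by (auto simp: le_fun_def)
  have "H m = H m0" if m: "m \<ge> m0" for m
  proof
    fix n
    have "x \<in> H m0 n" if x: "x \<in> H m n" for x
    proof -
      have "H2 m = H2 m0" using m2[of m] m2[of m0] m by (auto simp: m0_def)
      then have "H2 m n = H2 m0 n" by simp
      then have "a \<bullet> x \<in> H2 m0 n" using x H2_def by blast
      then obtain u where u: "u \<in> H m0 n" "a \<bullet> x = a \<bullet> u" by (auto simp: H2_def)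
      have uc: "u \<in> carrier M" and xc: "x \<in> carrier M" using u x sub_carrier[OF Hs] by auto
      have "x \<ominus>\<^bsub>M\<^esub> u \<in> H m n" using sub_minus[OF Hs x] u up[OF m] by auto
      moreover have "a \<bullet> (x \<ominus>\<^bsub>M\<^esub> u) = \<zero>\<^bsub>M\<^esub>"
        unfolding smult_minus[OF a xc uc] u(2) using a uc by (simp add: a_minus_def M.r_neg)
      ultimately have "x \<ominus>\<^bsub>M\<^esub> u \<in> H1 m n" by (simp add: H1_def)
      moreover have "H1 m = H1 m0" using m1[of m] m1[of m0] m by (auto simp: m0_def)
      ultimately have "x \<ominus>\<^bsub>M\<^esub> u \<in> H m0 n" by (simp add: H1_def)
      then have "(x \<ominus>\<^bsub>M\<^esub> u) \<oplus>\<^bsub>M\<^esub> u \<in> H m0 n" using u sub_add[OF Hs] by blast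
      then show ?thesis using uc xc by (simp add: a_minus_def M.add.m_assoc M.l_neg)
    qed
    then show "H m n = H m0 n" using up[OF m] by blast
  qed
  then show "\<exists>m0. \<forall>m\<ge>m0. H m = H m0" by blast
qed

text \<open>Hilbert's basis argument with \<open>y\<close> as the polynomial variable: \<open>psum y E i N\<close> holds the terms
  of \<open>y\<close>-degree below \<open>i\<close>, and \<open>lead y E H i\<close> the leading coefficients of the members of \<open>H\<close> of
  \<open>y\<close>-degree \<open>i\<close>.\<close>

primrec psum :: "'a \<Rightarrow> (nat \<Rightarrow> 'c set) \<Rightarrow> nat \<Rightarrow> nat \<Rightarrow> 'c set" where
  "psum y E 0 N = {\<zero>\<^bsub>M\<^esub>}"
| "psum y E (Suc i) N =
     (if i \<le> N then psum y E i N <+>\<^bsub>M\<^esub> ((\<lambda>k. (y [^] i) \<bullet> k) ` E (N - i))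
      else psum y E i N)"

definition lead :: "'a \<Rightarrow> (nat \<Rightarrow> 'c set) \<Rightarrow> (nat \<Rightarrow> 'c set) \<Rightarrow> nat \<Rightarrow> nat \<Rightarrow> 'c set" where
  "lead y E H i n =
     {k \<in> E n. (y [^] i) \<bullet> k \<in> H (n + i) <+>\<^bsub>M\<^esub> psum y E i (n + i)}"

context
  fixes y B E
  assumes y: "y \<in> carrier R" and B: "B \<subseteq> carrier R" and famE: "family B E"
begin

lemma submodule_psum: "submodule (psum y E i N) R M"
proof (induct i)
  case (Suc i)
  then show ?case
    using submodule_sum[OF Suc submodule_image[OF family_sub[OF famE, of "N - i"]], of "y [^] i"] y
    by simp
qed (simp add: submodule_zero)

lemma submodule_pow_image: "submodule ((\<lambda>k. (y [^] i) \<bullet> k) ` E j) R M" for i :: nat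
  by (rule submodule_image[OF family_sub[OF famE]]) (use y in simp)

lemma psum_Suc: "psum y E i N \<subseteq> psum y E (Suc i) N"
  using sum_upper1[OF submodule_pow_image, of "psum y E i N" i "N - i"]
    sub_carrier[OF submodule_psum[of i N]] by auto

lemma psum_mono: "i \<le> j \<Longrightarrow> psum y E i N \<subseteq> psum y E j N"
  using lift_Suc_mono_le[of "\<lambda>i. psum y E i N"] psum_Suc by auto

lemma psum_incl: "i \<le> N \<Longrightarrow> k \<in> E (N - i) \<Longrightarrow> (y [^] i) \<bullet> k \<in> psum y E (Suc i) N"
  using sum_upper2[OF submodule_psum, of "((\<lambda>k. (y [^] i) \<bullet> k) ` E (N - i))" i N]
    sub_carrier[OF submodule_pow_image[of i "N - i"]] by auto

lemma psum_SucE: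
  assumes "x \<in> psum y E (Suc i) N"
  obtains "x \<in> psum y E i N"
  | f k where "i \<le> N" "f \<in> psum y E i N" "k \<in> E (N - i)" "x = f \<oplus>\<^bsub>M\<^esub> (y [^] i) \<bullet> k"
  using assms by (auto simp: mem_set_add split: if_splits)

lemma psum_op:
  assumes b: "b \<in> B"
  shows "x \<in> psum y E i N \<Longrightarrow> b \<bullet> x \<in> psum y E i (Suc N)"
proof (induct i arbitrary: x)
  case 0
  then show ?case using b B by auto
next
  case (Suc i)
  from Suc(2) show ?case
  proof (cases rule: psum_SucE)
    case 1
    then show ?thesis using Suc(1) psum_Suc by blast
  next
    case (2 f k)
    have c: "f \<in> carrier M" "k \<in> carrier M" "b \<in> carrier R"
      using 2 sub_carrier[OF submodule_psum] sub_carrier[OF family_sub[OF famE]] b B by auto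
    have "b \<bullet> k \<in> E (Suc N - i)"
      using family_mult[OF famE b 2(3)] 2(1) by (simp add: Suc_diff_le)
    then have "(y [^] i) \<bullet> (b \<bullet> k) \<in> psum y E (Suc i) (Suc N)"
      by (rule psum_incl[rotated]) (use 2 in simp)
    moreover have "b \<bullet> f \<in> psum y E (Suc i) (Suc N)"
      using Suc(1)[OF 2(2)] psum_Suc by blast
    moreover have "b \<bullet> x = b \<bullet> f \<oplus>\<^bsub>M\<^esub> (y [^] i) \<bullet> (b \<bullet> k)"
      using 2(4) c y smult_commute[of b "y [^] i" k] by (simp add: smult_r_distr)
    ultimately show ?thesis using sub_add[OF submodule_psum] by metis
  qed
qed

lemma psum_mult:
  "x \<in> psum y E i N \<Longrightarrow> y \<bullet> x \<in> psum y E (Suc i) (Suc N)"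
proof (induct i arbitrary: x)
  case 0
  then show ?case
    using y sub_zero[OF submodule_psum, of "Suc 0" "Suc N"] by (simp del: psum.simps(2))
next
  case (Suc i)
  from Suc(2) show ?case
  proof (cases rule: psum_SucE)
    case 1
    then show ?thesis using Suc(1) psum_Suc by blast
  next
    case (2 f k)
    have c: "f \<in> carrier M" "k \<in> carrier M"
      using 2 sub_carrier[OF submodule_psum] sub_carrier[OF family_sub[OF famE]] by auto
    have "(y [^] Suc i) \<bullet> k \<in> psum y E (Suc (Suc i)) (Suc N)"
      by (rule psum_incl) (use 2 in auto)
    moreover have "y \<bullet> f \<in> psum y E (Suc (Suc i)) (Suc N)"
      using Suc(1)[OF 2(2)] psum_Suc by blast
    moreover have "y \<bullet> x = y \<bullet> f \<oplus>\<^bsub>M\<^esub> (y [^] Suc i) \<bullet> k"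
      using 2(4) c y by (simp add: smult_r_distr smult_assoc1 R.m_comm[of "y [^] i" y])
    ultimately show ?thesis using sub_add[OF submodule_psum] by metis
  qed
qed

lemma submodule_lead:
  assumes "family (insert y B) H" shows "submodule (lead y E H i n) R M"
  unfolding lead_def
  by (rule submodule_preimage[OF family_sub[OF famE]
        submodule_sum[OF family_sub[OF assms] submodule_psum]]) (use y in simp)

lemma family_lead:
  assumes H: "family (insert y B) H" shows "family B (lead y E H i)"
proof (rule familyI)
  show "submodule (lead y E H i n) R M" for n by (rule submodule_lead[OF H])
  fix b n x assume b: "b \<in> B" and x: "x \<in> lead y E H i n"
  obtain h f where hf: "h \<in> H (n + i)" "f \<in> psum y E i (n + i)"
    "(y [^] i) \<bullet> x = h \<oplus>\<^bsub>M\<^esub> f" and xE: "x \<in> E n"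
    using x by (auto simp: lead_def mem_set_add)
  have c: "h \<in> carrier M" "f \<in> carrier M" "b \<in> carrier R" "x \<in> carrier M"
    using hf xE sub_carrier[OF submodule_psum] sub_carrier[OF family_sub[OF famE]]
      sub_carrier[OF family_sub[OF H]] b B by auto
  have "(y [^] i) \<bullet> (b \<bullet> x) = b \<bullet> h \<oplus>\<^bsub>M\<^esub> b \<bullet> f"
    using c y smult_commute[of b "y [^] i" x] hf by (simp add: smult_r_distr)
  moreover have "b \<bullet> h \<in> H (Suc n + i)" using family_mult[OF H _ hf(1)] b by simp
  moreover have "b \<bullet> f \<in> psum y E i (Suc n + i)" using psum_op[OF b hf(2)] by simp
  ultimately show "b \<bullet> x \<in> lead y E H i (Suc n)"
    using family_mult[OF famE b xE] unfolding lead_def mem_set_add by blast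
qed

lemma lead_mono: "H \<le> H' \<Longrightarrow> lead y E H i \<le> lead y E H' i"
  by (auto simp: lead_def le_fun_def mem_set_add)

lemma lead_Suc:
  assumes H: "family (insert y B) H" shows "lead y E H i \<le> lead y E H (Suc i)"
proof (rule le_funI, rule subsetI)
  fix n x assume x: "x \<in> lead y E H i n"
  obtain h f where hf: "h \<in> H (n + i)" "f \<in> psum y E i (n + i)"
    "(y [^] i) \<bullet> x = h \<oplus>\<^bsub>M\<^esub> f" and xE: "x \<in> E n"
    using x by (auto simp: lead_def mem_set_add)
  have c: "h \<in> carrier M" "f \<in> carrier M" "x \<in> carrier M"
    using hf xE sub_carrier[OF submodule_psum] sub_carrier[OF family_sub[OF famE]]
      sub_carrier[OF family_sub[OF H]] by auto
  have "(y [^] Suc i) \<bullet> x = y \<bullet> ((y [^] i) \<bullet> x)"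
    using c y by (simp add: smult_assoc1 R.m_comm[of "y [^] i" y])
  then have "(y [^] Suc i) \<bullet> x = y \<bullet> h \<oplus>\<^bsub>M\<^esub> y \<bullet> f"
    using c y hf by (simp add: smult_r_distr)
  moreover have "y \<bullet> h \<in> H (n + Suc i)" using family_mult[OF H _ hf(1)] by simp
  moreover have "y \<bullet> f \<in> psum y E (Suc i) (n + Suc i)"
    using psum_mult[OF hf(2)] by simp
  ultimately show "x \<in> lead y E H (Suc i) n"
    using xE unfolding lead_def mem_set_add by blast
qed

text \<open>Descent on the \<open>y\<close>-degree: the top coefficient of an element of
  \<open>H'\<close> is also a leading coefficient of \<open>H\<close>, so subtracting a suitable
  member of \<open>H\<close> leaves an element of \<open>H'\<close> of smaller
  \<open>y\<close>-degree. Expressions in powers of \<open>y\<close> need not be unique; only their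
  existence is used.\<close>

lemma lead_determines:
  assumes H: "family (insert y B) H" and H': "family (insert y B) H'" and le: "H \<le> H'"
    and top: "H' \<le> (\<lambda>N. psum y E (Suc N) N)"
    and eq: "\<And>i. lead y E H' i \<le> lead y E H i"
  shows "H' \<le> H"
proof -
  have "x \<in> H' N \<Longrightarrow> x \<in> psum y E i N \<Longrightarrow> x \<in> H N" for i x N
  proof (induct i arbitrary: x)
    case 0
    then show ?case using sub_zero[OF family_sub[OF H]] by simp
  next
    case (Suc i)
    from Suc(3) show ?case
    proof (cases rule: psum_SucE)
      case 1
      then show ?thesis using Suc by blast
    next
      case (2 f k)
      have c: "f \<in> carrier M" "k \<in> carrier M" "x \<in> carrier M"
        using 2 Suc(2) sub_carrier[OF submodule_psum] sub_carrier[OF family_sub[OF famE]]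
          sub_carrier[OF family_sub[OF H']] by auto
      have yk: "(y [^] i) \<bullet> k \<in> carrier M" using c y by simp
      have "(y [^] i) \<bullet> k = x \<oplus>\<^bsub>M\<^esub> (\<ominus>\<^bsub>M\<^esub> f)"
        using 2(4) c yk by (simp add: M.add.m_ac M.r_neg1 M.r_neg2)
      moreover have "\<ominus>\<^bsub>M\<^esub> f \<in> psum y E i N"
        using 2(2) submoduleE(3)[OF submodule_psum] by blast
      ultimately have "k \<in> lead y E H' i (N - i)"
        using 2 Suc(2) unfolding lead_def mem_set_add by auto
      then have "k \<in> lead y E H i (N - i)" using eq[of i] by (auto simp: le_fun_def)
      then obtain h f' where hf: "h \<in> H N" "f' \<in> psum y E i N"
        "(y [^] i) \<bullet> k = h \<oplus>\<^bsub>M\<^esub> f'"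
        using 2(1) by (auto simp: lead_def mem_set_add)
      have c': "h \<in> carrier M" "f' \<in> carrier M"
        using hf sub_carrier[OF submodule_psum] sub_carrier[OF family_sub[OF H]] by auto
      have x: "x = (f \<oplus>\<^bsub>M\<^esub> f') \<oplus>\<^bsub>M\<^esub> h" using 2(4) hf(3) c c' by (simp add: M.add.m_ac)
      have hH': "h \<in> H' N" using hf(1) le by (auto simp: le_fun_def)
      have ff: "f \<oplus>\<^bsub>M\<^esub> f' \<in> psum y E i N"
        using 2(2) hf(2) sub_add[OF submodule_psum] by blast
      have "f \<oplus>\<^bsub>M\<^esub> f' \<in> H' N"
        by (rule sub_add_cancel[OF family_sub[OF H'] hH']) (use c c' x Suc(2) in auto)
      then have "f \<oplus>\<^bsub>M\<^esub> f' \<in> H N" using Suc(1) ff by blast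
      then show ?thesis using x hf(1) sub_add[OF family_sub[OF H]] by blast
    qed
  qed
  then show ?thesis using top unfolding le_fun_def by blast
qed

lemma fam_psum: "family (insert y B) (\<lambda>N. psum y E (Suc N) N)"
proof (rule familyI)
  fix b n x assume "b \<in> insert y B" "x \<in> psum y E (Suc n) n"
  then show "b \<bullet> x \<in> psum y E (Suc (Suc n)) (Suc n)"
    using psum_mult[of x "Suc n" n] psum_op[of b x "Suc n" n]
      psum_Suc[of "Suc n" "Suc n"] by blast
qed (rule submodule_psum)

lemma psum_contains: "E N \<subseteq> psum y E (Suc N) N"
proof
  fix k assume k: "k \<in> E N"
  then have "(y [^] (0::nat)) \<bullet> k \<in> psum y E (Suc 0) N"
    by (intro psum_incl) auto
  then show "k \<in> psum y E (Suc N) N"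
    using k sub_carrier[OF family_sub[OF famE]] psum_mono[of "Suc 0" "Suc N" N]
    by (auto simp del: psum.simps)
qed

text \<open>The leading families \<open>L i m\<close> form an array increasing in both indices. Its
  diagonal stabilizes at some \<open>m1\<close> and thereby controls all rows beyond
  \<open>m1\<close>; the finitely many remaining rows are stabilized one by one.\<close>

lemma noeth_psum:
  assumes E: "noeth B E"
  shows "noeth (insert y B) (\<lambda>N. psum y E (Suc N) N)"
  unfolding noeth_def
proof (intro allI impI)
  fix H assume H: "\<forall>m. family (insert y B) (H m) \<and> H m \<le> (\<lambda>N. psum y E (Suc N) N) \<and> H m \<le> H (Suc m)"
  define L where "L i m = lead y E (H m) i" for i m
  have famL: "family B (L i m)" for i m unfolding L_def using H family_lead by blast
  have LE: "L i m \<le> E" for i m by (auto simp: L_def lead_def le_fun_def)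
  have up1: "L i m \<le> L i (Suc m)" for i m unfolding L_def using H lead_mono by blast
  have up2: "L i m \<le> L (Suc i) m" for i m unfolding L_def using H lead_Suc by blast
  have up: "L i m \<le> L j k" if "i \<le> j" "m \<le> k" for i j k m
    using lift_Suc_mono_le[of "L i" m k] up1 lift_Suc_mono_le[of "\<lambda>i. L i k" i j] up2 that
    by (meson order_trans)
  obtain m1 where m1: "\<And>m. m \<ge> m1 \<Longrightarrow> L m m = L m1 m1"
    using noethE[OF E, of "\<lambda>m. L m m"] famL LE up[of _ "Suc _" _ "Suc _"] by (metis le_Suc_eq order_refl)
  have "\<exists>m2. \<forall>m\<ge>m2. L i m = L i m2" for i
    using noethE[OF E, of "L i"] famL LE up1 by metis
  then obtain s where s: "\<And>i m. m \<ge> s i \<Longrightarrow> L i m = L i (s i)" by metis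
  define m0 where "m0 = max m1 (Max (s ` {..m1}))"
  have s_le: "s i \<le> m0" if "i \<le> m1" for i
    using that by (auto simp: m0_def intro!: le_max_iff_disj[THEN iffD2] disjI2 Max_ge)
  have Leq: "L i m = L i m0" if m: "m \<ge> m0" for i m
  proof (cases "i \<le> m1")
    case True
    then show ?thesis using s[of i m] s[of i m0] s_le[of i] m by auto
  next
    case False
    have m0m1: "m1 \<le> m0" by (simp add: m0_def)
    \<comment> \<open>An entry beyond \<open>(m1, m1)\<close> is squeezed between that diagonal
      entry and a later diagonal entry, which is the same.\<close>
    have "L i k = L m1 m1" if k: "k \<ge> m0" for k
    proof (rule antisym)
      show "L m1 m1 \<le> L i k" using up[of m1 i m1 k] False k m0m1 by auto
      have "L i k \<le> L (max i k) (max i k)" by (rule up) auto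
      also have "\<dots> = L m1 m1" using m1[of "max i k"] False by auto
      finally show "L i k \<le> L m1 m1" .
    qed
    then show ?thesis using m by simp
  qed
  have "H m = H m0" if m: "m \<ge> m0" for m
  proof (rule antisym)
    show le: "H m0 \<le> H m" using lift_Suc_mono_le[of H m0 m] H m by blast
    show "H m \<le> H m0"
      using lead_determines[OF _ _ le] H Leq[OF m] unfolding L_def by (metis order_refl)
  qed
  then show "\<exists>m0. \<forall>m\<ge>m0. H m = H m0" by blast
qed

end

section \<open>Noetherian families over a Noetherian module\<close>

definition noetherian_module :: bool where
  "noetherian_module \<longleftrightarrow> (\<forall>H::nat \<Rightarrow> 'c set. (\<forall>m. submodule (H m) R M \<and> H m \<subseteq> H (Suc m)) \<longrightarrow>
     (\<exists>m0. \<forall>m\<ge>m0. H m = H m0))"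

text \<open>Begin with \<open>M\<close> in level 0 and zero elsewhere, where the chain condition is
  that of \<open>M\<close>, and adjoin the scalars of \<open>B\<close> one at a time.\<close>

lemma noeth_exists:
  assumes M: noetherian_module and "finite B" "B \<subseteq> carrier R"
  shows "\<exists>E. family B E \<and> noeth B E \<and> carrier M \<subseteq> E 0"
  using assms(2,3)
proof (induct B rule: finite_induct)
  case empty
  define E :: "nat \<Rightarrow> 'c set" where "E n = (if n = 0 then carrier M else {\<zero>\<^bsub>M\<^esub>})" for n
  have "family {} E" by (rule familyI) (simp_all add: E_def carrier_is_submodule submodule_zero)
  moreover have "noeth {} E"
    unfolding noeth_def
  proof (intro allI impI)
    fix H assume H: "\<forall>m. family {} (H m) \<and> H m \<le> E \<and> H m \<le> H (Suc m)"
    then have "\<forall>m. submodule (H m 0) R M \<and> H m 0 \<subseteq> H (Suc m) 0" by (auto simp: family_def le_fun_def)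
    then obtain m0 where m0: "\<And>m. m \<ge> m0 \<Longrightarrow> H m 0 = H m0 0"
      using M[unfolded noetherian_module_def, THEN spec, of "\<lambda>m. H m 0"] by blast
    have "H m n = {\<zero>\<^bsub>M\<^esub>}" if "n \<noteq> 0" for m n
    proof -
      have "H m n \<subseteq> E n" "submodule (H m n) R M" using H by (auto simp: family_def le_fun_def)
      then show ?thesis using that sub_zero unfolding E_def by fastforce
    qed
    then have "H m = H m0" if "m \<ge> m0" for m using m0[OF that] by (metis ext)
    then show "\<exists>m0. \<forall>m\<ge>m0. H m = H m0" by blast
  qed
  moreover have "carrier M \<subseteq> E 0" by (simp add: E_def)
  ultimately show ?case by blast
next
  case (insert y B)
  then obtain E where E: "family B E" "noeth B E" "carrier M \<subseteq> E 0" by auto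
  have yB: "y \<in> carrier R" "B \<subseteq> carrier R" using insert by auto
  show ?case
    using fam_psum[OF yB E(1)] noeth_psum[OF yB E(1,2)]
      psum_contains[OF yB E(1), of 0] E(3) by (meson order_trans)
qed

text \<open>Since \<open>V 0\<close> lies in \<open>M\<close>, induction puts \<open>V\<close>
  inside the Noetherian family of \<open>noeth_exists\<close>.\<close>

lemma noeth_generated:
  assumes M: noetherian_module and B: "finite B" "B \<subseteq> carrier R"
    and V: "\<And>n. submodule (V n) R M" "\<And>n. V (Suc n) = ideal_smult R M (Idl B) (V n)"
  shows "noeth B V"
proof -
  obtain E where E: "family B E" "noeth B E" "carrier M \<subseteq> E 0" using noeth_exists[OF M B] by blast
  have "V n \<subseteq> E n" for n
  proof (induct n)
    case 0
    then show ?case using sub_carrier[OF V(1)] E(3) by blast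
  next
    case (Suc n)
    show ?case unfolding V(2)
      by (rule ideal_smult_Idl_least[OF B(2) _ family_sub[OF E(1)]])
        (use Suc sub_carrier[OF V(1)] family_mult[OF E(1)] in auto)
  qed
  then show ?thesis using noeth_mono[OF E(2)] by (simp add: le_fun_def)
qed

lemma family_Idl:
  assumes "B \<subseteq> carrier R" "family B V"
  shows "ideal_smult R M (Idl B) (V n) \<subseteq> V (Suc n)"
  by (rule ideal_smult_Idl_least[OF assms(1)])
    (use assms family_sub[OF assms(2)] sub_carrier family_mult[OF assms(2)] in auto)

text \<open>Let \<open>H m\<close> agree with \<open>V\<close> below level \<open>m\<close> and
  continue from \<open>V m\<close> by powers of \<open>J\<close> alone. These subfamilies ascend,
  and where the chain stops, \<open>V\<close> is generated by its terms up to that level.\<close>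

lemma noeth_eventually_generated:
  assumes B: "B \<subseteq> carrier R" and V: "family B V" "noeth B V"
  shows "\<exists>n0. \<forall>n\<ge>n0. V (Suc n) = ideal_smult R M (Idl B) (V n)"
proof -
  define J where "J = Idl B"
  have J: "ideal J R" unfolding J_def by (rule R.genideal_ideal[OF B])
  have BJ: "B \<subseteq> J" unfolding J_def by (rule R.genideal_self[OF B])
  have Vs: "submodule (V n) R M" for n using V family_sub by blast
  have JV: "ideal_smult R M J (V n) \<subseteq> V (Suc n)" for n
    unfolding J_def by (rule family_Idl[OF B V(1)])
  define H where "H m n = (if n < m then V n else ipow J (n - m) (V m))" for m n
  have step: "b \<bullet> x \<in> ipow J (Suc k) (V m)" if "b \<in> B" "x \<in> ipow J k (V m)" for b x k m
    unfolding ipow_Suc[OF J Vs] by (rule ideal_smult_incl) (use that BJ in auto)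
  have pwV: "ipow J k (V m) \<subseteq> V (m + k)" for k m
  proof (induct k)
    case (Suc k)
    have "ipow J (Suc k) (V m) \<subseteq> ideal_smult R M J (V (m + k))"
      unfolding ipow_Suc[OF J Vs]
      by (rule ideal_smult_mono) (use Suc ideal.Icarr[OF J] sub_carrier[OF Vs] in auto)
    then show ?case using JV[of "m + k"] by simp
  qed (simp add: ipow_0 Vs)
  have HV: "H m n \<subseteq> V n" for m n
    using pwV[of "n - m" m] by (auto simp: H_def)
  have "family B (H m)" for m
  proof (rule familyI)
    show "submodule (H m n) R M" for n by (simp add: H_def Vs submodule_ipow J)
    fix b n x assume bx: "b \<in> B" "x \<in> H m n"
    show "b \<bullet> x \<in> H m (Suc n)"
    proof (cases "n < m")
      case True
      then have "b \<bullet> x \<in> V (Suc n)" using bx family_mult[OF V(1)] by (auto simp: H_def)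
      then show ?thesis using True by (auto simp: H_def ipow_0 Vs not_less_eq less_Suc_eq)
    next
      case False
      then show ?thesis using step[of b x "n - m" m] bx by (simp add: H_def Suc_diff_le)
    qed
  qed
  moreover have "H m \<le> V" for m using HV by (simp add: le_fun_def)
  moreover have "H m \<le> H (Suc m)" for m
  proof (rule le_funI)
    fix n
    consider "n < m" | "n = m" | k where "n = Suc m + k"
      by (metis add_Suc_shift less_iff_Suc_add linorder_neqE_nat add_Suc add_Suc_right)
    then show "H m n \<le> H (Suc m) n"
    proof cases
      case 3
      have "ipow J (Suc k) (V m) = ipow J k (ideal_smult R M J (V m))" by (rule ipow_Suc'[OF J Vs])
      also have "\<dots> \<subseteq> ipow J k (V (Suc m))" by (rule ipow_mono[OF J Vs JV])
      finally show ?thesis using 3 by (simp add: H_def)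
    qed (simp_all add: H_def ipow_0 Vs)
  qed
  ultimately obtain m0 where m0: "\<And>m. m \<ge> m0 \<Longrightarrow> H m = H m0" using noethE[OF V(2)] by metis
  have V_eq: "V n = ipow J (n - m0) (V m0)" if "n \<ge> m0" for n
  proof -
    \<comment> \<open>Level \<open>n\<close> is still below the cut-off of \<open>H (Suc n)\<close>,
      where that family agrees with \<open>V\<close>.\<close>
    have "V n = H (Suc n) n" by (simp add: H_def)
    also have "\<dots> = H m0 n" using m0[of "Suc n"] that by simp
    finally show ?thesis using that by (simp add: H_def)
  qed
  have "V (Suc n) = ideal_smult R M J (V n)" if "n \<ge> m0" for n
    using V_eq[of n] V_eq[of "Suc n"] that ipow_Suc[OF J Vs, of "n - m0" m0] by (simp add: Suc_diff_le)
  then show ?thesis unfolding J_def by blast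
qed

end


section \<open>Noetherian modules and associated primes\<close>

lemma (in noetherian_ring) ideal_chain_stabilizes:
  assumes "\<And>m. ideal (I m) R" "\<And>m. I m \<subseteq> I (Suc m)"
  shows "\<exists>m0::nat. \<forall>m\<ge>m0. I m = I m0"
proof -
  have mono: "I i \<subseteq> I j" if "i \<le> j" for i j
    using lift_Suc_mono_le[of I i j] assms(2) that by auto
  have "subset.chain {I. ideal I R} (range I)"
    unfolding subset_chain_def using assms(1) mono nat_le_linear by blast
  then have "\<Union>(range I) \<in> range I" by (rule ideal_chain_is_trivial[rotated]) simp
  then obtain m0 where "\<Union>(range I) = I m0" by auto
  then have "I m = I m0" if "m \<ge> m0" for m using mono[OF that] by blast
  then show ?thesis by blast
qed

lemma (in noetherian_ring) ideal_set_has_maximal: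
  assumes "C \<noteq> {}" "\<And>I. I \<in> C \<Longrightarrow> ideal I R"
  shows "\<exists>Q\<in>C. \<forall>I\<in>C. Q \<subseteq> I \<longrightarrow> I = Q"
proof (rule subset_Zorn_nonempty[OF assms(1)])
  fix D assume D: "D \<noteq> {}" "subset.chain C D"
  then have "subset.chain {I. ideal I R} D" using assms(2) unfolding subset_chain_def by blast
  then have "\<Union>D \<in> D" by (rule ideal_chain_is_trivial[OF D(1)])
  then show "\<Union>D \<in> C" using D(2) unfolding subset_chain_def by blast
qed

context module
begin

section \<open>Finitely generated modules over a Noetherian ring\<close>

definition cyclic :: "'c \<Rightarrow> 'c set" where
  "cyclic x = (\<lambda>r. r \<bullet> x) ` carrier R"

lemma submodule_cyclic:
  assumes x: "x \<in> carrier M" shows "submodule (cyclic x) R M"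
proof (rule submodule_closedI)
  show "\<zero>\<^bsub>M\<^esub> \<in> cyclic x" unfolding cyclic_def using x by (metis R.zero_closed image_eqI smult_l_null)
  fix u v assume "u \<in> cyclic x" "v \<in> cyclic x"
  then show "u \<oplus>\<^bsub>M\<^esub> v \<in> cyclic x" unfolding cyclic_def using x by (auto simp: smult_l_distr[symmetric])
next
  fix a u assume "a \<in> carrier R" "u \<in> cyclic x"
  then show "a \<bullet> u \<in> cyclic x" unfolding cyclic_def using x by (auto simp: smult_assoc1[symmetric])
qed (use x in \<open>auto simp: cyclic_def\<close>)

lemma cyclic_self: "x \<in> carrier M \<Longrightarrow> x \<in> cyclic x"
  unfolding cyclic_def by (metis R.one_closed image_eqI smult_one)

lemma gen_insert_subset:
  assumes "s \<in> carrier M" "S \<subseteq> carrier M"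
  shows "gen_submodule R M (insert s S) \<subseteq> cyclic s <+>\<^bsub>M\<^esub> gen_submodule R M S"
proof (rule gen_least)
  have G: "submodule (gen_submodule R M S) R M" by (rule submodule_gen[OF assms(2)])
  show "submodule (cyclic s <+>\<^bsub>M\<^esub> gen_submodule R M S) R M"
    by (rule submodule_sum[OF submodule_cyclic[OF assms(1)] G])
  have "cyclic s \<subseteq> cyclic s <+>\<^bsub>M\<^esub> gen_submodule R M S"
    by (rule sum_upper1[OF G]) (use sub_carrier[OF submodule_cyclic[OF assms(1)]] in auto)
  moreover have "gen_submodule R M S \<subseteq> cyclic s <+>\<^bsub>M\<^esub> gen_submodule R M S"
    by (rule sum_upper2[OF submodule_cyclic[OF assms(1)]]) (use sub_carrier[OF G] in auto)
  ultimately show "insert s S \<subseteq> cyclic s <+>\<^bsub>M\<^esub> gen_submodule R M S"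
    using cyclic_self[OF assms(1)] gen_incl[of S] by blast
qed

text \<open>Induction on the generators: a chain is controlled by its intersection with the span
  \<open>K\<close> of the other generators and by the ideal of coefficients of \<open>s\<close>
  occurring in it. That ideal is \<open>(H m + K : s)\<close>, so the chain condition of
  \<open>R\<close> applies.\<close>

lemma fin_gen_noetherian:
  assumes R: "noetherian_ring R" and M: "fin_gen_module R M"
  shows noetherian_module
proof -
  interpret NR: noetherian_ring R by (rule R)
  have main: "\<exists>m0. \<forall>m\<ge>m0. H m = H m0"
    if "finite S" "S \<subseteq> carrier M" "\<And>m. submodule (H m) R M" "\<And>m. H m \<subseteq> H (Suc m)"
      "\<And>m. H m \<subseteq> gen_submodule R M S" for S and H :: "nat \<Rightarrow> 'c set"
    using that
  proof (induct S arbitrary: H rule: finite_induct)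
    case empty
    have "H m = {\<zero>\<^bsub>M\<^esub>}" for m
      using empty(4)[of m] gen_least[OF submodule_zero, of "{}"] sub_zero[OF empty(2)[of m]] by blast
    then show ?case by blast
  next
    case (insert s S)
    define K where "K = gen_submodule R M S"
    have s: "s \<in> carrier M" and S: "S \<subseteq> carrier M" using insert by auto
    have K: "submodule K R M" unfolding K_def by (rule submodule_gen[OF S])
    note Hs = insert(5)
    have up: "H i \<subseteq> H j" if "i \<le> j" for i j
      using lift_Suc_mono_le[of H i j] insert(6) that by auto
    have "\<exists>m0. \<forall>m\<ge>m0. H m \<inter> K = H m0 \<inter> K"
      by (rule insert(3)[of "\<lambda>m. H m \<inter> K"]) (use S insert(6) submodule_Int[OF Hs K] K_def in auto)
    then obtain m1 where m1: "\<And>m. m \<ge> m1 \<Longrightarrow> H m \<inter> K = H m1 \<inter> K" by blast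
    have "colon (H m <+>\<^bsub>M\<^esub> K) s \<subseteq> colon (H (Suc m) <+>\<^bsub>M\<^esub> K) s" for m
      using insert(6)[of m] unfolding colon_def mem_set_add by blast
    then obtain m2 where m2: "\<And>m. m \<ge> m2 \<Longrightarrow> colon (H m <+>\<^bsub>M\<^esub> K) s = colon (H m2 <+>\<^bsub>M\<^esub> K) s"
      using NR.ideal_chain_stabilizes[of "\<lambda>m. colon (H m <+>\<^bsub>M\<^esub> K) s"]
        ideal_colon[OF submodule_sum[OF Hs K] s] by blast
    define m0 where "m0 = max m1 m2"
    have "H m \<subseteq> H m0" if m: "m \<ge> m0" for m
    proof
      fix x assume x: "x \<in> H m"
      then have "x \<in> cyclic s <+>\<^bsub>M\<^esub> K" using insert(7) gen_insert_subset[OF s S] unfolding K_def by blast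
      then obtain r k where rk: "r \<in> carrier R" "k \<in> K" "x = r \<bullet> s \<oplus>\<^bsub>M\<^esub> k"
        by (auto simp: mem_set_add cyclic_def)
      have c: "k \<in> carrier M" "x \<in> carrier M" "r \<bullet> s \<in> carrier M"
        using rk x s sub_carrier[OF K] sub_carrier[OF Hs] by auto
      have "r \<bullet> s = x \<oplus>\<^bsub>M\<^esub> (\<ominus>\<^bsub>M\<^esub> k)"
        using rk(3) c by (simp add: M.add.m_assoc M.r_neg)
      then have "r \<in> colon (H m <+>\<^bsub>M\<^esub> K) s"
        using x rk(1,2) submoduleE(3)[OF K] unfolding colon_def mem_set_add by blast
      then have "r \<in> colon (H m0 <+>\<^bsub>M\<^esub> K) s" using m2[of m] m2[of m0] m by (auto simp: m0_def)
      then obtain h k' where hk: "h \<in> H m0" "k' \<in> K" "r \<bullet> s = h \<oplus>\<^bsub>M\<^esub> k'"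
        by (auto simp: colon_def mem_set_add)
      have c': "h \<in> carrier M" "k' \<in> carrier M"
        using hk sub_carrier[OF K] sub_carrier[OF Hs] by auto
      have xeq: "x = (k \<oplus>\<^bsub>M\<^esub> k') \<oplus>\<^bsub>M\<^esub> h" using rk hk c c' by (simp add: M.add.m_ac)
      have "k \<oplus>\<^bsub>M\<^esub> k' \<in> H m"
        by (rule sub_add_cancel[OF Hs, of h]) (use hk up[OF m] c c' x xeq in auto)
      then have "k \<oplus>\<^bsub>M\<^esub> k' \<in> H m0"
        using m1[of m] m1[of m0] m rk(2) hk(2) sub_add[OF K] by (auto simp: m0_def)
      then show "x \<in> H m0" using xeq hk(1) sub_add[OF Hs] by blast
    qed
    then show ?case using up by blast
  qed
  obtain S where S: "S \<subseteq> carrier M" "finite S" "carrier M = gen_submodule R M S"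
    using M unfolding fin_gen_module_def by blast
  show ?thesis
    unfolding noetherian_module_def
  proof (intro allI impI)
    fix H :: "nat \<Rightarrow> 'c set"
    assume H: "\<forall>m. submodule (H m) R M \<and> H m \<subseteq> H (Suc m)"
    show "\<exists>m0. \<forall>m\<ge>m0. H m = H m0"
      by (rule main[OF S(2,1)]) (use H submoduleE(1) in \<open>simp_all add: S(3)[symmetric]\<close>)
  qed
qed

text \<open>\<open>R/p\<close> is a domain, so multiplying a generator of a copy of
  \<open>R/p\<close> by a scalar outside \<open>p\<close> does not change its annihilator.\<close>

lemma colon_prime_smult:
  assumes K: "submodule K R M" and x: "x \<in> carrier M" and p: "primeideal (colon K x) R"
    and r: "r \<in> carrier R" "r \<notin> colon K x"
  shows "colon K (r \<bullet> x) = colon K x"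
proof -
  have "a \<in> colon K (r \<bullet> x) \<longleftrightarrow> a \<otimes> r \<in> colon K x" if "a \<in> carrier R" for a
    using that r(1) x by (simp add: colon_def smult_assoc1)
  moreover have "a \<otimes> r \<in> colon K x \<longleftrightarrow> a \<in> colon K x" if "a \<in> carrier R" for a
  proof
    show "a \<in> colon K x" if "a \<otimes> r \<in> colon K x"
      using primeideal.I_prime[OF p \<open>a \<in> carrier R\<close> r(1) that] r(2) by simp
  qed (rule ideal.I_r_closed[OF ideal_colon[OF K x] _ r(1)])
  moreover have "colon K x \<subseteq> carrier R" "colon K (r \<bullet> x) \<subseteq> carrier R" by (auto simp: colon_def)
  ultimately show ?thesis by blast
qed

section \<open>Finiteness of the associated primes of a quotient of families\<close>

definition family_ass :: "(nat \<Rightarrow> 'c set) \<Rightarrow> (nat \<Rightarrow> 'c set) \<Rightarrow> 'a set set" where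
  "family_ass V W = {p. primeideal p R \<and> (\<exists>n. \<exists>x\<in>V n. p = colon (W n) x)}"

text \<open>Noetherian induction over the families between \<open>W\<close> and \<open>V\<close>: adjoining an element whose
  colon ideal is maximal creates at most one new prime, namely that maximal colon ideal.\<close>

lemma finite_family_ass_step:
  assumes R: "noetherian_ring R" and B: "B \<subseteq> carrier R"
    and V: "family B V" and T: "family B T" "W \<le> T" "T \<le> V" "T \<noteq> V" "finite (family_ass T W)"
    and W: "family B W"
  shows "\<exists>T'. family B T' \<and> T \<le> T' \<and> T' \<le> V \<and> T' \<noteq> T \<and> finite (family_ass T' W)"
proof -
  interpret NR: noetherian_ring R by (rule R)
  have Vs: "submodule (V n) R M" and Ts: "submodule (T n) R M" and Ws: "submodule (W n) R M" for n
    using V T W family_sub by auto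
  define C where "C = {colon (T n) x | n x. x \<in> V n - T n}"
  have "C \<noteq> {}"
  proof -
    obtain n where "T n \<noteq> V n" using T(4) by blast
    moreover have "T n \<subseteq> V n" using T(3) by (simp add: le_fun_def)
    ultimately show ?thesis unfolding C_def by blast
  qed
  moreover have "ideal I R" if "I \<in> C" for I
    using that ideal_colon[OF Ts] sub_carrier[OF Vs] unfolding C_def by auto
  ultimately obtain Q where Q: "Q \<in> C" "\<And>I. I \<in> C \<Longrightarrow> Q \<subseteq> I \<Longrightarrow> I = Q"
    using NR.ideal_set_has_maximal[of C] by metis
  obtain n0 x0 where x0: "Q = colon (T n0) x0" "x0 \<in> V n0" "x0 \<notin> T n0"
    using Q(1) unfolding C_def by auto
  have x0c: "x0 \<in> carrier M" using x0 sub_carrier[OF Vs] by blast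
  define J where "J = Idl B"
  have J: "ideal J R" unfolding J_def by (rule R.genideal_ideal[OF B])
  have BJ: "B \<subseteq> J" unfolding J_def by (rule R.genideal_self[OF B])
  have cs: "submodule (cyclic x0) R M" by (rule submodule_cyclic[OF x0c])
  have ps: "submodule (ipow J k (cyclic x0)) R M" for k by (rule submodule_ipow[OF J cs])
  \<comment> \<open>\<open>T\<close> enlarged by the subfamily that \<open>x0\<close> generates from
    its own level \<open>n0\<close> on.\<close>
  define T' where "T' n = (if n < n0 then T n else T n <+>\<^bsub>M\<^esub> ipow J (n - n0) (cyclic x0))" for n
  have T's: "submodule (T' n) R M" for n
    unfolding T'_def using Ts submodule_sum[OF Ts ps] by simp
  have TT': "T n \<subseteq> T' n" for n
    using sum_upper1[OF ps, of "T n"] sub_carrier[OF Ts] unfolding T'_def by auto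
  have pw_step: "ipow J (Suc k) (cyclic x0) \<subseteq> H"
    if "submodule H R M" "\<And>b w. b \<in> B \<Longrightarrow> w \<in> ipow J k (cyclic x0) \<Longrightarrow> b \<bullet> w \<in> H" for k H
    unfolding ipow_Suc[OF J cs] unfolding J_def
    by (rule ideal_smult_Idl_least[OF B]) (use that sub_carrier[OF ps] J_def in auto)
  have pwV: "ipow J k (cyclic x0) \<subseteq> V (n0 + k)" for k
  proof (induct k)
    case 0
    then show ?case using x0 sub_smult[OF Vs] unfolding ipow_0[OF cs] by (auto simp: cyclic_def)
  next
    case (Suc k)
    show ?case by (rule pw_step) (use Suc Vs family_mult[OF V] in auto)
  qed
  \<comment> \<open>\<open>Q\<close> carries \<open>x0\<close> into \<open>T n0\<close>; since
    scalars commute, it carries everything generated by \<open>x0\<close> into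
    \<open>T\<close>.\<close>
  have pwQ: "ipow J k (cyclic x0) \<subseteq> {w \<in> V (n0 + k). \<forall>q\<in>Q. q \<bullet> w \<in> T (n0 + k)}" for k
  proof (induct k)
    case 0
    have "q \<bullet> (r \<bullet> x0) \<in> T n0" if "q \<in> Q" "r \<in> carrier R" for q r
      using that smult_commute[of q r x0] x0c sub_smult[OF Ts] x0(1) by (auto simp: colon_def)
    then show ?case using x0 sub_smult[OF Vs] unfolding ipow_0[OF cs] by (auto simp: cyclic_def)
  next
    case (Suc k)
    show ?case
    proof (rule pw_step)
      show "submodule {w \<in> V (n0 + Suc k). \<forall>q\<in>Q. q \<bullet> w \<in> T (n0 + Suc k)} R M"
        by (rule submodule_colon[OF Vs Ts]) (auto simp: x0(1) colon_def)
      fix b w assume bw: "b \<in> B" "w \<in> ipow J k (cyclic x0)"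
      have "q \<bullet> (b \<bullet> w) \<in> T (n0 + Suc k)" if q: "q \<in> Q" for q
      proof -
        have "b \<bullet> (q \<bullet> w) \<in> T (n0 + Suc k)" using family_mult[OF T(1) bw(1)] Suc bw(2) q by auto
        then show ?thesis
          using smult_commute[of q b w] bw B q sub_carrier[OF ps bw(2)] by (auto simp: x0(1) colon_def)
      qed
      then show "b \<bullet> w \<in> {w \<in> V (n0 + Suc k). \<forall>q\<in>Q. q \<bullet> w \<in> T (n0 + Suc k)}"
        using family_mult[OF V bw(1)] Suc bw(2) by auto
    qed
  qed
  have famT': "family B T'"
  proof (rule familyI[OF T's])
    fix b n x assume b: "b \<in> B" and x: "x \<in> T' n"
    show "b \<bullet> x \<in> T' (Suc n)"
    proof (cases "n < n0")
      case True
      then have "x \<in> T n" using x by (simp add: T'_def)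
      then show ?thesis using family_mult[OF T(1) b] TT' by blast
    next
      case False
      then obtain t w where tw: "t \<in> T n" "w \<in> ipow J (n - n0) (cyclic x0)" "x = t \<oplus>\<^bsub>M\<^esub> w"
        using x unfolding T'_def by (auto simp: mem_set_add)
      have "b \<bullet> w \<in> ipow J (Suc (n - n0)) (cyclic x0)"
        unfolding ipow_Suc[OF J cs] by (rule ideal_smult_incl) (use b BJ tw in auto)
      then have "b \<bullet> w \<in> ipow J (Suc n - n0) (cyclic x0)" using False by (simp add: Suc_diff_le)
      moreover have "b \<bullet> t \<in> T (Suc n)" using tw family_mult[OF T(1) b] by blast
      moreover have "b \<bullet> x = b \<bullet> t \<oplus>\<^bsub>M\<^esub> b \<bullet> w"
        using tw b B sub_carrier[OF Ts] sub_carrier[OF ps] by (auto simp: smult_r_distr)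
      ultimately show ?thesis using False unfolding T'_def by (auto simp: mem_set_add)
    qed
  qed
  have T'V: "T' n \<subseteq> V n" for n
    using T(3) pwV[of "n - n0"] sum_least[OF Vs[of n], of "T n" "ipow J (n - n0) (cyclic x0)"]
    unfolding T'_def by (auto simp: le_fun_def)
  have "x0 \<in> T' n0"
    using sum_upper2[OF Ts[of n0], of "cyclic x0"] cyclic_self[OF x0c] sub_carrier[OF cs]
    unfolding T'_def by (auto simp: ipow_0 cs)
  then have ne: "T' \<noteq> T" using x0(3) by auto
  \<comment> \<open>The colon ideal of a new element contains \<open>Q\<close> and itself belongs to
    \<open>C\<close>, so maximality makes it equal to \<open>Q\<close>.\<close>
  have colQ: "colon (T n) u = Q" if u: "u \<in> T' n" "u \<notin> T n" for n u
  proof -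
    have n: "n \<ge> n0" using u unfolding T'_def by (auto split: if_splits)
    then obtain t w where tw: "t \<in> T n" "w \<in> ipow J (n - n0) (cyclic x0)" "u = t \<oplus>\<^bsub>M\<^esub> w"
      using u unfolding T'_def by (auto simp: mem_set_add)
    have c: "t \<in> carrier M" "w \<in> carrier M" using tw sub_carrier[OF Ts] sub_carrier[OF ps] by auto
    have "q \<bullet> u \<in> T n" if q: "q \<in> Q" for q
    proof -
      have qc: "q \<in> carrier R" using q x0(1) by (simp add: colon_def)
      have "q \<bullet> w \<in> T n" using pwQ[of "n - n0"] tw(2) q n by auto
      then show ?thesis
        using tw c qc sub_add[OF Ts] sub_smult[OF Ts qc tw(1)] by (simp add: smult_r_distr)
    qed
    then have "Q \<subseteq> colon (T n) u" using x0(1) by (auto simp: colon_def)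
    moreover have "colon (T n) u \<in> C" using u T'V unfolding C_def by blast
    ultimately show ?thesis using Q(2) by blast
  qed
  have "family_ass T' W \<subseteq> insert Q (family_ass T W)"
  proof
    fix p assume "p \<in> family_ass T' W"
    then obtain n u where p: "primeideal p R" "u \<in> T' n" "p = colon (W n) u"
      unfolding family_ass_def by auto
    have uc: "u \<in> carrier M" using p sub_carrier[OF T's] by blast
    \<comment> \<open>If a multiple of \<open>u\<close> by a scalar outside \<open>p\<close> lies in
      \<open>T\<close>, it still has colon ideal \<open>p\<close>, so \<open>p\<close> already
      occurs for \<open>T\<close> over \<open>W\<close>. Otherwise \<open>(W n : u)\<close> and
      \<open>(T n : u)\<close> coincide, and the prime is \<open>Q\<close>.\<close>
    show "p \<in> insert Q (family_ass T W)"
    proof (cases "\<exists>r\<in>carrier R. r \<notin> p \<and> r \<bullet> u \<in> T n")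
      case True
      then obtain r where r: "r \<in> carrier R" "r \<notin> p" "r \<bullet> u \<in> T n" by blast
      then have "colon (W n) (r \<bullet> u) = p" using colon_prime_smult[OF Ws uc] p by auto
      then show ?thesis using p r unfolding family_ass_def by blast
    next
      case False
      have "p \<subseteq> colon (T n) u" using p(3) T(2) by (auto simp: colon_def le_fun_def)
      moreover have "colon (T n) u \<subseteq> p" using False by (auto simp: colon_def)
      moreover have "u \<notin> T n"
      proof
        assume "u \<in> T n"
        then have "carrier R \<subseteq> p" using False sub_smult[OF Ts] by blast
        then show False using primeideal.I_notcarr[OF p(1)] p(3) by (auto simp: colon_def)
      qed
      ultimately show ?thesis using colQ[OF p(2)] by auto
    qed
  qed
  then have "finite (family_ass T' W)" using T(5) by (meson finite.insertI finite_subset)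
  moreover have "T \<le> T'" "T' \<le> V" using TT' T'V by (simp_all add: le_fun_def)
  ultimately show ?thesis using famT' ne by blast
qed

text \<open>If \<open>V\<close> had infinitely many primes over \<open>W\<close>, every intermediate
  family with finitely many could be enlarged strictly with finiteness preserved. Iterating from
  \<open>W\<close> would violate the chain condition on \<open>V\<close>.\<close>

lemma finite_family_ass:
  assumes R: "noetherian_ring R" and B: "B \<subseteq> carrier R"
    and V: "family B V" "noeth B V" and W: "family B W" "W \<le> V"
  shows "finite (family_ass V W)"
proof (rule ccontr)
  assume inf: "infinite (family_ass V W)"
  define good where "good T \<longleftrightarrow> family B T \<and> W \<le> T \<and> T \<le> V \<and> finite (family_ass T W)" for T
  have "\<exists>T'. good T' \<and> T \<le> T' \<and> T' \<noteq> T" if "good T" for T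
  proof -
    have T: "family B T" "W \<le> T" "T \<le> V" "finite (family_ass T W)" using that by (auto simp: good_def)
    then have "T \<noteq> V" using inf by auto
    then obtain T' where "family B T'" "T \<le> T'" "T' \<le> V" "T' \<noteq> T" "finite (family_ass T' W)"
      using finite_family_ass_step[OF R B V(1) T(1-3) _ T(4) W(1)] by blast
    then show ?thesis using T(2) order_trans[of W T T'] unfolding good_def by blast
  qed
  then obtain s where s: "\<And>T. good T \<Longrightarrow> good (s T) \<and> T \<le> s T \<and> s T \<noteq> T" by metis
  have "family_ass W W = {}"
  proof -
    have "p = carrier R" if "x \<in> W n" "p = colon (W n) x" for p n x
      using that sub_smult[OF family_sub[OF W(1)]] by (auto simp: colon_def)
    then show ?thesis unfolding family_ass_def by (auto dest: primeideal.I_notcarr)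
  qed
  then have good0: "good W" using W by (simp add: good_def)
  define H where "H m = (s ^^ m) W" for m
  have gH: "good (H m)" for m by (induct m) (use s good0 in \<open>auto simp: H_def\<close>)
  have "H m \<le> H (Suc m)" for m using s[OF gH[of m]] by (simp add: H_def)
  moreover have "family B (H m)" "H m \<le> V" for m using gH unfolding good_def by blast+
  ultimately obtain m0 where "\<And>m. m \<ge> m0 \<Longrightarrow> H m = H m0" using noethE[OF V(2), of H] by blast
  then have "H (Suc m0) = H m0" using le_SucI by blast
  then show False using s[OF gH[of m0]] by (simp add: H_def)
qed

section \<open>Families of colon modules\<close>

lemma noeth_zero: "noeth B (\<lambda>n. {\<zero>\<^bsub>M\<^esub>})"
  unfolding noeth_def
proof (intro allI impI)
  fix H assume H: "\<forall>m. family B (H m) \<and> H m \<le> (\<lambda>n. {\<zero>\<^bsub>M\<^esub>}) \<and> H m \<le> H (Suc m)"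
  have "H m n = {\<zero>\<^bsub>M\<^esub>}" for m n
    using H sub_zero[OF family_sub[of B "H m" n]] unfolding le_fun_def by blast
  then have "H m = H 0" for m by (metis ext)
  then show "\<exists>m0. \<forall>m\<ge>m0. H m = H m0" by blast
qed

text \<open>The conditions \<open>a x = 0\<close> for \<open>a\<close> in \<open>C\<close> are
  already imposed, those for \<open>a\<close> in \<open>A\<close> are still to come. With all of
  \<open>S\<close> imposed only zero is left; each condition is then lifted by
  \<open>noeth_extension\<close>, the image lying in \<open>E\<close>.\<close>

lemma noeth_faithful:
  assumes B: "B \<subseteq> carrier R" and E: "noeth B E"
    and G: "\<And>n. G n \<subseteq> carrier M"
    and GE: "\<And>a n x. a \<in> S \<Longrightarrow> x \<in> G n \<Longrightarrow> a \<bullet> x \<in> E n"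
    and S: "finite S" "S \<subseteq> carrier R" "zero_colon M S = {\<zero>\<^bsub>M\<^esub>}"
  shows "noeth B G"
proof -
  have "noeth B (\<lambda>n. {x \<in> G n. \<forall>a\<in>C. a \<bullet> x = \<zero>\<^bsub>M\<^esub>})"
    if "finite A" "A \<union> C = S" for A C
    using that
  proof (induct A arbitrary: C rule: finite_induct)
    case empty
    have "{x \<in> G n. \<forall>a\<in>C. a \<bullet> x = \<zero>\<^bsub>M\<^esub>} \<subseteq> zero_colon M S" for n
      using G[of n] empty by (auto simp: zero_colon_def)
    then have "(\<lambda>n. {x \<in> G n. \<forall>a\<in>C. a \<bullet> x = \<zero>\<^bsub>M\<^esub>}) \<le> (\<lambda>n. {\<zero>\<^bsub>M\<^esub>})"
      unfolding S(3) by (simp add: le_fun_def)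
    then show ?case using noeth_mono[OF noeth_zero] by blast
  next
    case (insert a A)
    have "noeth B (\<lambda>n. {x \<in> G n. \<forall>b\<in>insert a C. b \<bullet> x = \<zero>\<^bsub>M\<^esub>})"
      by (rule insert(3)) (use insert(4) in auto)
    then show ?case
      by (rule noeth_extension[OF _ E B, where a = a]) (use insert(4) S(2) GE in auto)
  qed
  from this[OF S(1), of "{}"] show ?thesis by simp
qed

lemma zero_colon_generators:
  assumes "S \<subseteq> carrier R"
  shows "zero_colon M (Idl S) = zero_colon M S"
proof -
  have "x \<in> zero_colon M (Idl S)" if x: "x \<in> zero_colon M S" for x
  proof -
    have "Idl S \<subseteq> colon {\<zero>\<^bsub>M\<^esub>} x"
      by (rule R.genideal_minimal[OF ideal_colon[OF submodule_zero]])
        (use x assms in \<open>auto simp: zero_colon_def colon_def\<close>)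
    then show ?thesis using x by (auto simp: zero_colon_def colon_def)
  qed
  then show ?thesis using R.genideal_self[OF assms] by (auto simp: zero_colon_def)
qed

lemma reduction_ipow:
  assumes I: "ideal I R" and red: "ideal J R" "ideal_prod R J (ideal_pow R I m) = ideal_pow R I (Suc m)"
    and K: "submodule K R M" and n: "n \<ge> m"
  shows "ipow I (Suc n) K = ideal_smult R M J (ipow I n K)"
proof -
  obtain k where k: "n = m + k" using n le_Suc_ex by blast
  have Kk: "submodule (ipow I k K) R M" by (rule submodule_ipow[OF I K])
  have "ipow I (Suc n) K = ipow I (Suc m) (ipow I k K)" unfolding k add_Suc[symmetric] by (rule ipow_add[OF I K])
  also have "\<dots> = ideal_smult R M J (ipow I m (ipow I k K))"
    unfolding ipow_def red(2)[symmetric]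
    by (rule ideal_smult_prod[OF red(1) ideal_ideal_pow[OF I] Kk[unfolded ipow_def]])
  finally show ?thesis by (simp only: k ipow_add[OF I K])
qed

text \<open>From the exponent \<open>m\<close> on, multiplication by \<open>I\<close> may be
  replaced by multiplication by \<open>J\<close>, so the shifted powers are generated by the finite
  set \<open>B\<close>.\<close>

lemma noeth_ipow:
  assumes M: noetherian_module and B: "finite B" "B \<subseteq> carrier R"
    and I: "ideal I R" and red: "ideal_prod R (Idl B) (ideal_pow R I m) = ideal_pow R I (Suc m)"
    and K: "submodule K R M"
  shows "noeth B (\<lambda>n. ipow I (m + n) K)"
proof (rule noeth_generated[OF M B])
  show "ipow I (m + Suc n) K = ideal_smult R M (Idl B) (ipow I (m + n) K)" for n
    using reduction_ipow[OF I R.genideal_ideal[OF B(2)] red K, of "m + n"] by simp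
qed (rule submodule_ipow[OF I K])

lemma family_ipow:
  assumes "ideal I R" "submodule K R M" "B \<subseteq> I"
  shows "family B (\<lambda>n. ipow I (m + n) K)"
proof (rule familyI)
  fix b n x assume "b \<in> B" "x \<in> ipow I (m + n) K"
  then show "b \<bullet> x \<in> ipow I (m + Suc n) K"
    using ideal_smult_incl[of b I x "ipow I (m + n) K"] assms by (auto simp: ipow_Suc)
qed (rule submodule_ipow[OF assms(1,2)])

text \<open>The colon modules form a Noetherian family, so from some point on each is \<open>J\<close> times its
  predecessor, and \<open>J (I\<^sup>n\<^sup>+\<^sup>1K : I) \<subseteq> I\<^sup>n\<^sup>+\<^sup>1K\<close> by the definition of the colon.\<close>

lemma eventually_colon_ipow:
  assumes R: "noetherian_ring R" and M: noetherian_module and B: "finite B" "B \<subseteq> carrier R"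
    and I: "ideal I R" "Idl B \<subseteq> I"
    and red: "ideal_prod R (Idl B) (ideal_pow R I m) = ideal_pow R I (Suc m)"
    and zc: "zero_colon M I = {\<zero>\<^bsub>M\<^esub>}" and K: "submodule K R M"
  shows "\<exists>n0. \<forall>n\<ge>n0. \<forall>x\<in>carrier M. (\<forall>a\<in>I. a \<bullet> x \<in> ipow I (Suc n) K) \<longrightarrow> x \<in> ipow I n K"
proof -
  have Ic: "I \<subseteq> carrier R" using ideal.Icarr[OF I(1)] by auto
  have BI: "B \<subseteq> I" using R.genideal_self[OF B(2)] I(2) by auto
  obtain S where S: "S \<subseteq> carrier R" "finite S" "I = Idl S"
    using noetherian_ring.finetely_gen[OF R I(1)] by blast
  define G where "G n = {x \<in> carrier M. \<forall>a\<in>I. a \<bullet> x \<in> ipow I (Suc (m + n)) K}" for n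
  have step: "a \<bullet> x \<in> ipow I (Suc n) K" if "a \<in> I" "x \<in> ipow I n K" for a x n
    unfolding ipow_Suc[OF I(1) K] by (rule ideal_smult_incl[OF that])
  have famG: "family B G"
  proof (rule familyI)
    show "submodule (G n) R M" for n
      unfolding G_def by (rule submodule_colon[OF carrier_is_submodule submodule_ipow[OF I(1) K] Ic])
    fix b n x assume b: "b \<in> B" and x: "x \<in> G n"
    have "a \<bullet> (b \<bullet> x) \<in> ipow I (Suc (m + Suc n)) K" if a: "a \<in> I" for a
    proof -
      have "a \<bullet> (b \<bullet> x) = b \<bullet> (a \<bullet> x)"
        using a b x Ic B smult_commute by (auto simp: G_def subset_iff)
      moreover have "a \<bullet> x \<in> ipow I (Suc (m + n)) K" using x a by (simp add: G_def)
      ultimately show ?thesis using step[of b "a \<bullet> x" "Suc (m + n)"] b BI by auto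
    qed
    then show "b \<bullet> x \<in> G (Suc n)" using x b B(2) by (auto simp: G_def)
  qed
  \<comment> \<open>The product lies in \<open>I^(m+n+1) K\<close>; weakening this to
    \<open>I^(m+n) K\<close> makes multiplication by \<open>a\<close> preserve the level.\<close>
  have GE: "a \<bullet> x \<in> ipow I (m + n) K" if "a \<in> S" "x \<in> G n" for a n x
  proof -
    have "a \<bullet> x \<in> ipow I (Suc (m + n)) K" using that S R.genideal_self[OF S(1)] by (auto simp: G_def)
    then show ?thesis using ipow_decreasing[OF I(1) K, of "m + n" "Suc (m + n)"] by auto
  qed
  have "noeth B G"
  proof (rule noeth_faithful[OF B(2) noeth_ipow[OF M B I(1) red K]])
    show "G n \<subseteq> carrier M" for n by (auto simp: G_def)
    show "zero_colon M S = {\<zero>\<^bsub>M\<^esub>}" using zc zero_colon_generators[OF S(1)] S(3) by simp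
  qed (use GE S in auto)
  then obtain n0 where n0: "\<And>n. n \<ge> n0 \<Longrightarrow> G (Suc n) = ideal_smult R M (Idl B) (G n)"
    using noeth_eventually_generated[OF B(2) famG] by blast
  \<comment> \<open>Generation expresses \<open>G (Suc k)\<close> through \<open>G k\<close>, so
    \<open>n\<close> must exceed \<open>m + n0\<close> by at least one.\<close>
  have "x \<in> ipow I n K"
    if n: "n \<ge> m + Suc n0" and x: "x \<in> carrier M" "\<forall>a\<in>I. a \<bullet> x \<in> ipow I (Suc n) K" for n x
  proof -
    obtain k where k: "n = m + Suc k" "k \<ge> n0"
      using n le_Suc_ex[of "m + Suc n0" n] by (metis add.assoc add_Suc add_Suc_right le_add1)
    have "x \<in> G (Suc k)" using x k by (simp add: G_def)
    then have "x \<in> ideal_smult R M (Idl B) (G k)" using n0[OF k(2)] by simp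
    moreover have "ideal_smult R M (Idl B) (G k) \<subseteq> ipow I n K"
      by (rule ideal_smult_least[OF submodule_ipow[OF I(1) K]]) (use I(2) k in \<open>auto simp: G_def\<close>)
    ultimately show ?thesis by blast
  qed
  then show ?thesis by blast
qed

end


section \<open>Homogeneous components\<close>

definition hcomp :: "('a, 'm) ring_scheme \<Rightarrow> ('i \<Rightarrow> 'a set) \<Rightarrow> 'a \<Rightarrow> 'i \<Rightarrow> 'a" where
  "hcomp G D x = (THE f. (\<forall>i. f i \<in> D i) \<and> finite {i. f i \<noteq> \<zero>\<^bsub>G\<^esub>} \<and>
     x = (\<Oplus>\<^bsub>G\<^esub>i\<in>{i. f i \<noteq> \<zero>\<^bsub>G\<^esub>}. f i))"

context abelian_group
begin

context
  fixes D :: "'i \<Rightarrow> 'a set"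
  assumes ds: "internal_direct_sum G D"
begin

lemma summand_subgroup: "additive_subgroup (D i) G"
  using ds by (simp add: internal_direct_sum_def)

lemma summand_carrier: "x \<in> D i \<Longrightarrow> x \<in> carrier G"
  using additive_subgroup.a_subset[OF summand_subgroup] by blast

lemma summand_zero: "\<zero> \<in> D i"
  by (rule additive_subgroup.zero_closed[OF summand_subgroup])

lemma summand_add: "x \<in> D i \<Longrightarrow> y \<in> D i \<Longrightarrow> x \<oplus> y \<in> D i"
  by (rule additive_subgroup.a_closed[OF summand_subgroup])

lemma hcomp_spec:
  assumes "x \<in> carrier G"
  shows "(\<forall>i. hcomp G D x i \<in> D i) \<and> finite {i. hcomp G D x i \<noteq> \<zero>} \<and>
    x = (\<Oplus>i\<in>{i. hcomp G D x i \<noteq> \<zero>}. hcomp G D x i)"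
proof -
  have "\<exists>!f. (\<forall>i. f i \<in> D i) \<and> finite {i. f i \<noteq> \<zero>} \<and> x = (\<Oplus>i\<in>{i. f i \<noteq> \<zero>}. f i)"
    using ds assms by (simp add: internal_direct_sum_def)
  then show ?thesis unfolding hcomp_def by (rule theI')
qed

lemma hcomp_in: "x \<in> carrier G \<Longrightarrow> hcomp G D x i \<in> D i"
  using hcomp_spec by blast

lemma hcomp_carrier [simp, intro]: "x \<in> carrier G \<Longrightarrow> hcomp G D x i \<in> carrier G"
  using hcomp_in summand_carrier by blast

lemma finite_hcomp: "x \<in> carrier G \<Longrightarrow> finite {i. hcomp G D x i \<noteq> \<zero>}"
  using hcomp_spec by blast

lemma finsum_mono_neutral:
  assumes "finite S" "T \<subseteq> S" "\<And>i. i \<in> S - T \<Longrightarrow> f i = \<zero>" "f \<in> T \<rightarrow> carrier G"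
  shows "finsum G f T = finsum G f S"
proof -
  have "finsum G f S = finsum G f (T \<union> (S - T))" using assms(2) by (simp add: Un_absorb1)
  also have "\<dots> = finsum G f T \<oplus> finsum G f (S - T)"
    by (rule add.finprod_Un_disjoint)
      (use assms in \<open>auto intro: finite_subset simp: Pi_def\<close>)
  also have "finsum G f (S - T) = \<zero>"
    by (rule add.finprod_one_eqI) (use assms in auto)
  also have "finsum G f T \<oplus> \<zero> = finsum G f T" using assms(4) by simp
  finally show ?thesis by simp
qed

lemma hcomp_unique:
  assumes f: "\<And>i. f i \<in> D i" and S: "finite S" "\<And>i. i \<notin> S \<Longrightarrow> f i = \<zero>"
    and x: "x = (\<Oplus>i\<in>S. f i)"
  shows "hcomp G D x = f"
proof -
  have fc: "f i \<in> carrier G" for i using f summand_carrier by blast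
  have sub: "{i. f i \<noteq> \<zero>} \<subseteq> S" using S(2) by blast
  have "(\<Oplus>i\<in>{i. f i \<noteq> \<zero>}. f i) = (\<Oplus>i\<in>S. f i)"
    by (rule finsum_mono_neutral[OF S(1) sub]) (use fc in auto)
  then have *: "finite {i. f i \<noteq> \<zero>}" "x = (\<Oplus>i\<in>{i. f i \<noteq> \<zero>}. f i)"
    unfolding x using finite_subset[OF sub S(1)] by auto
  have "x \<in> carrier G" unfolding x using fc by simp
  then have "\<exists>!f. (\<forall>i. f i \<in> D i) \<and> finite {i. f i \<noteq> \<zero>} \<and> x = (\<Oplus>i\<in>{i. f i \<noteq> \<zero>}. f i)"
    using ds by (simp add: internal_direct_sum_def)
  then show ?thesis unfolding hcomp_def by (rule the1_equality) (use f * in blast)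
qed

lemma hcomp_eq:
  assumes "x \<in> carrier G" "finite S" "\<And>i. i \<notin> S \<Longrightarrow> hcomp G D x i = \<zero>"
  shows "x = (\<Oplus>i\<in>S. hcomp G D x i)"
proof -
  have sub: "{i. hcomp G D x i \<noteq> \<zero>} \<subseteq> S" using assms(3) by blast
  have "x = (\<Oplus>i\<in>{i. hcomp G D x i \<noteq> \<zero>}. hcomp G D x i)"
    using hcomp_spec[OF assms(1)] by blast
  also have "\<dots> = (\<Oplus>i\<in>S. hcomp G D x i)"
    by (rule finsum_mono_neutral[OF assms(2) sub]) (use assms(1) in auto)
  finally show ?thesis .
qed

lemma hcomp_homogeneous:
  assumes "x \<in> D j" shows "hcomp G D x i = (if i = j then x else \<zero>)"
proof -
  have "hcomp G D x = (\<lambda>i. if i = j then x else \<zero>)"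
    by (rule hcomp_unique[where S = "{j}"]) (use assms summand_zero summand_carrier in auto)
  then show ?thesis by simp
qed

lemma hcomp_zero: "hcomp G D \<zero> i = \<zero>"
  using hcomp_homogeneous[OF summand_zero] by simp

lemma hcomp_add:
  assumes x: "x \<in> carrier G" and y: "y \<in> carrier G"
  shows "hcomp G D (x \<oplus> y) i = hcomp G D x i \<oplus> hcomp G D y i"
proof -
  define S where "S = {i. hcomp G D x i \<noteq> \<zero>} \<union> {i. hcomp G D y i \<noteq> \<zero>}"
  have S: "finite S" "\<And>i. i \<notin> S \<Longrightarrow> hcomp G D x i = \<zero>" "\<And>i. i \<notin> S \<Longrightarrow> hcomp G D y i = \<zero>"
    unfolding S_def using finite_hcomp x y by auto
  have "hcomp G D (x \<oplus> y) = (\<lambda>i. hcomp G D x i \<oplus> hcomp G D y i)"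
  proof (rule hcomp_unique[OF _ S(1)])
    show "x \<oplus> y = (\<Oplus>i\<in>S. hcomp G D x i \<oplus> hcomp G D y i)"
      using arg_cong2[of _ _ _ _ "(\<oplus>)", OF hcomp_eq[OF x S(1,2)] hcomp_eq[OF y S(1,3)]]
        finsum_addf[of "hcomp G D x" S "hcomp G D y"] x y by (simp add: Pi_def)
  qed (use S x y hcomp_in summand_add in auto)
  then show ?thesis by simp
qed

lemma hcomp_induct:
  assumes x: "x \<in> carrier G" and H: "\<And>i. hcomp G D x i \<in> H" "\<zero> \<in> H"
    "\<And>u v. u \<in> H \<Longrightarrow> v \<in> H \<Longrightarrow> u \<in> carrier G \<Longrightarrow> v \<in> carrier G \<Longrightarrow> u \<oplus> v \<in> H"
  shows "x \<in> H"
proof -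
  have "(\<Oplus>i\<in>S. hcomp G D x i) \<in> H" if "finite S" for S
    using that
  proof induct
    case (insert j S)
    then show ?case using H x by (simp add: Pi_def)
  qed (use H in simp)
  then show ?thesis using hcomp_spec[OF x] by metis
qed

end
end

context graded_cring
begin

abbreviation rcomp where "rcomp r i \<equiv> hcomp R A r i"

lemmas A_carrier = summand_carrier[OF ring_direct_sum]
lemmas rcomp_in = hcomp_in[OF ring_direct_sum]
lemmas rcomp_carrier = hcomp_carrier[OF ring_direct_sum]
lemmas rcomp_homogeneous = hcomp_homogeneous[OF ring_direct_sum]
lemmas rcomp_zero = hcomp_zero[OF ring_direct_sum]
lemmas A_zero = summand_zero[OF ring_direct_sum]
lemmas rcomp_add = hcomp_add[OF ring_direct_sum]
lemmas rcomp_induct = hcomp_induct[OF ring_direct_sum]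

text \<open>Isolates one component of a scalar, so that what is known about all the others can be
  assembled with \<open>rcomp_induct\<close>. This serves the lowest-term argument in
  \<open>prime_colon_homog\<close>.\<close>

lemma remove_component:
  assumes r: "r \<in> carrier R"
  shows "\<exists>s\<in>carrier R. r = s \<oplus> rcomp r a \<and> (\<forall>j. rcomp s j = (if j = a then \<zero> else rcomp r j))"
proof
  define s where "s = r \<ominus> rcomp r a"
  show sC: "s \<in> carrier R" using r rcomp_carrier by (simp add: s_def)
  have rs: "r = s \<oplus> rcomp r a"
    using r rcomp_carrier[OF r] by (simp add: s_def a_minus_def a_assoc l_neg)
  have "rcomp s j = (if j = a then \<zero> else rcomp r j)" for j
  proof -
    have "rcomp (s \<oplus> rcomp r a) j = rcomp s j \<oplus> rcomp (rcomp r a) j" by (rule rcomp_add[OF sC rcomp_carrier[OF r]])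
    then have eq: "rcomp r j = rcomp s j \<oplus> rcomp (rcomp r a) j" unfolding rs[symmetric] .
    have c: "rcomp r j \<in> carrier R" "rcomp s j \<in> carrier R" using rcomp_carrier r sC by auto
    show ?thesis
    proof (cases "j = a")
      case True
      then have "rcomp r a = rcomp s a \<oplus> rcomp r a" using eq rcomp_homogeneous[OF rcomp_in[OF r], of a a] by simp
      then show ?thesis using True c add.r_cancel_one'[of "rcomp r a" "rcomp s a"] by simp
    next
      case False
      then have "rcomp (rcomp r a) j = \<zero>" using rcomp_homogeneous[OF rcomp_in[OF r]] by simp
      then show ?thesis using eq[symmetric] False c by simp
    qed
  qed
  then show "r = s \<oplus> rcomp r a \<and> (\<forall>j. rcomp s j = (if j = a then \<zero> else rcomp r j))" using rs by blast
qed

end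

context graded_module
begin

abbreviation mcomp where "mcomp x u \<equiv> hcomp M D x u"

lemmas D_carrier = M.summand_carrier[OF module_direct_sum]
lemmas D_zero = M.summand_zero[OF module_direct_sum]
lemmas mcomp_in = M.hcomp_in[OF module_direct_sum]
lemmas mcomp_carrier = M.hcomp_carrier[OF module_direct_sum]
lemmas mcomp_zero = M.hcomp_zero[OF module_direct_sum]
lemmas mcomp_add = M.hcomp_add[OF module_direct_sum]
lemmas mcomp_homogeneous = M.hcomp_homogeneous[OF module_direct_sum]
lemmas mcomp_induct = M.hcomp_induct[OF module_direct_sum]
lemmas finite_mcomp = M.finite_hcomp[OF module_direct_sum]

lemma mcomp_smult:
  assumes a: "a \<in> A i" and x: "x \<in> carrier M"
  shows "mcomp (a \<bullet> x) v = a \<bullet> mcomp x (v - int i)"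
proof -
  have ac: "a \<in> carrier R" using a by (rule A_carrier)
  have "x \<in> {x \<in> carrier M. \<forall>v. mcomp (a \<bullet> x) v = a \<bullet> mcomp x (v - int i)}"
  proof (rule mcomp_induct[OF x])
    fix u
    have u: "mcomp x u \<in> D u" "a \<bullet> mcomp x u \<in> D (int i + u)"
      using mcomp_in[OF x] graded_smult[OF a] by auto
    show "mcomp x u \<in> {x \<in> carrier M. \<forall>v. mcomp (a \<bullet> x) v = a \<bullet> mcomp x (v - int i)}"
      using mcomp_homogeneous[OF u(1)] mcomp_homogeneous[OF u(2)] D_carrier[OF u(1)] ac by auto
  qed (use ac mcomp_carrier in \<open>auto simp: mcomp_zero mcomp_add smult_r_distr\<close>)
  then show ?thesis by simp
qed

section \<open>Graded submodules\<close>

definition graded_sub :: "'b set \<Rightarrow> bool" where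
  "graded_sub H \<longleftrightarrow> submodule H R M \<and> (\<forall>x\<in>H. \<forall>u. mcomp x u \<in> H)"

lemma graded_subD: "graded_sub H \<Longrightarrow> submodule H R M" and graded_sub_mcomp: "graded_sub H \<Longrightarrow> x \<in> H \<Longrightarrow> mcomp x u \<in> H"
  by (auto simp: graded_sub_def)

lemma graded_mem: "graded_sub H \<Longrightarrow> x \<in> H \<Longrightarrow> x \<in> carrier M"
  using graded_subD sub_carrier by blast

lemma graded_sub_iff:
  assumes "graded_sub H" "x \<in> carrier M" shows "x \<in> H \<longleftrightarrow> (\<forall>u. mcomp x u \<in> H)"
  using assms graded_sub_mcomp mcomp_induct[of x H] sub_zero[OF graded_subD] sub_add[OF graded_subD] by blast

text \<open>With \<open>U\<close> everything this expresses gradedness of \<open>H\<close>; with an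
  initial segment of degrees and \<open>H\<close> zero it says that nothing lives below a given
  degree.\<close>

definition comps_in :: "int set \<Rightarrow> 'b set \<Rightarrow> 'b set" where
  "comps_in U H = {x \<in> carrier M. \<forall>u\<in>U. mcomp x u \<in> H}"

text \<open>Scalars have nonnegative degrees, so a component of \<open>a x\<close> involves only
  components of \<open>x\<close> in the same or lower degrees. Hence \<open>U\<close> has to be
  closed downwards.\<close>

lemma submodule_comps_in:
  assumes H: "submodule H R M" and U: "\<And>u i. u \<in> U \<Longrightarrow> u - int i \<in> U"
  shows "submodule (comps_in U H) R M"
proof (rule submodule_closedI)
  fix a x assume a: "a \<in> carrier R" and x: "x \<in> comps_in U H"
  have xc: "x \<in> carrier M" using x by (simp add: comps_in_def)
  have "a \<in> {a \<in> carrier R. \<forall>u\<in>U. mcomp (a \<bullet> x) u \<in> H}"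
  proof (rule rcomp_induct[OF a])
    fix i
    show "rcomp a i \<in> {a \<in> carrier R. \<forall>u\<in>U. mcomp (a \<bullet> x) u \<in> H}"
      using mcomp_smult[OF rcomp_in[OF a] xc] x U sub_smult[OF H rcomp_carrier[OF a]] rcomp_carrier[OF a]
      by (auto simp: comps_in_def)
  qed (use xc sub_zero[OF H] sub_add[OF H] in \<open>auto simp: mcomp_zero mcomp_add smult_l_distr\<close>)
  then show "a \<bullet> x \<in> comps_in U H" using a xc by (auto simp: comps_in_def)
qed (use sub_zero[OF H] sub_add[OF H] in \<open>auto simp: comps_in_def mcomp_zero mcomp_add\<close>)

lemma graded_subI: "submodule H R M \<Longrightarrow> H \<subseteq> comps_in UNIV H \<Longrightarrow> graded_sub H"
  by (auto simp: graded_sub_def comps_in_def)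

lemma graded_sub_carrier: "graded_sub (carrier M)"
  by (simp add: graded_sub_def carrier_is_submodule mcomp_carrier)

lemma graded_sub_ideal_smult:
  assumes I: "homogeneous_ideal R A I" and K: "graded_sub K"
  shows "graded_sub (ideal_smult R M I K)"
proof -
  obtain S where S: "S \<subseteq> (\<Union>i. A i)" "I = Idl S" and II: "ideal I R"
    using I unfolding homogeneous_ideal_def by blast
  have Sc: "S \<subseteq> carrier R" using S(1) A_carrier by blast
  have L: "submodule (ideal_smult R M I K) R M" by (rule submodule_ideal_smult_ideal[OF II graded_subD[OF K]])
  have "ideal_smult R M (Idl S) K \<subseteq> comps_in UNIV (ideal_smult R M I K)"
  proof (rule ideal_smult_Idl_least[OF Sc _ submodule_comps_in[OF L]])
    show "K \<subseteq> carrier M" using graded_mem[OF K] by blast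
    fix a x assume a: "a \<in> S" and x: "x \<in> K"
    obtain i where i: "a \<in> A i" using a S(1) by blast
    have xc: "x \<in> carrier M" using sub_carrier[OF graded_subD[OF K] x] .
    have "a \<in> I" using a genideal_self[OF Sc] S(2) by auto
    then show "a \<bullet> x \<in> comps_in UNIV (ideal_smult R M I K)"
      using mcomp_smult[OF i xc] graded_sub_mcomp[OF K x] ideal_smult_incl[of a I _ K] xc A_carrier[OF i]
      by (auto simp: comps_in_def)
  qed simp
  then show ?thesis using graded_subI[OF L] S(2) by simp
qed

lemma gr_ipow:
  assumes I: "homogeneous_ideal R A I" and K: "graded_sub K"
  shows "graded_sub (ipow I n K)"
proof -
  have "ideal I R" using I by (simp add: homogeneous_ideal_def)
  then show ?thesis
    using K graded_sub_ideal_smult[OF I] graded_subD[OF K] by (induct n) (simp_all add: ipow_0 ipow_Suc)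
qed

text \<open>A decomposition inside \<open>N\<close> is also one inside \<open>M\<close>, and
  uniqueness in \<open>M\<close> identifies its terms with the components there.\<close>

lemma graded_submodule_graded_sub:
  assumes "graded_submodule R M D N" shows "graded_sub N"
proof -
  have N: "submodule N R M" and ds: "internal_direct_sum (M\<lparr>carrier := N\<rparr>) (\<lambda>u. N \<inter> D u)"
    using assms by (auto simp: graded_submodule_def)
  interpret MN: module R "M\<lparr>carrier := N\<rparr>"
    using submodule.submodule_is_module[OF N] module_axioms by blast
  have fs: "finsum (M\<lparr>carrier := N\<rparr>) f S = finsum M f S" if "finite S" "\<And>u. f u \<in> N" for f and S :: "int set"
    using that(1)
  proof induct
    case (insert u S)
    then show ?case using that(2) sub_carrier[OF N] MN.finsum_insert[of S u f] by (simp add: Pi_def)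
  qed (simp add: MN.finsum_empty[simplified])
  have "mcomp x u \<in> N" if x: "x \<in> N" for x u
  proof -
    define f where "f = hcomp (M\<lparr>carrier := N\<rparr>) (\<lambda>u. N \<inter> D u) x"
    have f: "\<forall>u. f u \<in> N \<inter> D u" "finite {u. f u \<noteq> \<zero>\<^bsub>M\<^esub>}"
      "x = finsum (M\<lparr>carrier := N\<rparr>) f {u. f u \<noteq> \<zero>\<^bsub>M\<^esub>}"
      using MN.hcomp_spec[OF ds, of x] x unfolding f_def by auto
    have "mcomp x = f"
      by (rule M.hcomp_unique[OF module_direct_sum _ f(2)]) (use f fs[OF f(2), of f] in auto)
    then show ?thesis using f by auto
  qed
  then show ?thesis using N by (simp add: graded_sub_def)
qed

lemma degrees_bounded_below:
  assumes "fin_gen_module R M"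
  shows "\<exists>u0. \<forall>u<u0. \<forall>x\<in>carrier M. mcomp x u = \<zero>\<^bsub>M\<^esub>"
proof -
  obtain S where S: "S \<subseteq> carrier M" "finite S" "carrier M = gen_submodule R M S"
    using assms unfolding fin_gen_module_def by blast
  define F where "F = (\<Union>s\<in>S. {u. mcomp s u \<noteq> \<zero>\<^bsub>M\<^esub>})"
  have F: "finite F" unfolding F_def using S finite_mcomp by blast
  \<comment> \<open>The extra 0 makes the minimum defined when no generator has a nonzero
    component.\<close>
  define u0 where "u0 = Min (insert 0 F)"
  have "u0 \<le> u" if "u \<in> F" for u unfolding u0_def using F that by simp
  then have "S \<subseteq> comps_in {..<u0} {\<zero>\<^bsub>M\<^esub>}" using S(1) by (force simp: comps_in_def F_def)
  then have "carrier M \<subseteq> comps_in {..<u0} {\<zero>\<^bsub>M\<^esub>}"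
    unfolding S(3) by (intro gen_least[OF submodule_comps_in[OF submodule_zero]]) auto
  then show ?thesis by (auto simp: comps_in_def)
qed


section \<open>Associated primes of graded modules\<close>

definition homog :: "'a set \<Rightarrow> bool" where
  "homog p \<longleftrightarrow> (\<forall>r\<in>p. \<forall>i. rcomp r i \<in> p)"

lemma mcomp_smult_component:
  assumes r: "r \<in> carrier R" and z: "z \<in> D t"
  shows "mcomp (r \<bullet> z) (int i + t) = rcomp r i \<bullet> z"
proof -
  have zc: "z \<in> carrier M" using z by (rule D_carrier)
  have "r \<in> {s \<in> carrier R. mcomp (s \<bullet> z) (int i + t) = rcomp s i \<bullet> z}"
  proof (rule rcomp_induct[OF r])
    fix j
    have j: "rcomp r j \<in> A j" by (rule rcomp_in[OF r])
    have *: "rcomp r j \<bullet> z \<in> D (int j + t)" by (rule graded_smult[OF j z])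
    show "rcomp r j \<in> {s \<in> carrier R. mcomp (s \<bullet> z) (int i + t) = rcomp s i \<bullet> z}"
      using mcomp_homogeneous[OF *, of "int i + t"] rcomp_homogeneous[OF j, of i] zc A_carrier[OF j] by auto
  next
    show "\<zero> \<in> {s \<in> carrier R. mcomp (s \<bullet> z) (int i + t) = rcomp s i \<bullet> z}"
      using zc rcomp_zero by (simp add: mcomp_zero)
  qed (use zc rcomp_carrier in \<open>auto simp: mcomp_add rcomp_add smult_l_distr\<close>)
  then show ?thesis by simp
qed

lemma colon_homog:
  assumes K: "graded_sub K" and x: "x \<in> D u" shows "homog (colon K x)"
proof -
  have "rcomp r i \<bullet> x \<in> K" if "r \<in> carrier R" "r \<bullet> x \<in> K" for r i
    using graded_sub_mcomp[OF K that(2), of "int i + u"] mcomp_smult_component[OF that(1) x, of i] by simp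
  then show ?thesis using rcomp_carrier by (auto simp: homog_def colon_def)
qed

text \<open>Suppose some \<open>r\<close> in \<open>p\<close> has a component outside
  \<open>p\<close>; let \<open>r_a\<close> be the lowest such, and \<open>x_b\<close> the lowest
  component of \<open>x\<close> outside \<open>K\<close>. In degree \<open>a + b\<close>,
  \<open>r x \<in> K\<close> forces \<open>r_a x_b \<in> K\<close>. So \<open>r_a x\<close> has the
  same colon ideal by primality but fewer components outside \<open>K\<close>, and induction on
  their number applies.\<close>

lemma prime_colon_homog:
  assumes K: "graded_sub K" and x: "x \<in> carrier M" and p: "primeideal (colon K x) R"
  shows "homog (colon K x)"
  using x p
proof (induct "card {u. mcomp x u \<notin> K}" arbitrary: x rule: less_induct)
  case less
  note x = less(2) and p = less(3)
  have Ks: "submodule K R M" by (rule graded_subD[OF K])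
  define p where "p = colon K x"
  have pc: "p \<subseteq> carrier R" by (auto simp: p_def colon_def)
  define S where "S y = {u. mcomp y u \<notin> K}" for y
  have finS: "finite (S y)" if "y \<in> carrier M" for y
    by (rule finite_subset[OF _ finite_mcomp[OF that]]) (use sub_zero[OF Ks] in \<open>auto simp: S_def\<close>)
  show ?case
  proof (rule ccontr)
    assume "\<not> homog (colon K x)"
    then obtain r i where r: "r \<in> p" "rcomp r i \<notin> p" by (auto simp: homog_def p_def)
    have rC: "r \<in> carrier R" using r pc by auto
    define a where "a = (LEAST i. rcomp r i \<notin> p)"
    have a: "rcomp r a \<notin> p" "\<And>j. j < a \<Longrightarrow> rcomp r j \<in> p"
      unfolding a_def using LeastI[of "\<lambda>i. rcomp r i \<notin> p", OF r(2)] not_less_Least[of _ "\<lambda>i. rcomp r i \<notin> p"]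
      by blast+
    have "S x \<noteq> {}"
    proof
      assume "S x = {}"
      then have "x \<in> K" using graded_sub_iff[OF K x] by (auto simp: S_def)
      then have "colon K x = carrier R" using sub_smult[OF Ks] by (auto simp: colon_def)
      then show False using primeideal.I_notcarr[OF p] by simp
    qed
    define b where "b = Min (S x)"
    have b: "b \<in> S x" "\<And>u. u < b \<Longrightarrow> u \<notin> S x"
      unfolding b_def using Min_in[OF finS[OF x] \<open>S x \<noteq> {}\<close>] Min_le[OF finS[OF x]] by fastforce+
    define v where "v = int a + b"
    define Z where "Z = {s \<in> carrier R. mcomp (s \<bullet> x) v \<in> K}"
    have Zadd: "s \<oplus> t \<in> Z" if "s \<in> Z" "t \<in> Z" for s t
      using that x sub_add[OF Ks] by (auto simp: Z_def smult_l_distr mcomp_add)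
    have Z0: "\<zero> \<in> Z" using x sub_zero[OF Ks] by (simp add: Z_def mcomp_zero)
    \<comment> \<open>Components of \<open>r\<close> below \<open>a\<close> lie in \<open>p\<close>;
      those above \<open>a\<close> meet, in degree \<open>v\<close>, only components of
      \<open>x\<close> below \<open>b\<close>, which lie in \<open>K\<close>.\<close>
    have Zj: "rcomp r j \<in> Z" if "j \<noteq> a" for j
    proof (cases "j < a")
      case True
      then have "rcomp r j \<bullet> x \<in> K" using a(2) by (auto simp: p_def colon_def)
      then show ?thesis using graded_sub_mcomp[OF K] rcomp_carrier[OF rC] by (simp add: Z_def)
    next
      case False
      then have "v - int j \<notin> S x" using b(2) that by (simp add: v_def)
      then have "mcomp x (v - int j) \<in> K" by (simp add: S_def)
      then show ?thesis
        using mcomp_smult[OF rcomp_in[OF rC] x] sub_smult[OF Ks rcomp_carrier[OF rC]] rcomp_carrier[OF rC] by (simp add: Z_def)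
    qed
    obtain s where sC: "s \<in> carrier R" and rs: "r = s \<oplus> rcomp r a"
      and sj: "\<And>j. rcomp s j = (if j = a then \<zero> else rcomp r j)"
      using remove_component[OF rC] by blast
    have "s \<in> Z" by (rule rcomp_induct[OF sC]) (use sj Zj Z0 Zadd in auto)
    have "r \<in> Z" using r(1) graded_sub_mcomp[OF K] rC by (auto simp: Z_def p_def colon_def)
    have "mcomp (r \<bullet> x) v = mcomp (rcomp r a \<bullet> x) v \<oplus>\<^bsub>M\<^esub> mcomp (s \<bullet> x) v"
      using rs x sC rcomp_carrier[OF rC] mcomp_carrier by (metis M.a_comm mcomp_add smult_closed smult_l_distr)
    then have "mcomp (rcomp r a \<bullet> x) v \<in> K"
      using sub_add_cancel[OF Ks, of "mcomp (s \<bullet> x) v" "mcomp (rcomp r a \<bullet> x) v"]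
        \<open>s \<in> Z\<close> \<open>r \<in> Z\<close> x rcomp_carrier[OF rC] mcomp_carrier by (auto simp: Z_def)
    define x' where "x' = rcomp r a \<bullet> x"
    have x'c: "x' \<in> carrier M" using x rcomp_carrier[OF rC] by (simp add: x'_def)
    have cx': "colon K x' = colon K x"
      unfolding x'_def by (rule colon_prime_smult[OF Ks x p rcomp_carrier[OF rC]]) (use a in \<open>simp add: p_def\<close>)
    \<comment> \<open>Multiplication by \<open>r_a\<close> shifts the components of \<open>x\<close>
      outside \<open>K\<close> by \<open>a\<close> and loses at least the one in degree
      \<open>b\<close>.\<close>
    have "S x' \<subseteq> (\<lambda>u. int a + u) ` (S x - {b})"
    proof
      fix u assume u: "u \<in> S x'"
      have "mcomp x' u = rcomp r a \<bullet> mcomp x (u - int a)" unfolding x'_def by (rule mcomp_smult[OF rcomp_in[OF rC] x])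
      then have "u - int a \<in> S x" using u sub_smult[OF Ks rcomp_carrier[OF rC]] by (auto simp: S_def)
      moreover have "u \<noteq> v" using u \<open>mcomp (rcomp r a \<bullet> x) v \<in> K\<close> by (auto simp: S_def x'_def)
      ultimately show "u \<in> (\<lambda>u. int a + u) ` (S x - {b})"
        by (intro image_eqI[where x = "u - int a"]) (auto simp: v_def)
    qed
    then have "card (S x') \<le> card ((\<lambda>u. int a + u) ` (S x - {b}))" using finS[OF x] by (intro card_mono) auto
    also have "\<dots> \<le> card (S x - {b})" using finS[OF x] by (intro card_image_le) auto
    also have "\<dots> < card (S x)" using b(1) finS[OF x] by (intro card_Diff1_less) auto
    finally have "homog (colon K x')" using less(1)[of x'] x'c p cx' by (simp add: S_def)
    then show False using r cx' by (auto simp: homog_def p_def)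
  qed
qed

lemma homogeneous_smult_mcomp:
  assumes "graded_sub K" "s \<in> A i" "x \<in> carrier M" "s \<bullet> x \<in> K"
  shows "s \<bullet> mcomp x u \<in> K"
  using graded_sub_mcomp[OF assms(1,4), of "u + int i"] mcomp_smult[OF assms(2,3), of "u + int i"] by simp

lemma homog_subset_colon:
  assumes K: "graded_sub K" and x: "x \<in> carrier M" and p: "homog p" "p \<subseteq> colon K x"
  shows "p \<subseteq> colon K (mcomp x u)"
proof
  have Ks: "submodule K R M" by (rule graded_subD[OF K])
  fix r assume r: "r \<in> p"
  have rC: "r \<in> carrier R" using r p(2) by (auto simp: colon_def)
  show "r \<in> colon K (mcomp x u)"
  proof (rule rcomp_induct[OF rC])
    fix i
    have "rcomp r i \<bullet> x \<in> K" using p r by (auto simp: homog_def colon_def)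
    then show "rcomp r i \<in> colon K (mcomp x u)"
      using homogeneous_smult_mcomp[OF K rcomp_in[OF rC] x] rcomp_carrier[OF rC] by (simp add: colon_def)
  qed (use mcomp_carrier[OF x] sub_zero[OF Ks] sub_add[OF Ks] in \<open>auto simp: colon_def smult_l_distr\<close>)
qed

text \<open>Each component has colon ideal at least \<open>p\<close>. If all were strictly larger, a
  product of scalars outside \<open>p\<close>, one for each nonzero component, would carry every
  component and hence \<open>x\<close> into \<open>K\<close>, although it lies outside the prime
  \<open>p\<close>.\<close>

lemma prime_colon_component:
  assumes K: "graded_sub K" and x: "x \<in> carrier M" and p: "primeideal (colon K x) R"
  shows "\<exists>u. colon K (mcomp x u) = colon K x"
proof (rule ccontr)
  assume neg: "\<nexists>u. colon K (mcomp x u) = colon K x"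
  have Ks: "submodule K R M" by (rule graded_subD[OF K])
  define p where "p = colon K x"
  have P: "primeideal p R" using p by (simp add: p_def)
  have h: "homog p" using prime_colon_homog[OF K x p] by (simp add: p_def)
  have sub: "p \<subseteq> colon K (mcomp x u)" for u
    by (rule homog_subset_colon[OF K x h]) (simp add: p_def)
  have "\<exists>r\<in>carrier R. r \<notin> p \<and> (\<forall>u\<in>F. r \<bullet> mcomp x u \<in> K)" if "finite F" for F
    using that
  proof induct
    case empty
    have "p \<noteq> carrier R" "p \<subseteq> carrier R" using primeideal.I_notcarr[OF P] by (auto simp: p_def colon_def)
    then show ?case by blast
  next
    case (insert u F)
    then obtain r where r: "r \<in> carrier R" "r \<notin> p" "\<forall>u\<in>F. r \<bullet> mcomp x u \<in> K" by blast
    obtain s where s: "s \<in> carrier R" "s \<notin> p" "s \<bullet> mcomp x u \<in> K"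
      using neg sub[of u] unfolding p_def colon_def by blast
    have "r \<otimes> s \<notin> p" using primeideal.I_prime[OF P r(1) s(1)] r s by blast
    moreover have "(r \<otimes> s) \<bullet> mcomp x w \<in> K" if w: "w \<in> insert u F" for w
    proof (cases "w = u")
      case True
      then show ?thesis using r s mcomp_carrier[OF x] sub_smult[OF Ks] by (simp add: smult_assoc1)
    next
      case False
      then have "s \<bullet> (r \<bullet> mcomp x w) \<in> K" using w r s sub_smult[OF Ks] by auto
      then show ?thesis using r s mcomp_carrier[OF x] smult_commute by (simp add: smult_assoc1)
    qed
    ultimately show ?case using r s by (intro bexI[of _ "r \<otimes> s"]) auto
  qed
  from this[OF finite_mcomp[OF x]] obtain r where r: "r \<in> carrier R" "r \<notin> p"
    "\<And>u. mcomp x u \<noteq> \<zero>\<^bsub>M\<^esub> \<Longrightarrow> r \<bullet> mcomp x u \<in> K" by blast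
  have "x \<in> {x \<in> carrier M. r \<bullet> x \<in> K}"
  proof (rule mcomp_induct[OF x])
    fix u
    show "mcomp x u \<in> {x \<in> carrier M. r \<bullet> x \<in> K}"
      using r mcomp_carrier[OF x] sub_zero[OF Ks] by (cases "mcomp x u = \<zero>\<^bsub>M\<^esub>") auto
  qed (use r(1) sub_zero[OF Ks] sub_add[OF Ks] in \<open>auto simp: smult_r_distr\<close>)
  then show False using r by (auto simp: p_def colon_def)
qed

end


section \<open>Eventual linearity of the initial degree\<close>

definition is_least :: "int set \<Rightarrow> int \<Rightarrow> bool" where
  "is_least S m \<longleftrightarrow> m \<in> S \<and> (\<forall>u\<in>S. m \<le> u)"

lemma is_least_exists:
  assumes "S \<noteq> {}" "\<And>u. u \<in> S \<Longrightarrow> u0 \<le> u"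
  shows "\<exists>m. is_least S m"
proof -
  obtain s where s: "s \<in> S" using assms(1) by blast
  have fin: "finite (S \<inter> {u0..s})" by simp
  have "Min (S \<inter> {u0..s}) \<in> S \<inter> {u0..s}"
    by (rule Min_in[OF fin]) (use s assms(2) in auto)
  moreover have "Min (S \<inter> {u0..s}) \<le> u" if "u \<in> S" for u
  proof (cases "u \<le> s")
    case True
    then show ?thesis using that assms(2) by (intro Min_le[OF fin]) auto
  next
    case False
    have "Min (S \<inter> {u0..s}) \<le> s" by (rule Min_le[OF fin]) (use s assms(2) in auto)
    then show ?thesis using False by linarith
  qed
  ultimately show ?thesis unfolding is_least_def by blast
qed

lemma eventually_constant:
  fixes g :: "nat \<Rightarrow> int"
  assumes "\<And>n. n \<ge> n1 \<Longrightarrow> g n \<le> g (Suc n)" "\<And>n. n \<ge> n1 \<Longrightarrow> g n \<le> C"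
  shows "\<exists>b. \<forall>\<^sub>F n in sequentially. g n = b"
proof -
  have mono: "g i \<le> g j" if "n1 \<le> i" "i \<le> j" for i j
    using that(2)
  proof (induct j rule: dec_induct)
    case (step j)
    then show ?case using assms(1)[of j] that(1) by linarith
  qed simp
  have "g ` {n1..} \<subseteq> {g n1..C}" using mono[of n1] assms(2) by auto
  then have fin: "finite (g ` {n1..})" by (rule finite_subset) simp
  have "Max (g ` {n1..}) \<in> g ` {n1..}" by (rule Max_in[OF fin]) auto
  then obtain n2 where n2: "n2 \<ge> n1" "g n2 = Max (g ` {n1..})" by auto
  have "g n = g n2" if n: "n \<ge> n2" for n
  proof (rule antisym)
    show "g n \<le> g n2" unfolding n2(2) by (rule Max_ge[OF fin]) (use n n2 in auto)
    show "g n2 \<le> g n" by (rule mono[OF n2(1) n])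
  qed
  then show ?thesis unfolding eventually_sequentially by blast
qed

context graded_module
begin

lemma pow_smult_D:
  assumes a: "a \<in> A i" and x: "x \<in> D u"
  shows "(a [^] k) \<bullet> x \<in> D (int (i * k) + u)"
proof (induct k)
  case 0
  then show ?case using x D_carrier[OF x] by simp
next
  case (Suc k)
  have "(a [^] Suc k) \<bullet> x = a \<bullet> ((a [^] k) \<bullet> x)"
    by (rule smult_pow_Suc[OF A_carrier[OF a] D_carrier[OF x]])
  then show ?case using graded_smult[OF a Suc] by (simp add: algebra_simps)
qed

section \<open>Nilpotent and persistent generators on a quotient of families\<close>

definition degrees :: "'b set \<Rightarrow> 'b set \<Rightarrow> int set" where
  "degrees K L = {u. \<exists>x\<in>K \<inter> D u. x \<notin> L}"

text \<open>The elements that \<open>a^k\<close> sends into \<open>W\<close> form an ascending chain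
  of subfamilies of \<open>V\<close>, which stops at some \<open>k0\<close>. If it has not exhausted
  \<open>V\<close> there, a homogeneous component escapes it, and escapes for every
  exponent.\<close>

lemma nilpotent_or_persistent:
  assumes B: "B \<subseteq> carrier R" and V: "family B V" "noeth B V" "\<And>n. graded_sub (V n)"
    and W: "family B W" and a: "a \<in> B"
  shows "(\<exists>k. \<forall>n. \<forall>x\<in>V n. (a [^] k) \<bullet> x \<in> W (n + k)) \<or>
    (\<exists>n u. \<exists>x\<in>V n \<inter> D u. \<forall>k. (a [^] k) \<bullet> x \<notin> W (n + k))"
proof -
  define Z where "Z k n = {x \<in> V n. (a [^] k) \<bullet> x \<in> W (n + k)}" for k :: nat and n
  have Vs: "submodule (V n) R M" and Ws: "submodule (W n) R M" for n using V W family_sub by auto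
  have aC: "a \<in> carrier R" using a B by auto
  have Zs: "submodule (Z k n) R M" for k n
    unfolding Z_def by (rule submodule_preimage[OF Vs Ws]) (use aC in simp)
  have "family B (Z k)" for k
  proof (rule familyI[OF Zs])
    fix b n x assume b: "b \<in> B" and x: "x \<in> Z k n"
    have xV: "x \<in> V n" "(a [^] k) \<bullet> x \<in> W (n + k)" using x by (auto simp: Z_def)
    have "(a [^] k) \<bullet> (b \<bullet> x) = b \<bullet> ((a [^] k) \<bullet> x)"
      by (rule smult_commute) (use aC b B sub_carrier[OF Vs xV(1)] in auto)
    then show "b \<bullet> x \<in> Z k (Suc n)"
      using family_mult[OF V(1) b xV(1)] family_mult[OF W b xV(2)] by (simp add: Z_def)
  qed
  moreover have "Z k \<le> V" for k by (auto simp: Z_def le_fun_def)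
  moreover have ZS: "Z k \<le> Z (Suc k)" for k
  proof (rule le_funI, rule subsetI)
    fix n x assume "x \<in> Z k n"
    then have "x \<in> V n" "(a [^] k) \<bullet> x \<in> W (n + k)" by (auto simp: Z_def)
    then show "x \<in> Z (Suc k) n"
      using family_mult[OF W a, of "(a [^] k) \<bullet> x"] smult_pow_Suc[OF aC sub_carrier[OF Vs], of x n k]
      unfolding Z_def by (metis (mono_tags, lifting) add_Suc_right mem_Collect_eq)
  qed
  ultimately obtain k0 where k0: "\<And>k. k \<ge> k0 \<Longrightarrow> Z k = Z k0" using noethE[OF V(2), of Z] by blast
  have Zle: "Z k n \<subseteq> Z k0 n" for k n
    using k0[of k] lift_Suc_mono_le[of Z k k0, OF ZS] by (cases "k \<ge> k0") (auto simp: le_fun_def)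
  show ?thesis
  proof (cases "\<forall>n. V n \<subseteq> Z k0 n")
    case True
    then show ?thesis by (auto simp: Z_def)
  next
    case False
    then obtain n x where x: "x \<in> V n" "x \<notin> Z k0 n" by blast
    have xc: "x \<in> carrier M" using x sub_carrier[OF Vs] by blast
    obtain u where u: "mcomp x u \<notin> Z k0 n"
      using x(2) mcomp_induct[OF xc, of "Z k0 n"] sub_zero[OF Zs] sub_add[OF Zs] by blast
    have "mcomp x u \<in> V n \<inter> D u" using graded_sub_mcomp[OF V(3) x(1)] mcomp_in[OF xc] by blast
    moreover have "(a [^] k) \<bullet> mcomp x u \<notin> W (n + k)" for k
      using u Zle[of k n] calculation by (auto simp: Z_def)
    ultimately show ?thesis by blast
  qed
qed

text \<open>\<open>generated y V W S n\<close> says \<open>V\<^sub>n\<^sub>+\<^sub>1 \<subseteq> (\<Sum>i\<in>S. y\<^sub>i V\<^sub>n) + W\<^sub>n\<^sub>+\<^sub>1\<close>.\<close>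

definition generated :: "('i \<Rightarrow> 'a) \<Rightarrow> (nat \<Rightarrow> 'b set) \<Rightarrow> (nat \<Rightarrow> 'b set) \<Rightarrow> 'i set \<Rightarrow> nat \<Rightarrow> bool" where
  "generated y V W S n \<longleftrightarrow> (\<forall>H. submodule H R M \<longrightarrow> W (Suc n) \<subseteq> H \<longrightarrow>
     (\<forall>i\<in>S. \<forall>x\<in>V n. y i \<bullet> x \<in> H) \<longrightarrow> V (Suc n) \<subseteq> H)"

text \<open>Descending induction on \<open>k\<close> puts \<open>y_i^k V_(n+1-k)\<close> into
  \<open>H\<close>; nilpotency starts it at \<open>k = K\<close>. In one step
  \<open>V_(n+1-k)\<close> is expanded by its generators: for \<open>j\<close> in \<open>S\<close>
  the power \<open>y_i^k\<close> is first absorbed into \<open>V_n\<close>, while the term of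
  \<open>y_i\<close> raises the exponent to \<open>k + 1\<close>. The bound \<open>n1 + K\<close>
  keeps every level used at or above \<open>n1\<close>.\<close>

lemma generated_remove_nilpotent:
  assumes Y: "y ` Y \<subseteq> carrier R" and V: "family (y ` Y) V" and W: "family (y ` Y) W"
    and i: "i \<in> Y" "S \<subseteq> Y" and nil: "\<And>n x. x \<in> V n \<Longrightarrow> (y i [^] K) \<bullet> x \<in> W (n + K)"
    and gen: "\<And>n. n \<ge> n1 \<Longrightarrow> generated y V W (insert i S) n"
    and n: "n \<ge> n1 + K"
  shows "generated y V W S n"
  unfolding generated_def
proof (intro allI impI)
  fix H assume H: "submodule H R M" "W (Suc n) \<subseteq> H" "\<forall>i\<in>S. \<forall>x\<in>V n. y i \<bullet> x \<in> H"
  have yi: "y i \<in> carrier R" using Y i by auto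
  have Vs: "submodule (V n) R M" and Ws: "submodule (W n) R M" for n using V W family_sub by auto
  have main: "\<forall>x\<in>V (Suc n - k). (y i [^] k) \<bullet> x \<in> H" if "k \<le> K" for k
    using that
  proof (induct k rule: inc_induct)
    case base
    have "Suc n - K + K = Suc n" using n by simp
    then show ?case using nil H(2) by (metis subsetD)
  next
    case (step k)
    define m where "m = n - k"
    have m: "Suc n - Suc k = m" "Suc n - k = Suc m" "m \<ge> n1" "m + k = n" "Suc m + k = Suc n"
      using step n by (auto simp: m_def)
    define H' where "H' = {x \<in> carrier M. (y i [^] k) \<bullet> x \<in> H}"
    have H's: "submodule H' R M"
      unfolding H'_def by (rule submodule_preimage[OF carrier_is_submodule H(1)]) (use yi in simp)
    have 1: "W (Suc m) \<subseteq> H'"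
    proof
      fix w assume w: "w \<in> W (Suc m)"
      then have "(y i [^] k) \<bullet> w \<in> W (Suc m + k)" using family_mult_pow[OF W _ yi] i by blast
      then show "w \<in> H'" using H(2) m(5) sub_carrier[OF Ws w] by (auto simp: H'_def)
    qed
    have 2: "y j \<bullet> x \<in> H'" if j: "j \<in> insert i S" and x: "x \<in> V m" for j x
    proof -
      have xc: "x \<in> carrier M" using x sub_carrier[OF Vs] by blast
      have yj: "y j \<in> carrier R" using j i Y by auto
      have "(y i [^] k) \<bullet> (y j \<bullet> x) = y j \<bullet> ((y i [^] k) \<bullet> x)"
        by (rule smult_commute) (use yi yj xc in auto)
      moreover have "y j \<bullet> ((y i [^] k) \<bullet> x) \<in> H"
      proof (cases "j \<in> S")
        case True
        have "(y i [^] k) \<bullet> x \<in> V n" using family_mult_pow[OF V _ yi x, of k] i m by auto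
        then show ?thesis using True H(3) by blast
      next
        case False
        then have "j = i" using j by blast
        then show ?thesis using step(3) m(1) x smult_pow_Suc[OF yi xc, of k] by auto
      qed
      ultimately show ?thesis using yj xc by (simp add: H'_def)
    qed
    have "V (Suc m) \<subseteq> H'"
      using gen[OF m(3)] H's 1 2 unfolding generated_def by blast
    then show ?case using m(2) by (auto simp: H'_def)
  qed
  then show "V (Suc n) \<subseteq> H" using main[of 0] sub_carrier[OF Vs] by force
qed

text \<open>The persistent element is returned together with the slope because its multiples later
  bound the v-number from above with the same slope.\<close>

theorem initial_degree_linear:
  assumes Y: "finite Y" "\<And>i. i \<in> Y \<Longrightarrow> y i \<in> A (dy i)"
    and V: "family (y ` Y) V" "noeth (y ` Y) V" "\<And>n. graded_sub (V n)"
    and W: "family (y ` Y) W" "\<And>n. graded_sub (W n)" "W \<le> V"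
    and u0: "\<And>u x. u < u0 \<Longrightarrow> x \<in> carrier M \<Longrightarrow> mcomp x u = \<zero>\<^bsub>M\<^esub>"
  shows "(\<forall>\<^sub>F n in sequentially. V n = W n) \<or>
    (\<exists>\<gamma>\<in>Y. (\<exists>b. \<forall>\<^sub>F n in sequentially. is_least (degrees (V n) (W n)) (int (dy \<gamma>) * int n + b)) \<and>
      (\<exists>n u. \<exists>x\<in>V n \<inter> D u. \<forall>k. (y \<gamma> [^] k) \<bullet> x \<notin> W (n + k)))"
proof -
  have YC: "y ` Y \<subseteq> carrier R" using Y A_carrier by blast
  have Vs: "submodule (V n) R M" and Ws: "submodule (W n) R M" for n using V W family_sub by auto
  define nil where "nil i \<longleftrightarrow> (\<exists>k. \<forall>n. \<forall>x\<in>V n. (y i [^] k) \<bullet> x \<in> W (n + k))" for i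
  obtain n1 where n1: "\<And>n. n \<ge> n1 \<Longrightarrow> V (Suc n) = ideal_smult R M (Idl (y ` Y)) (V n)"
    using noeth_eventually_generated[OF YC V(1,2)] by blast
  have gen0: "generated y V W Y n" if "n \<ge> n1" for n
    unfolding generated_def n1[OF that]
    by (intro allI impI, rule ideal_smult_Idl_least[OF YC]) (use sub_carrier[OF Vs] in auto)
  have remove: "\<exists>n2. \<forall>n\<ge>n2. generated y V W S n"
    if "finite F" "F \<union> S = Y" "\<And>i. i \<in> F \<Longrightarrow> nil i" for F S
    using that
  proof (induct F arbitrary: S rule: finite_induct)
    case empty
    then show ?case using gen0 by auto
  next
    case (insert i F)
    obtain n2 where n2: "\<And>n. n \<ge> n2 \<Longrightarrow> generated y V W (insert i S) n"
      using insert(3)[of "insert i S"] insert(4,5) by auto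
    obtain k where k: "\<And>n x. x \<in> V n \<Longrightarrow> (y i [^] k) \<bullet> x \<in> W (n + k)"
      using insert(5)[of i] by (auto simp: nil_def)
    have "generated y V W S n" if "n \<ge> n2 + k" for n
      by (rule generated_remove_nilpotent[OF YC V(1) W(1) _ _ k n2 that]) (use insert(4) in auto)
    then show ?case by blast
  qed
  define S where "S = {i \<in> Y. \<not> nil i}"
  have "\<exists>n2. \<forall>n\<ge>n2. generated y V W S n"
    by (rule remove[of "{i \<in> Y. nil i}"]) (use Y(1) in \<open>auto simp: S_def\<close>)
  then obtain n2 where n2: "\<And>n. n \<ge> n2 \<Longrightarrow> generated y V W S n" by blast
  show ?thesis
  proof (cases "S = {}")
    case True
    have "V (Suc n) \<subseteq> W (Suc n)" if "n \<ge> n2" for n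
      using n2[OF that] Ws[of "Suc n"] unfolding True generated_def by simp
    moreover have "W n \<subseteq> V n" for n using W(3) by (simp add: le_fun_def)
    ultimately have "V n = W n" if "n \<ge> Suc n2" for n
      using that by (cases n) (auto intro: equalityI)
    then show ?thesis unfolding eventually_sequentially by blast
  next
    case False
    have finS: "finite S" using Y(1) by (simp add: S_def)
    define \<gamma> where "\<gamma> = arg_min_on dy S"
    have \<gamma>: "\<gamma> \<in> S" "\<And>i. i \<in> S \<Longrightarrow> dy \<gamma> \<le> dy i"
      unfolding \<gamma>_def using arg_min_if_finite(1)[OF finS False] arg_min_least[OF finS False] by auto
    have \<gamma>Y: "\<gamma> \<in> Y" using \<gamma> by (simp add: S_def)
    have \<gamma>A: "y \<gamma> \<in> A (dy \<gamma>)" "y \<gamma> \<in> carrier R" using \<gamma>Y Y(2) A_carrier by auto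
    have "\<not> nil \<gamma>" using \<gamma> by (simp add: S_def)
    then have "\<exists>n u. \<exists>x\<in>V n \<inter> D u. \<forall>k. (y \<gamma> [^] k) \<bullet> x \<notin> W (n + k)"
      using nilpotent_or_persistent[OF YC V W(1), of "y \<gamma>"] \<gamma>Y unfolding nil_def by blast
    then obtain n0 u x where x: "x \<in> V n0" "x \<in> D u" "\<And>k. (y \<gamma> [^] k) \<bullet> x \<notin> W (n0 + k)"
      by blast
    have mem: "int (dy \<gamma> * k) + u \<in> degrees (V (n0 + k)) (W (n0 + k))" for k
      using x(3) family_mult_pow[OF V(1) _ \<gamma>A(2) x(1), of k] \<gamma>Y pow_smult_D[OF \<gamma>A(1) x(2), of k]
      by (auto simp: degrees_def)
    have bdd: "u0 \<le> v" if v: "v \<in> degrees (V n) (W n)" for v n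
    proof (rule ccontr)
      assume "\<not> u0 \<le> v"
      moreover obtain z where z: "z \<in> V n" "z \<in> D v" "z \<notin> W n" using v by (auto simp: degrees_def)
      ultimately have "mcomp z v = \<zero>\<^bsub>M\<^esub>" using u0 sub_carrier[OF Vs] by simp
      then show False using mcomp_homogeneous[OF z(2), of v] z(3) sub_zero[OF Ws] by auto
    qed
    have "\<exists>m. is_least (degrees (V n) (W n)) m" if n: "n \<ge> n0" for n
    proof (rule is_least_exists[OF _ bdd])
      show "degrees (V n) (W n) \<noteq> {}" using mem[of "n - n0"] n by auto
    qed
    then obtain f where f: "\<And>n. n \<ge> n0 \<Longrightarrow> is_least (degrees (V n) (W n)) (f n)" by metis
    define g where "g n = f n - int (dy \<gamma>) * int n" for n
    have "g n \<le> u - int (dy \<gamma>) * int n0" if n: "n \<ge> n0" for n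
    proof -
      have "f n \<le> int (dy \<gamma> * (n - n0)) + u" using f[OF n] mem[of "n - n0"] n by (auto simp: is_least_def)
      then show ?thesis using n by (simp add: g_def of_nat_diff algebra_simps)
    qed
    \<comment> \<open>Every surviving generator has degree at least that of
      \<open>y \<gamma>\<close>. If the least degree \<open>w\<close> at level \<open>n + 1\<close>
      were too small, components of \<open>y_i t\<close> up to degree \<open>w\<close> would come
      from components of \<open>t\<close> below \<open>f n\<close>, which lie in \<open>W n\<close>.
      All of \<open>V (Suc n)\<close> would then be trivial modulo \<open>W\<close> up to degree
      \<open>w\<close>.\<close>
    moreover have "g n \<le> g (Suc n)" if n: "n \<ge> max n0 n2" for n
    proof (rule ccontr)
      assume "\<not> g n \<le> g (Suc n)"
      then have lt: "f (Suc n) - int (dy \<gamma>) < f n" by (simp add: g_def algebra_simps)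
      define w where "w = f (Suc n)"
      obtain z where z: "z \<in> V (Suc n)" "z \<in> D w" "z \<notin> W (Suc n)"
        using f[of "Suc n"] n by (auto simp: is_least_def degrees_def w_def)
      have low: "mcomp t v \<in> W n" if "t \<in> V n" "v < f n" for t v
        using f[of n] n that graded_sub_mcomp[OF V(3) that(1)] mcomp_in[OF sub_carrier[OF Vs that(1)]]
        by (force simp: is_least_def degrees_def)
      have "V (Suc n) \<subseteq> comps_in {..w} (W (Suc n))"
      proof -
        have "generated y V W S n" using n2 n by simp
        moreover have "submodule (comps_in {..w} (W (Suc n))) R M" by (rule submodule_comps_in[OF Ws]) auto
        moreover have "W (Suc n) \<subseteq> comps_in {..w} (W (Suc n))"
          using graded_sub_mcomp[OF W(2)] sub_carrier[OF Ws] by (auto simp: comps_in_def)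
        moreover have "y i \<bullet> t \<in> comps_in {..w} (W (Suc n))" if i: "i \<in> S" and t: "t \<in> V n" for i t
        proof -
          have iY: "i \<in> Y" using i by (simp add: S_def)
          have tc: "t \<in> carrier M" using t sub_carrier[OF Vs] by blast
          have "mcomp (y i \<bullet> t) v \<in> W (Suc n)" if "v \<le> w" for v
          proof -
            have "v - int (dy i) < f n" using that lt \<gamma>(2)[OF i] by (simp add: w_def)
            then show ?thesis
              using mcomp_smult[OF Y(2)[OF iY] tc] family_mult[OF W(1) _ low[OF t]] iY by auto
          qed
          then show ?thesis using tc A_carrier[OF Y(2)[OF iY]] by (simp add: comps_in_def)
        qed
        ultimately show ?thesis unfolding generated_def by blast
      qed
      then have "mcomp z w \<in> W (Suc n)" using z(1) by (auto simp: comps_in_def)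
      then show False using mcomp_homogeneous[OF z(2), of w] z(3) by simp
    qed
    ultimately obtain b where b: "\<forall>\<^sub>F n in sequentially. g n = b"
      using eventually_constant[of "max n0 n2" g "u - int (dy \<gamma>) * int n0"] by auto
    have "\<forall>\<^sub>F n in sequentially. is_least (degrees (V n) (W n)) (int (dy \<gamma>) * int n + b)"
      using b eventually_ge_at_top[of n0]
    proof eventually_elim
      case (elim n)
      then have "f n = int (dy \<gamma>) * int n + b" by (simp add: g_def)
      then show ?case using f[OF elim(2)] by simp
    qed
    then show ?thesis using \<gamma>Y x by blast
  qed
qed

end


section \<open>Local v-numbers as initial degrees\<close>

context graded_module
begin

definition ass_set :: "'b set \<Rightarrow> 'b set \<Rightarrow> 'a set set" where
  "ass_set L K = {p. primeideal p R \<and> (\<exists>x\<in>L. p = colon K x)}"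

definition v_degrees :: "'a set \<Rightarrow> 'b set \<Rightarrow> 'b set \<Rightarrow> int set" where
  "v_degrees p L K = {u. \<exists>x\<in>L \<inter> D u. p = colon K x}"

definition killed :: "'a set \<Rightarrow> 'b set \<Rightarrow> 'b set \<Rightarrow> 'b set" where
  "killed p L K = {x \<in> L. \<forall>a\<in>p. a \<bullet> x \<in> K}"

text \<open>Modulo \<open>K\<close>, the part of \<open>killed\<close> that vanishes under
  homogeneous localization at \<open>p\<close>. A homogeneous element of \<open>killed\<close>
  outside it has annihilator exactly \<open>p\<close> modulo \<open>K\<close> when \<open>p\<close>
  is a homogeneous prime and \<open>K\<close> is graded.\<close>

definition overkilled :: "'a set \<Rightarrow> 'b set \<Rightarrow> 'b set \<Rightarrow> 'b set" where
  "overkilled p L K = {x \<in> killed p L K. \<exists>i. \<exists>s\<in>A i. s \<notin> p \<and> s \<bullet> x \<in> K}"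

lemma primeideal_closed:
  assumes "primeideal p R"
  shows "p \<subseteq> carrier R" "\<zero> \<in> p" "a \<in> p \<Longrightarrow> b \<in> p \<Longrightarrow> a \<oplus> b \<in> p"
proof -
  have "additive_subgroup p R" using assms primeideal.axioms(1) ideal.axioms(1) by blast
  then show "p \<subseteq> carrier R" "\<zero> \<in> p" "a \<in> p \<Longrightarrow> b \<in> p \<Longrightarrow> a \<oplus> b \<in> p"
    by (auto intro: additive_subgroup.a_closed additive_subgroup.zero_closed dest: additive_subgroup.a_Hcarr)
qed

lemma graded_sub_killed:
  assumes L: "graded_sub L" and K: "graded_sub K" and p: "ideal p R" "homog p"
  shows "graded_sub (killed p L K)"
proof -
  have pc: "p \<subseteq> carrier R" using ideal.Icarr[OF p(1)] by auto
  have Ks: "submodule K R M" by (rule graded_subD[OF K])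
  have "a \<bullet> mcomp x u \<in> K" if x: "x \<in> killed p L K" and a: "a \<in> p" for x u a
  proof -
    have xc: "x \<in> carrier M" using x graded_mem[OF L] by (auto simp: killed_def)
    have "p \<subseteq> colon K x" using x pc by (auto simp: killed_def colon_def)
    then show ?thesis using homog_subset_colon[OF K xc p(2), of u] a by (auto simp: colon_def)
  qed
  moreover have "submodule (killed p L K) R M"
    unfolding killed_def by (rule submodule_colon[OF graded_subD[OF L] Ks pc])
  ultimately show ?thesis using graded_sub_mcomp[OF L] by (auto simp: graded_sub_def killed_def)
qed

lemma graded_sub_overkilled:
  assumes L: "graded_sub L" and K: "graded_sub K" and p: "primeideal p R" "homog p"
  shows "graded_sub (overkilled p L K)"
proof -
  have grU: "graded_sub (killed p L K)" by (rule graded_sub_killed[OF L K primeideal.axioms(1)[OF p(1)] p(2)])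
  have Xs: "submodule (killed p L K) R M" and Ks: "submodule K R M" using grU K graded_subD by auto
  have "submodule (overkilled p L K) R M"
  proof (rule submodule_closedI)
    show "overkilled p L K \<subseteq> carrier M" using sub_carrier[OF Xs] by (auto simp: overkilled_def)
    \<comment> \<open>Even for zero a homogeneous scalar outside \<open>p\<close> has to be
      exhibited; some component of 1 is one.\<close>
    have "\<one> \<notin> p" using ideal.one_imp_carrier[OF primeideal.axioms(1)[OF p(1)]] primeideal.I_notcarr[OF p(1)] by auto
    then obtain i where i: "rcomp \<one> i \<notin> p"
      using rcomp_induct[of \<one> p] primeideal_closed(2,3)[OF p(1)] by blast
    then show "\<zero>\<^bsub>M\<^esub> \<in> overkilled p L K"
      using sub_zero[OF Xs] sub_zero[OF Ks] rcomp_in[of \<one> i] A_carrier[OF rcomp_in[of \<one> i]]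
      by (auto simp: overkilled_def intro!: exI[of _ i] bexI[of _ "rcomp \<one> i"])
  next
    fix x z assume "x \<in> overkilled p L K" "z \<in> overkilled p L K"
    then obtain i s j t where s: "s \<in> A i" "s \<notin> p" "s \<bullet> x \<in> K" and t: "t \<in> A j" "t \<notin> p" "t \<bullet> z \<in> K"
      and xz: "x \<in> killed p L K" "z \<in> killed p L K" by (auto simp: overkilled_def)
    have c: "s \<in> carrier R" "t \<in> carrier R" "x \<in> carrier M" "z \<in> carrier M"
      using s t xz A_carrier sub_carrier[OF Xs] by auto
    have "(s \<otimes> t) \<bullet> (x \<oplus>\<^bsub>M\<^esub> z) = t \<bullet> (s \<bullet> x) \<oplus>\<^bsub>M\<^esub> s \<bullet> (t \<bullet> z)"
      using c smult_commute[of s t x] by (simp add: smult_assoc1 smult_r_distr)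
    also have "\<dots> \<in> K" using s t c sub_smult[OF Ks] sub_add[OF Ks] by blast
    finally have "(s \<otimes> t) \<bullet> (x \<oplus>\<^bsub>M\<^esub> z) \<in> K" .
    moreover have "s \<otimes> t \<in> A (i + j)" by (rule graded_mult[OF s(1) t(1)])
    moreover have "s \<otimes> t \<notin> p" using primeideal.I_prime[OF p(1) c(1,2)] s t by blast
    ultimately show "x \<oplus>\<^bsub>M\<^esub> z \<in> overkilled p L K"
      using sub_add[OF Xs xz] unfolding overkilled_def by blast
  next
    fix a x assume a: "a \<in> carrier R" and "x \<in> overkilled p L K"
    then obtain i s where s: "s \<in> A i" "s \<notin> p" "s \<bullet> x \<in> K" and x: "x \<in> killed p L K"
      by (auto simp: overkilled_def)
    have "s \<bullet> (a \<bullet> x) \<in> K"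
      using smult_commute[of s a x] A_carrier[OF s(1)] a sub_carrier[OF Xs x] sub_smult[OF Ks a s(3)] by simp
    then show "a \<bullet> x \<in> overkilled p L K"
      using sub_smult[OF Xs a x] s unfolding overkilled_def by blast
  qed
  moreover have "mcomp x u \<in> overkilled p L K" if x: "x \<in> overkilled p L K" for x u
  proof -
    obtain i s where s: "s \<in> A i" "s \<notin> p" "s \<bullet> x \<in> K" and xX: "x \<in> killed p L K"
      using x by (auto simp: overkilled_def)
    have "s \<bullet> mcomp x u \<in> K" by (rule homogeneous_smult_mcomp[OF K s(1) sub_carrier[OF Xs xX] s(3)])
    then show ?thesis using graded_sub_mcomp[OF grU xX] s unfolding overkilled_def by blast
  qed
  ultimately show ?thesis by (simp add: graded_sub_def)
qed

lemma colon_not_overkilled: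
  assumes "x \<in> L" "p = colon K x"
  shows "x \<in> killed p L K" "x \<notin> overkilled p L K"
  using assms A_carrier by (auto simp: killed_def overkilled_def colon_def)

text \<open>The colon ideal of a homogeneous element is homogeneous, so it suffices to exclude
  homogeneous annihilators outside \<open>p\<close>, and this is what leaving out
  \<open>overkilled\<close> does.\<close>

lemma degrees_killed:
  assumes L: "graded_sub L" and K: "graded_sub K" and p: "primeideal p R" "homog p"
  shows "degrees (killed p L K) (overkilled p L K) = v_degrees p L K"
proof -
  have pc: "p \<subseteq> carrier R" and pz: "\<zero> \<in> p" and pa: "\<And>a b. a \<in> p \<Longrightarrow> b \<in> p \<Longrightarrow> a \<oplus> b \<in> p"
    using primeideal_closed[OF p(1)] by auto
  have "colon K x = p" if x: "x \<in> killed p L K" "x \<in> D u" "x \<notin> overkilled p L K" for x u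
  proof
    show "p \<subseteq> colon K x" using x(1) pc by (auto simp: killed_def colon_def)
    show "colon K x \<subseteq> p"
    proof
      fix r assume r: "r \<in> colon K x"
      have rC: "r \<in> carrier R" using r by (simp add: colon_def)
      have "rcomp r i \<in> colon K x" for i
        using colon_homog[OF K x(2)] r by (simp add: homog_def)
      then have "rcomp r i \<bullet> x \<in> K" for i by (simp add: colon_def)
      then have "rcomp r i \<in> p" for i using x(1,3) rcomp_in[OF rC, of i] unfolding overkilled_def by blast
      then show "r \<in> p" by (rule rcomp_induct[OF rC]) (use pz pa in blast)+
    qed
  qed
  moreover have "x \<in> killed p L K \<and> x \<notin> overkilled p L K" if "x \<in> L" "p = colon K x" for x
    using colon_not_overkilled[OF that] by simp
  moreover have "killed p L K \<subseteq> L" by (auto simp: killed_def)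
  ultimately have "x \<in> killed p L K \<inter> D u \<and> x \<notin> overkilled p L K \<longleftrightarrow> x \<in> L \<inter> D u \<and> p = colon K x" for x u
    by (metis IntE IntI subsetD)
  then show ?thesis unfolding degrees_def v_degrees_def by auto
qed

text \<open>A nonhomogeneous prime is never associated. For homogeneous \<open>p\<close> the claim
  is \<open>initial_degree_linear\<close> for the killed modulo the overkilled elements; where these
  agree, no element has colon ideal \<open>p\<close>.\<close>

lemma local_v_linear:
  assumes Y: "finite Y" "\<And>i. i \<in> Y \<Longrightarrow> y i \<in> A (dy i)"
    and V: "family (y ` Y) V" "noeth (y ` Y) V" "\<And>n. graded_sub (V n)"
    and W: "family (y ` Y) W" "\<And>n. graded_sub (W n)" "W \<le> V"
    and u0: "\<And>u x. u < u0 \<Longrightarrow> x \<in> carrier M \<Longrightarrow> mcomp x u = \<zero>\<^bsub>M\<^esub>"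
    and p: "primeideal p R"
  shows "(\<forall>\<^sub>F n in sequentially. p \<notin> ass_set (V n) (W n)) \<or>
    (\<exists>\<gamma>\<in>Y. \<exists>b. \<forall>\<^sub>F n in sequentially. is_least (v_degrees p (V n) (W n)) (int (dy \<gamma>) * int n + b))"
proof (cases "homog p")
  case False
  have "p \<notin> ass_set (V n) (W n)" for n
    using prime_colon_homog[OF W(2)] sub_carrier[OF graded_subD[OF V(3)]] False by (auto simp: ass_set_def)
  then show ?thesis by simp
next
  case True
  define U where "U n = killed p (V n) (W n)" for n
  define G where "G n = overkilled p (V n) (W n)" for n
  have grU: "graded_sub (U n)" and grG: "graded_sub (G n)" for n
    unfolding U_def G_def using graded_sub_killed graded_sub_overkilled V(3) W(2) p True primeideal.axioms(1) by blast+
  have YC: "y ` Y \<subseteq> carrier R" using Y A_carrier by blast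
  have pc: "p \<subseteq> carrier R" using ideal.Icarr[OF primeideal.axioms(1)[OF p]] by auto
  have comm: "a \<bullet> (b \<bullet> x) \<in> W (Suc n)"
    if "a \<in> carrier R" "b \<in> y ` Y" "x \<in> V n" "a \<bullet> x \<in> W n" for a b x n
    using smult_commute[of a b x] family_mult[OF W(1) that(2,4)] that YC sub_carrier[OF graded_subD[OF V(3)]] by auto
  have famU: "family (y ` Y) U"
  proof (rule familyI)
    fix b n x assume "b \<in> y ` Y" "x \<in> U n"
    then show "b \<bullet> x \<in> U (Suc n)"
      using comm[of _ b x n] family_mult[OF V(1)] pc by (auto simp: U_def killed_def)
  qed (rule graded_subD[OF grU])
  have famG: "family (y ` Y) G"
  proof (rule familyI)
    fix b n x assume b: "b \<in> y ` Y" and x: "x \<in> G n"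
    then obtain i s where s: "s \<in> A i" "s \<notin> p" "s \<bullet> x \<in> W n" and xX: "x \<in> U n"
      by (auto simp: G_def U_def overkilled_def)
    have "s \<bullet> (b \<bullet> x) \<in> W (Suc n)"
      by (rule comm[OF A_carrier[OF s(1)] b _ s(3)]) (use xX in \<open>auto simp: U_def killed_def\<close>)
    then show "b \<bullet> x \<in> G (Suc n)"
      using family_mult[OF famU b xX] s unfolding U_def G_def overkilled_def by blast
  qed (rule graded_subD[OF grG])
  have "noeth (y ` Y) U"
    by (rule noeth_mono[OF V(2)]) (auto simp: U_def killed_def le_fun_def)
  moreover have "G \<le> U" by (auto simp: U_def G_def overkilled_def le_fun_def)
  ultimately have "(\<forall>\<^sub>F n in sequentially. U n = G n) \<or>
    (\<exists>\<gamma>\<in>Y. \<exists>b. \<forall>\<^sub>F n in sequentially. is_least (degrees (U n) (G n)) (int (dy \<gamma>) * int n + b))"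
    using initial_degree_linear[OF Y famU _ grU famG grG _ u0] by blast
  moreover have "degrees (U n) (G n) = v_degrees p (V n) (W n)" for n
    unfolding U_def G_def by (rule degrees_killed[OF V(3) W(2) p True])
  moreover have "p \<notin> ass_set (V n) (W n)" if "U n = G n" for n
    using that colon_not_overkilled[of _ "V n" p "W n"] by (auto simp: U_def G_def ass_set_def)
  ultimately show ?thesis by (auto elim: eventually_mono)
qed

lemma v_degrees_imp_ass: "primeideal p R \<Longrightarrow> u \<in> v_degrees p L K \<Longrightarrow> p \<in> ass_set L K"
  by (auto simp: v_degrees_def ass_set_def)

text \<open>By \<open>local_v_linear\<close> each prime is eventually absent or has a least v-degree
  and so is eventually present. Only finitely many primes ever occur, so one threshold serves them
  all.\<close>

lemma ass_set_stabilizes: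
  assumes R: "noetherian_ring R" and Y: "finite Y" "\<And>i. i \<in> Y \<Longrightarrow> y i \<in> A (dy i)"
    and V: "family (y ` Y) V" "noeth (y ` Y) V" "\<And>n. graded_sub (V n)"
    and W: "family (y ` Y) W" "\<And>n. graded_sub (W n)" "W \<le> V"
    and u0: "\<And>u x. u < u0 \<Longrightarrow> x \<in> carrier M \<Longrightarrow> mcomp x u = \<zero>\<^bsub>M\<^esub>"
  shows "\<exists>P. finite P \<and> (\<forall>\<^sub>F n in sequentially. ass_set (V n) (W n) = P)"
proof -
  have YC: "y ` Y \<subseteq> carrier R" using Y A_carrier by blast
  define F where "F = family_ass V W"
  have finF: "finite F" unfolding F_def by (rule finite_family_ass[OF R YC V(1,2) W(1,3)])
  have sub: "ass_set (V n) (W n) \<subseteq> F" for n by (auto simp: F_def family_ass_def ass_set_def)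
  define P where "P = {p \<in> F. \<forall>\<^sub>F n in sequentially. p \<in> ass_set (V n) (W n)}"
  have each: "\<forall>\<^sub>F n in sequentially. p \<in> ass_set (V n) (W n) \<longleftrightarrow> p \<in> P" if p: "p \<in> F" for p
  proof -
    have pp: "primeideal p R" using p by (simp add: F_def family_ass_def)
    show ?thesis
    proof (cases "p \<in> P")
      case True
      then show ?thesis by (simp add: P_def)
    next
      case False
      have "\<not> (\<exists>\<gamma>\<in>Y. \<exists>b. \<forall>\<^sub>F n in sequentially. is_least (v_degrees p (V n) (W n)) (int (dy \<gamma>) * int n + b))"
      proof
        assume "\<exists>\<gamma>\<in>Y. \<exists>b. \<forall>\<^sub>F n in sequentially. is_least (v_degrees p (V n) (W n)) (int (dy \<gamma>) * int n + b)"
        then have "\<forall>\<^sub>F n in sequentially. p \<in> ass_set (V n) (W n)"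
          using v_degrees_imp_ass[OF pp] by (auto simp: is_least_def elim: eventually_mono)
        then show False using False p by (simp add: P_def)
      qed
      then have "\<forall>\<^sub>F n in sequentially. p \<notin> ass_set (V n) (W n)"
        using local_v_linear[OF Y V W u0 pp] by blast
      then show ?thesis using False by simp
    qed
  qed
  have "\<forall>\<^sub>F n in sequentially. \<forall>p\<in>F. p \<in> ass_set (V n) (W n) \<longleftrightarrow> p \<in> P"
    by (rule eventually_ball_finite[OF finF]) (use each in blast)
  then have "\<forall>\<^sub>F n in sequentially. ass_set (V n) (W n) = P"
    by eventually_elim (use sub in \<open>auto simp: P_def\<close>)
  moreover have "finite P" using finF by (simp add: P_def)
  ultimately show ?thesis by blast
qed


section \<open>Subquotients of the module\<close>

context
  fixes L K
  assumes L: "submodule L R M" and K: "submodule K R M" and KL: "K \<subseteq> L"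
begin

lemma module_restrict: "module R (M\<lparr>carrier := L\<rparr>)"
  using submodule.submodule_is_module[OF L] module_axioms by blast

lemma submodule_restrict: "submodule K R (M\<lparr>carrier := L\<rparr>)"
  using module.module_incl_imp_submodule[OF module_restrict, of K] KL
    submodule.submodule_is_module[OF K] module_axioms by simp

lemma coset_restrict: "K +>\<^bsub>M\<lparr>carrier := L\<rparr>\<^esub> x = K +>\<^bsub>M\<^esub> x"
  by (simp add: a_r_coset_def r_coset_def)

lemma coset_eq_iff:
  assumes x: "x \<in> carrier M" shows "K +>\<^bsub>M\<^esub> x = K \<longleftrightarrow> x \<in> K"
proof
  assume "K +>\<^bsub>M\<^esub> x = K"
  moreover have "\<zero>\<^bsub>M\<^esub> \<oplus>\<^bsub>M\<^esub> x \<in> K +>\<^bsub>M\<^esub> x" using sub_zero[OF K] by (auto simp: a_r_coset_def')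
  ultimately show "x \<in> K" using x by simp
next
  assume xK: "x \<in> K"
  show "K +>\<^bsub>M\<^esub> x = K"
  proof
    show "K +>\<^bsub>M\<^esub> x \<subseteq> K" using xK sub_add[OF K] by (auto simp: a_r_coset_def')
    show "K \<subseteq> K +>\<^bsub>M\<^esub> x"
    proof
      fix k assume k: "k \<in> K"
      then have "k = (k \<ominus>\<^bsub>M\<^esub> x) \<oplus>\<^bsub>M\<^esub> x"
        using x sub_carrier[OF K] by (simp add: a_minus_def M.add.m_assoc M.l_neg)
      then show "k \<in> K +>\<^bsub>M\<^esub> x" using sub_minus[OF K k xK] unfolding a_r_coset_def' by blast
    qed
  qed
qed

text \<open>The bridge from cosets to elements: through it, associated primes and local v-numbers of
  \<open>L/K\<close> become statements about \<open>colon K\<close>.\<close>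

lemma elt_ann_coset:
  assumes x: "x \<in> L" shows "elt_ann R (subquot M L K) (K +>\<^bsub>M\<^esub> x) = colon K x"
proof -
  have "a \<odot>\<^bsub>subquot M L K\<^esub> (K +>\<^bsub>M\<^esub> x) = K +>\<^bsub>M\<^esub> (a \<bullet> x)" if "a \<in> carrier R" for a
    using quot_module_smult[OF module_restrict submodule_restrict that, of x] x
    by (simp add: coset_restrict)
  moreover have "\<zero>\<^bsub>subquot M L K\<^esub> = K" by (simp add: quot_module_def)
  moreover have "K +>\<^bsub>M\<^esub> (a \<bullet> x) = K \<longleftrightarrow> a \<bullet> x \<in> K" if "a \<in> carrier R" for a
    by (rule coset_eq_iff) (use that sub_carrier[OF L x] in simp)
  ultimately show ?thesis
    unfolding elt_ann_def colon_def by (intro Collect_cong) (simp cong: conj_cong)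
qed

lemma carrier_subquot: "carrier (subquot M L K) = (\<lambda>x. K +>\<^bsub>M\<^esub> x) ` L"
  by (auto simp: quot_module_def A_RCOSETS_def RCOSETS_def a_r_coset_def r_coset_def)

lemma Ass_subquot: "Ass R (subquot M L K) = ass_set L K"
  using elt_ann_coset by (auto simp: Ass_def ass_set_def carrier_subquot)

lemma local_v_subquot_eq:
  "local_v_subquot R M D L K p = (INF u\<in>v_degrees p L K. ereal (of_int u))"
proof -
  have "{u. \<exists>x\<in>subquot_grading M D L K u. p = elt_ann R (subquot M L K) x} = v_degrees p L K"
    using elt_ann_coset by (auto simp: subquot_grading_def v_degrees_def)
  then show ?thesis by (simp add: local_v_number_def)
qed

lemma v_subquot_eq:
  "v_subquot R M D L K = (INF p\<in>ass_set L K. INF u\<in>v_degrees p L K. ereal (of_int u))"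
  by (simp add: v_number_def Ass_subquot local_v_subquot_eq)

lemma indeg_subquot_eq: "indeg_subquot M D L K = (INF u\<in>degrees L K. ereal (of_int u))"
proof -
  have "subquot_grading M D L K u \<noteq> {K} \<longleftrightarrow> u \<in> degrees L K" for u
  proof -
    have "\<zero>\<^bsub>M\<^esub> \<in> L \<inter> D u" using sub_zero[OF L] D_zero by blast
    then show ?thesis
      using coset_eq_iff sub_carrier[OF L] by (auto simp: subquot_grading_def degrees_def)
  qed
  have "\<zero>\<^bsub>subquot M L K\<^esub> = K" by (simp add: quot_module_def)
  then have "{u. subquot_grading M D L K u \<noteq> {\<zero>\<^bsub>subquot M L K\<^esub>}} = degrees L K"
    using \<open>\<And>u. subquot_grading M D L K u \<noteq> {K} \<longleftrightarrow> u \<in> degrees L K\<close> by auto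
  then show ?thesis by (simp add: indeg_def)
qed

end

end

lemma INF_is_least: "is_least S m \<Longrightarrow> (INF u\<in>S. ereal (of_int u)) = ereal (of_int m)"
  by (intro antisym INF_lower INF_greatest) (auto simp: is_least_def)


section \<open>Asymptotics of powers\<close>

lemma linear_le:
  fixes a b a' b' :: int
  assumes "a < a' \<or> a = a' \<and> b \<le> b'"
  shows "\<forall>\<^sub>F n in sequentially. a * int n + b \<le> a' * int n + b'"
  \<comment> \<open>Distinct integer slopes differ by at least 1, so from \<open>n = b - b'\<close>
    on the gap makes up for the constants; for equal slopes \<open>b \<le> b'\<close> is
    given.\<close>
  using eventually_ge_at_top[of "nat (b - b')"]
proof eventually_elim
  case (elim n)
  show ?case
  proof (cases "a < a'")
    case True
    then have "(a + 1) * int n \<le> a' * int n" by (intro mult_right_mono) auto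
    moreover have "b - b' \<le> int n" using elim by linarith
    ultimately show ?thesis by (simp add: algebra_simps)
  qed (use assms in auto)
qed

lemma linear_le_slope:
  fixes a b a' b' :: int
  assumes "\<forall>\<^sub>F n in sequentially. a * int n + b \<le> a' * int n + b'"
  shows "a \<le> a'"
proof (rule ccontr)
  assume "\<not> a \<le> a'"
  then have "\<forall>\<^sub>F n in sequentially. a' * int n + (b' + 1) \<le> a * int n + b"
    by (intro linear_le) auto
  with assms have "\<forall>\<^sub>F n::nat in sequentially. False" by eventually_elim auto
  then show False by simp
qed

lemma linear_shift:
  assumes "\<forall>\<^sub>F n in sequentially. Q (m + n) (a * int n + b)"
  shows "\<exists>b'. \<forall>\<^sub>F n in sequentially. Q n (a * int n + b')"
proof
  have "\<forall>\<^sub>F n in sequentially. Q (n + m) (a * int (n + m) + (b - a * int m))"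
    using assms by (simp add: algebra_simps)
  then show "\<forall>\<^sub>F n in sequentially. Q n (a * int n + (b - a * int m))"
    by (simp only: eventually_sequentially_seg[of "\<lambda>n. Q n (a * int n + (b - a * int m))"])
qed

text \<open>The minimum of two linear functions is eventually the one of smaller slope, ties being
  decided by the constants. Hence no slope outside \<open>S\<close> can arise.\<close>

lemma linear_INF:
  fixes f :: "'p \<Rightarrow> nat \<Rightarrow> ereal" and S :: "int set"
  assumes "finite P" "P \<noteq> {}"
    and "\<And>p. p \<in> P \<Longrightarrow> \<exists>a\<in>S. \<exists>b. \<forall>\<^sub>F n in sequentially. f p n = ereal (of_int (a * int n + b))"
  shows "\<exists>a\<in>S. \<exists>b. \<forall>\<^sub>F n in sequentially. (INF p\<in>P. f p n) = ereal (of_int (a * int n + b))"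
  using assms
proof (induct P rule: finite_ne_induct)
  case (singleton p)
  then show ?case by simp
next
  case (insert p P)
  obtain a b where a: "a \<in> S" "\<forall>\<^sub>F n in sequentially. f p n = ereal (of_int (a * int n + b))"
    using insert(5)[of p] by auto
  obtain a' b' where a': "a' \<in> S" "\<forall>\<^sub>F n in sequentially. (INF p\<in>P. f p n) = ereal (of_int (a' * int n + b'))"
    using insert(4,5) by auto
  have eq: "\<forall>\<^sub>F n in sequentially. (INF p\<in>insert p P. f p n) =
    min (ereal (of_int (a * int n + b))) (ereal (of_int (a' * int n + b')))"
    using a(2) a'(2) by eventually_elim (simp add: inf_min)
  consider "a < a' \<or> a = a' \<and> b \<le> b'" | "a' < a \<or> a' = a \<and> b' \<le> b" by linarith
  then show ?case
  proof cases
    case 1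
    have "\<forall>\<^sub>F n in sequentially. (INF p\<in>insert p P. f p n) = ereal (of_int (a * int n + b))"
      using eq linear_le[OF 1]
    proof eventually_elim
      case (elim n)
      show ?case unfolding elim(1) by (rule min_absorb1) (use elim(2) in \<open>simp only: ereal_less_eq of_int_le_iff\<close>)
    qed
    then show ?thesis using a(1) by blast
  next
    case 2
    have "\<forall>\<^sub>F n in sequentially. (INF p\<in>insert p P. f p n) = ereal (of_int (a' * int n + b'))"
      using eq linear_le[OF 2]
    proof eventually_elim
      case (elim n)
      show ?case unfolding elim(1) by (rule min_absorb2) (use elim(2) in \<open>simp only: ereal_less_eq of_int_le_iff\<close>)
    qed
    then show ?thesis using a'(1) by blast
  qed
qed

text \<open>A maximal colon ideal among the multiples of \<open>z\<close> outside \<open>K\<close>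
  is prime. Having the witness as a multiple of the given \<open>z\<close> is what lets
  \<open>persistent_bound\<close> reuse one scalar along a whole sequence.\<close>

lemma (in module) prime_colon_exists:
  assumes R: "noetherian_ring R" and K: "submodule K R M" and z: "z \<in> carrier M" "z \<notin> K"
  shows "\<exists>r\<in>carrier R. primeideal (colon K (r \<bullet> z)) R"
proof -
  define C where "C = {colon K (r \<bullet> z) | r. r \<in> carrier R \<and> r \<bullet> z \<notin> K}"
  have "colon K (\<one> \<bullet> z) \<in> C" unfolding C_def using z by (metis (mono_tags, lifting) R.one_closed mem_Collect_eq smult_one)
  then have ne: "C \<noteq> {}" by blast
  have "ideal Q R" if "Q \<in> C" for Q using that ideal_colon[OF K] z(1) by (auto simp: C_def)
  then obtain Q where Q: "Q \<in> C" "\<And>Q'. Q' \<in> C \<Longrightarrow> Q \<subseteq> Q' \<Longrightarrow> Q' = Q"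
    using noetherian_ring.ideal_set_has_maximal[OF R ne] by blast
  then obtain r where r: "r \<in> carrier R" "r \<bullet> z \<notin> K" "Q = colon K (r \<bullet> z)" by (auto simp: C_def)
  have rz: "r \<bullet> z \<in> carrier M" using r z by simp
  have "primeideal Q R"
  proof (rule primeidealI)
    show "ideal Q R" unfolding r(3) by (rule ideal_colon[OF K rz])
    show "cring R" by (rule R.is_cring)
    have "\<one> \<notin> Q" using r rz by (simp add: colon_def)
    then show "carrier R \<noteq> Q" by auto
    fix a b assume ab: "a \<in> carrier R" "b \<in> carrier R" "a \<otimes> b \<in> Q"
    show "a \<in> Q \<or> b \<in> Q"
    proof (rule disjCI)
      assume "b \<notin> Q"
      then have "(b \<otimes> r) \<bullet> z \<notin> K" using ab r z by (simp add: colon_def smult_assoc1)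
      then have in_C: "colon K ((b \<otimes> r) \<bullet> z) \<in> C" unfolding C_def using ab r by blast
      have "Q \<subseteq> colon K ((b \<otimes> r) \<bullet> z)"
      proof
        fix c assume c: "c \<in> Q"
        then have cC: "c \<in> carrier R" "c \<bullet> (r \<bullet> z) \<in> K" by (auto simp: r(3) colon_def)
        have "c \<bullet> ((b \<otimes> r) \<bullet> z) = b \<bullet> (c \<bullet> (r \<bullet> z))"
          using smult_commute[OF cC(1) ab(2) rz] ab r z by (simp add: smult_assoc1)
        then show "c \<in> colon K ((b \<otimes> r) \<bullet> z)"
          using cC sub_smult[OF K ab(2)] by (simp add: colon_def)
      qed
      then have eq: "colon K ((b \<otimes> r) \<bullet> z) = Q" using Q(2)[OF in_C] by simp
      have "a \<bullet> ((b \<otimes> r) \<bullet> z) = (a \<otimes> b) \<bullet> (r \<bullet> z)"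
        using ab r z by (simp add: smult_assoc1)
      then have "a \<in> colon K ((b \<otimes> r) \<bullet> z)" using ab by (simp add: r(3) colon_def)
      then show "a \<in> Q" by (simp only: eq)
    qed
  qed
  then show ?thesis using r by blast
qed

context graded_module
begin

text \<open>Turns an arbitrary multiplier of a homogeneous element into a homogeneous one after
  passing to a component. Below the degree of \<open>z\<close> the component vanishes, and the
  multiplier 0 is taken.\<close>

lemma mcomp_smult_homogeneous:
  assumes r: "r \<in> carrier R" and z: "z \<in> D t"
  shows "\<exists>s i. s \<in> A i \<and> mcomp (r \<bullet> z) w = s \<bullet> z \<and> (s \<bullet> z = \<zero>\<^bsub>M\<^esub> \<or> w = int i + t)"
proof (cases "w < t")
  case True
  have zc: "z \<in> carrier M" using z by (rule D_carrier)
  have sub: "submodule (comps_in {..<t} {\<zero>\<^bsub>M\<^esub>}) R M" by (rule submodule_comps_in[OF submodule_zero]) auto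
  have "z \<in> comps_in {..<t} {\<zero>\<^bsub>M\<^esub>}" using mcomp_homogeneous[OF z] zc by (auto simp: comps_in_def)
  then have "r \<bullet> z \<in> comps_in {..<t} {\<zero>\<^bsub>M\<^esub>}" by (rule sub_smult[OF sub r])
  then have "mcomp (r \<bullet> z) w = \<zero> \<bullet> z" using True zc by (simp add: comps_in_def)
  then show ?thesis using A_zero[of 0] zc
    by (intro exI[of _ \<zero>] exI[of _ 0]) simp
next
  case False
  define i where "i = nat (w - t)"
  have w: "w = int i + t" using False by (simp add: i_def)
  have "mcomp (r \<bullet> z) w = rcomp r i \<bullet> z"
    unfolding w by (rule mcomp_smult_component[OF r z])
  then show ?thesis using w rcomp_in[OF r] by blast
qed

end

locale reduction_setting = graded_module R A M D
  for R :: "('a, 'r) ring_scheme" (structure) and A :: "nat \<Rightarrow> 'a set"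
    and M :: "('a, 'b, 'm) module_scheme" (structure) and D :: "int \<Rightarrow> 'b set" +
  fixes I :: "'a set" and y :: "nat \<Rightarrow> 'a" and dy :: "nat \<Rightarrow> nat" and Y :: "nat set" and m :: nat
  assumes noeth_R: "noetherian_ring R" and fg: "fin_gen_module R M"
    and hI: "homogeneous_ideal R A I"
    and finY: "finite Y" and yA: "\<And>i. i \<in> Y \<Longrightarrow> y i \<in> A (dy i)"
    and JI: "Idl (y ` Y) \<subseteq> I"
    and red: "ideal_prod R (Idl (y ` Y)) (ideal_pow R I m) = ideal_pow R I (Suc m)"
    and zc: "zero_colon M I = {\<zero>\<^bsub>M\<^esub>}"
begin

lemma II: "ideal I R"
  using hI by (simp add: homogeneous_ideal_def)

lemma yC: "y ` Y \<subseteq> carrier R"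
  using yA A_carrier by blast

lemma yI: "y ` Y \<subseteq> I"
  using genideal_self[OF yC] JI by blast

lemma noeth_M: noetherian_module
  by (rule fin_gen_noetherian[OF noeth_R fg])

lemma ipow_sub: "graded_sub K \<Longrightarrow> submodule (ipow I n K) R M"
  by (rule submodule_ipow[OF II graded_subD])

lemma ipow_Suc_subset:
  assumes "graded_sub K" "graded_sub L" "L \<subseteq> K" shows "ipow I (Suc n) L \<subseteq> ipow I n K"
  using ipow_decreasing[OF II graded_subD[OF assms(2)], of n "Suc n"] ipow_mono[OF II graded_subD[OF assms(1)] assms(3), of n]
  by auto

section \<open>The quotients \<open>I^n K / I^(n+1) L\<close>, later with \<open>(K, L)\<close>
  equal to \<open>(N, N)\<close> and \<open>(M, N)\<close>\<close>

context
  fixes K L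
  assumes K: "graded_sub K" and L: "graded_sub L" and LK: "L \<subseteq> K"
begin

lemma ipow_families:
  shows "family (y ` Y) (\<lambda>n. ipow I (m + n) K)" "noeth (y ` Y) (\<lambda>n. ipow I (m + n) K)"
    and "family (y ` Y) (\<lambda>n. ipow I (Suc (m + n)) L)" "(\<lambda>n. ipow I (Suc (m + n)) L) \<le> (\<lambda>n. ipow I (m + n) K)"
proof -
  show "family (y ` Y) (\<lambda>n. ipow I (m + n) K)" by (rule family_ipow[OF II graded_subD[OF K] yI])
  show "noeth (y ` Y) (\<lambda>n. ipow I (m + n) K)"
    by (rule noeth_ipow[OF noeth_M _ yC II red graded_subD[OF K]]) (use finY in simp)
  show "family (y ` Y) (\<lambda>n. ipow I (Suc (m + n)) L)"
    using family_ipow[OF II graded_subD[OF L] yI, of "Suc m"] by simp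
  show "(\<lambda>n. ipow I (Suc (m + n)) L) \<le> (\<lambda>n. ipow I (m + n) K)"
    using ipow_Suc_subset[OF K L LK] by (simp add: le_fun_def)
qed

lemma local_v_ipow:
  assumes p: "primeideal p R"
  shows "(\<forall>\<^sub>F n in sequentially. p \<notin> ass_set (ipow I n K) (ipow I (Suc n) L)) \<or>
    (\<exists>\<gamma>\<in>Y. \<exists>b. \<forall>\<^sub>F n in sequentially.
       is_least (v_degrees p (ipow I n K) (ipow I (Suc n) L)) (int (dy \<gamma>) * int n + b))"
proof -
  obtain u0 where u0: "\<And>u x. u < u0 \<Longrightarrow> x \<in> carrier M \<Longrightarrow> mcomp x u = \<zero>\<^bsub>M\<^esub>"
    using degrees_bounded_below[OF fg] by blast
  consider "\<forall>\<^sub>F n in sequentially. p \<notin> ass_set (ipow I (m + n) K) (ipow I (Suc (m + n)) L)"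
    | \<gamma> b where "\<gamma> \<in> Y" "\<forall>\<^sub>F n in sequentially.
       is_least (v_degrees p (ipow I (m + n) K) (ipow I (Suc (m + n)) L)) (int (dy \<gamma>) * int n + b)"
    using local_v_linear[OF finY yA ipow_families(1,2) gr_ipow[OF hI K] ipow_families(3) gr_ipow[OF hI L]
        ipow_families(4) u0 p] by blast
  then show ?thesis
  proof cases
    case 1
    then show ?thesis
      using eventually_sequentially_seg[of "\<lambda>n. p \<notin> ass_set (ipow I n K) (ipow I (Suc n) L)" m]
      by (simp add: add.commute)
  next
    case 2
    then show ?thesis
      using linear_shift[of "\<lambda>n. is_least (v_degrees p (ipow I n K) (ipow I (Suc n) L))" m] by blast
  qed
qed

lemma ass_ipow: "\<exists>P. finite P \<and> (\<forall>\<^sub>F n in sequentially. ass_set (ipow I n K) (ipow I (Suc n) L) = P)"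
proof -
  obtain u0 where u0: "\<And>u x. u < u0 \<Longrightarrow> x \<in> carrier M \<Longrightarrow> mcomp x u = \<zero>\<^bsub>M\<^esub>"
    using degrees_bounded_below[OF fg] by blast
  obtain P where P: "finite P"
    "\<forall>\<^sub>F n in sequentially. ass_set (ipow I (m + n) K) (ipow I (Suc (m + n)) L) = P"
    using ass_set_stabilizes[OF noeth_R finY yA ipow_families(1,2) gr_ipow[OF hI K] ipow_families(3)
        gr_ipow[OF hI L] ipow_families(4) u0] by blast
  then show ?thesis
    using eventually_sequentially_seg[of "\<lambda>n. ass_set (ipow I n K) (ipow I (Suc n) L) = P" m]
    by (auto simp: add.commute)
qed

lemma indeg_ipow:
  "(\<forall>\<^sub>F n in sequentially. ipow I n K = ipow I (Suc n) L) \<or>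
    (\<exists>\<gamma>\<in>Y. (\<exists>b. \<forall>\<^sub>F n in sequentially.
        is_least (degrees (ipow I n K) (ipow I (Suc n) L)) (int (dy \<gamma>) * int n + b)) \<and>
      (\<exists>n u. \<exists>x\<in>ipow I n K \<inter> D u. \<forall>k. (y \<gamma> [^] k) \<bullet> x \<notin> ipow I (Suc (n + k)) L))"
proof -
  obtain u0 where u0: "\<And>u x. u < u0 \<Longrightarrow> x \<in> carrier M \<Longrightarrow> mcomp x u = \<zero>\<^bsub>M\<^esub>"
    using degrees_bounded_below[OF fg] by blast
  consider "\<forall>\<^sub>F n in sequentially. ipow I (m + n) K = ipow I (Suc (m + n)) L"
    | \<gamma> b n u x where "\<gamma> \<in> Y" "\<forall>\<^sub>F n in sequentially.
       is_least (degrees (ipow I (m + n) K) (ipow I (Suc (m + n)) L)) (int (dy \<gamma>) * int n + b)"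
       "x \<in> ipow I (m + n) K \<inter> D u" "\<forall>k. (y \<gamma> [^] k) \<bullet> x \<notin> ipow I (Suc (m + (n + k))) L"
    using initial_degree_linear[OF finY yA ipow_families(1,2) gr_ipow[OF hI K] ipow_families(3) gr_ipow[OF hI L]
        ipow_families(4) u0] by blast
  then show ?thesis
  proof cases
    case 1
    then show ?thesis
      using eventually_sequentially_seg[of "\<lambda>n. ipow I n K = ipow I (Suc n) L" m]
      by (simp add: add.commute)
  next
    case (2 \<gamma> b n u x)
    obtain b' where "\<forall>\<^sub>F n in sequentially.
       is_least (degrees (ipow I n K) (ipow I (Suc n) L)) (int (dy \<gamma>) * int n + b')"
      using linear_shift[of "\<lambda>n. is_least (degrees (ipow I n K) (ipow I (Suc n) L))" m] 2(2) by blast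
    moreover have "\<forall>k. (y \<gamma> [^] k) \<bullet> x \<notin> ipow I (Suc ((m + n) + k)) L" using 2(4) by (simp add: add.assoc)
    ultimately show ?thesis using 2(1,3) by blast
  qed
qed

end

section \<open>Associated primes and local v-numbers of \<open>M / I^n N\<close>\<close>

lemma pow_mem_ipow:
  assumes "graded_sub K" "a \<in> I" "x \<in> K" shows "(a [^] n) \<bullet> x \<in> ipow I n K"
proof -
  have "family {a} (\<lambda>n. ipow I (0 + n) K)" by (rule family_ipow[OF II graded_subD[OF assms(1)]]) (use assms(2) in simp)
  from family_mult_pow[OF this, of a x 0 n] show ?thesis
    using assms ideal.Icarr[OF II] by (simp add: ipow_0 graded_subD)
qed

lemma pow_notin_prime:
  assumes p: "primeideal p R" and a: "a \<in> carrier R" "a \<notin> p" shows "a [^] (n::nat) \<notin> p"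
proof (induct n)
  case 0
  show ?case using ideal.one_imp_carrier[OF primeideal.axioms(1)[OF p]] primeideal.I_notcarr[OF p] by auto
next
  case (Suc n)
  then show ?case using primeideal.I_prime[OF p, of "a [^] n" a] a by auto
qed

text \<open>Localized at a prime not containing \<open>I\<close>, the modules \<open>N\<close> and
  \<open>I^n N\<close> agree. Concretely, \<open>b = a^n\<close> with \<open>a\<close> in
  \<open>I\<close> outside \<open>p\<close> carries \<open>N\<close> into \<open>I^n N\<close> and
  can be cancelled modulo \<open>p\<close>.\<close>

lemma ass_outside:
  assumes N: "graded_sub N" and p: "primeideal p R" "\<not> I \<subseteq> p"
  shows "p \<in> ass_set (carrier M) (ipow I n N) \<longleftrightarrow> p \<in> ass_set (carrier M) N"
proof -
  obtain a where a: "a \<in> I" "a \<notin> p" using p(2) by blast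
  have aC: "a \<in> carrier R" using a ideal.Icarr[OF II] by blast
  define b where "b = a [^] n"
  have b: "b \<in> carrier R" "b \<notin> p" using pow_notin_prime[OF p(1) aC a(2)] aC by (auto simp: b_def)
  have bN: "b \<bullet> x \<in> ipow I n N" if "x \<in> N" for x
    unfolding b_def by (rule pow_mem_ipow[OF N a(1) that])
  have sub: "ipow I n N \<subseteq> N" using ipow_decreasing[OF II graded_subD[OF N], of 0 n] ipow_0[OF graded_subD[OF N]] by simp
  have cancel: "r \<in> p" if "r \<in> carrier R" "b \<otimes> r \<in> p" for r
    using primeideal.I_prime[OF p(1) b(1) that] b(2) by blast
  show ?thesis
  proof
    assume "p \<in> ass_set (carrier M) (ipow I n N)"
    then obtain x where x: "x \<in> carrier M" "p = colon (ipow I n N) x" by (auto simp: ass_set_def)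
    have "colon N x \<subseteq> p"
    proof
      fix r assume "r \<in> colon N x"
      then have r: "r \<in> carrier R" "r \<bullet> x \<in> N" by (auto simp: colon_def)
      then have "(b \<otimes> r) \<bullet> x \<in> ipow I n N" using bN b x by (simp add: smult_assoc1)
      then have "b \<otimes> r \<in> p" using b r by (simp add: x(2) colon_def)
      then show "r \<in> p" using cancel r by blast
    qed
    moreover have "p \<subseteq> colon N x" unfolding x(2) using sub by (auto simp: colon_def)
    ultimately show "p \<in> ass_set (carrier M) N" using p(1) x(1) by (auto simp: ass_set_def)
  next
    assume "p \<in> ass_set (carrier M) N"
    then obtain x where x: "x \<in> carrier M" "p = colon N x" by (auto simp: ass_set_def)
    have "r \<in> colon (ipow I n N) (b \<bullet> x) \<longleftrightarrow> r \<in> p" for r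
    proof
      assume "r \<in> colon (ipow I n N) (b \<bullet> x)"
      then have r: "r \<in> carrier R" "r \<bullet> (b \<bullet> x) \<in> N" using sub by (auto simp: colon_def)
      then have "(b \<otimes> r) \<bullet> x \<in> N" using b x smult_commute[of r b x] by (simp add: smult_assoc1)
      then have "b \<otimes> r \<in> p" using b r by (simp add: x(2) colon_def)
      then show "r \<in> p" using cancel r by blast
    next
      assume "r \<in> p"
      then have r: "r \<in> carrier R" "r \<bullet> x \<in> N" by (auto simp: x(2) colon_def)
      then show "r \<in> colon (ipow I n N) (b \<bullet> x)"
        using bN[OF r(2)] smult_commute[OF r(1) b(1) x(1)] by (simp add: colon_def)
    qed
    then have "p = colon (ipow I n N) (b \<bullet> x)" by blast
    then show "p \<in> ass_set (carrier M) (ipow I n N)" using p(1) x b by (auto simp: ass_set_def)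
  qed
qed

text \<open>An element whose colon ideal contains \<open>I\<close> lies in
  \<open>(I^(n+1) N : I)\<close>, hence in \<open>I^n N\<close>. Quantifying over \<open>p\<close>
  and \<open>L\<close> inside the eventuality yields a single threshold for all primes and all
  intermediate modules.\<close>

lemma eventually_inside:
  assumes N: "graded_sub N"
  shows "\<forall>\<^sub>F n in sequentially. \<forall>p L. I \<subseteq> p \<longrightarrow> ipow I n N \<subseteq> L \<longrightarrow> L \<subseteq> carrier M \<longrightarrow>
    v_degrees p L (ipow I (Suc n) N) = v_degrees p (ipow I n N) (ipow I (Suc n) N) \<and>
    (p \<in> ass_set L (ipow I (Suc n) N) \<longleftrightarrow> p \<in> ass_set (ipow I n N) (ipow I (Suc n) N))"
proof -
  obtain n0 where n0: "\<And>n x. n \<ge> n0 \<Longrightarrow> x \<in> carrier M \<Longrightarrow>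
      (\<forall>a\<in>I. a \<bullet> x \<in> ipow I (Suc n) N) \<Longrightarrow> x \<in> ipow I n N"
    using eventually_colon_ipow[OF noeth_R noeth_M _ yC II JI red zc graded_subD[OF N]] finY by blast
  show ?thesis
    using eventually_ge_at_top[of n0]
  proof eventually_elim
    case (elim n)
    have "x \<in> ipow I n N" if "I \<subseteq> p" "x \<in> carrier M" "p = colon (ipow I (Suc n) N) x" for x p
      by (rule n0[OF elim that(2)]) (use that in \<open>auto simp: colon_def\<close>)
    then show ?case unfolding v_degrees_def ass_set_def by blast
  qed
qed

text \<open>Primes containing \<open>I\<close> are governed by \<open>I^n N / I^(n+1) N\<close>, the
  others by \<open>M/N\<close>. Only the former are recorded as finite, and under the hypothesis of
  (2) they are all of them.\<close>

lemma ass_power_stabilizes: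
  assumes N: "graded_sub N"
  shows "\<exists>P. finite {p \<in> P. I \<subseteq> p} \<and> (\<forall>\<^sub>F n in sequentially. ass_set (carrier M) (ipow I n N) = P)"
proof -
  obtain Q where Q: "finite Q" "\<forall>\<^sub>F n in sequentially. ass_set (ipow I n N) (ipow I (Suc n) N) = Q"
    using ass_ipow[OF N N] by blast
  define P where "P = {p \<in> Q. I \<subseteq> p} \<union> {p \<in> ass_set (carrier M) N. \<not> I \<subseteq> p}"
  have "\<forall>\<^sub>F n in sequentially. ass_set (carrier M) (ipow I (Suc n) N) = P"
    using Q(2) eventually_inside[OF N]
  proof eventually_elim
    case (elim n)
    have c: "ipow I n N \<subseteq> carrier M" using sub_carrier[OF ipow_sub[OF N]] by blast
    have "p \<in> ass_set (carrier M) (ipow I (Suc n) N) \<longleftrightarrow> p \<in> P" for p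
    proof (cases "I \<subseteq> p")
      case True
      then have "p \<in> ass_set (carrier M) (ipow I (Suc n) N) \<longleftrightarrow> p \<in> ass_set (ipow I n N) (ipow I (Suc n) N)"
        using elim(2) c by blast
      then show ?thesis using True elim(1) by (simp add: P_def)
    next
      case False
      then show ?thesis using ass_outside[OF N _ False, of "Suc n"] by (auto simp: P_def ass_set_def)
    qed
    then show ?case by blast
  qed
  then have "\<forall>\<^sub>F n in sequentially. ass_set (carrier M) (ipow I n N) = P"
    by (simp only: eventually_sequentially_Suc[of "\<lambda>n. ass_set (carrier M) (ipow I n N) = P"])
  moreover have "{p \<in> P. I \<subseteq> p} \<subseteq> Q" by (auto simp: P_def)
  ultimately show ?thesis using Q(1) finite_subset by blast
qed

lemma local_v_power_linear:
  assumes N: "graded_sub N" and p: "\<forall>\<^sub>F n in sequentially. p \<in> ass_set (carrier M) (ipow I n N)" "I \<subseteq> p"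
  shows "\<exists>\<gamma>\<in>Y. \<exists>b. \<forall>\<^sub>F n in sequentially.
    is_least (v_degrees p (carrier M) (ipow I (Suc n) N)) (int (dy \<gamma>) * int n + b)"
proof -
  have c: "ipow I n N \<subseteq> carrier M" for n using sub_carrier[OF ipow_sub[OF N]] by blast
  have p1: "\<forall>\<^sub>F n in sequentially. p \<in> ass_set (carrier M) (ipow I (Suc n) N)"
    using p(1) by (simp only: eventually_sequentially_Suc[of "\<lambda>n. p \<in> ass_set (carrier M) (ipow I n N)"])
  then have "\<forall>\<^sub>F n in sequentially. p \<in> ass_set (ipow I n N) (ipow I (Suc n) N)"
    using eventually_inside[OF N] by eventually_elim (use p(2) c in blast)
  moreover have pp: "primeideal p R"
    using eventually_happens[OF p(1)] by (auto simp: ass_set_def)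
  moreover have "\<not> (\<forall>\<^sub>F n in sequentially. p \<notin> ass_set (ipow I n N) (ipow I (Suc n) N))"
  proof
    assume "\<forall>\<^sub>F n in sequentially. p \<notin> ass_set (ipow I n N) (ipow I (Suc n) N)"
    with calculation(1) have "\<forall>\<^sub>F n::nat in sequentially. False" by eventually_elim simp
    then show False by simp
  qed
  ultimately obtain \<gamma> b where g: "\<gamma> \<in> Y" "\<forall>\<^sub>F n in sequentially.
     is_least (v_degrees p (ipow I n N) (ipow I (Suc n) N)) (int (dy \<gamma>) * int n + b)"
    using local_v_ipow[OF N N order_refl pp] by blast
  have "\<forall>\<^sub>F n in sequentially. is_least (v_degrees p (carrier M) (ipow I (Suc n) N)) (int (dy \<gamma>) * int n + b)"
    using g(2) eventually_inside[OF N]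
  proof eventually_elim
    case (elim n)
    have "v_degrees p (carrier M) (ipow I (Suc n) N) = v_degrees p (ipow I n N) (ipow I (Suc n) N)"
      using elim(2) p(2) c[of n] by blast
    then show ?case using elim(1) by simp
  qed
  then show ?thesis using g(1) by blast
qed

text \<open>Both \<open>I^n M\<close> and \<open>M\<close> contain \<open>I^n N\<close>, so each is
  compared with \<open>I^n N\<close> modulo \<open>I^(n+1) N\<close>.\<close>

lemma local_v_power_eq:
  assumes N: "graded_sub N"
  shows "\<forall>\<^sub>F n in sequentially. \<forall>p. I \<subseteq> p \<longrightarrow>
    v_degrees p (ipow I n (carrier M)) (ipow I (Suc n) N) = v_degrees p (carrier M) (ipow I (Suc n) N) \<and>
    (p \<in> ass_set (ipow I n (carrier M)) (ipow I (Suc n) N) \<longleftrightarrow> p \<in> ass_set (carrier M) (ipow I (Suc n) N))"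
  using eventually_inside[OF N]
proof eventually_elim
  case (elim n)
  have sub: "ipow I n N \<subseteq> ipow I n (carrier M)" "ipow I n (carrier M) \<subseteq> carrier M" "ipow I n N \<subseteq> carrier M"
    using ipow_mono[OF II carrier_is_submodule, of N n] graded_mem[OF N]
      sub_carrier[OF ipow_sub[OF graded_sub_carrier]] sub_carrier[OF ipow_sub[OF N]] by blast+
  show ?case
  proof (intro allI impI)
    fix p assume p: "I \<subseteq> p"
    show "v_degrees p (ipow I n (carrier M)) (ipow I (Suc n) N) = v_degrees p (carrier M) (ipow I (Suc n) N) \<and>
      (p \<in> ass_set (ipow I n (carrier M)) (ipow I (Suc n) N) \<longleftrightarrow> p \<in> ass_set (carrier M) (ipow I (Suc n) N))"
      using elim[rule_format, OF p sub(1,2)] elim[rule_format, OF p sub(3) order_refl] by simp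
  qed
qed

text \<open>If \<open>y\<^sub>\<gamma>\<^sup>k x\<close> never vanishes, the ascending annihilators of these elements stabilize, so a
  single homogeneous \<open>s\<close> makes the annihilator of \<open>s y\<^sub>\<gamma>\<^sup>k x\<close> one fixed prime for all large \<open>k\<close>.\<close>

lemma persistent_bound:
  assumes N: "graded_sub N" and g: "\<gamma> \<in> Y" and x: "x \<in> ipow I n0 (carrier M)" "x \<in> D u"
    and per: "\<And>k. (y \<gamma> [^] k) \<bullet> x \<notin> ipow I (Suc (n0 + k)) N"
  shows "\<exists>C. \<forall>\<^sub>F n in sequentially. \<exists>p\<in>ass_set (ipow I n (carrier M)) (ipow I (Suc n) N).
    int (dy \<gamma>) * int n + C \<in> v_degrees p (ipow I n (carrier M)) (ipow I (Suc n) N)"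
proof -
  define W where "W k = ipow I (Suc (n0 + k)) N" for k
  define z where "z k = (y \<gamma> [^] k) \<bullet> x" for k :: nat
  have y: "y \<gamma> \<in> A (dy \<gamma>)" "y \<gamma> \<in> carrier R" "y \<gamma> \<in> I" using g yA A_carrier yI by auto
  have Ws: "submodule (W k) R M" and grW: "graded_sub (W k)" for k
    unfolding W_def using ipow_sub[OF N] gr_ipow[OF hI N] by auto
  have xc: "x \<in> carrier M" using x(2) by (rule D_carrier)
  have zD: "z k \<in> D (int (dy \<gamma> * k) + u)" for k unfolding z_def by (rule pow_smult_D[OF y(1) x(2)])
  have zc: "z k \<in> carrier M" for k using zD D_carrier by blast
  have zS: "z (Suc k) = y \<gamma> \<bullet> z k" for k unfolding z_def by (rule smult_pow_Suc[OF y(2) xc])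
  have WS: "y \<gamma> \<bullet> w \<in> W (Suc k)" if "w \<in> W k" for w k
    using that ideal_smult_incl[OF y(3), of w "ipow I (Suc (n0 + k)) N"]
    by (simp add: W_def ipow_Suc[OF II graded_subD[OF N], symmetric])
  have famV: "family {y \<gamma>} (\<lambda>n. ipow I (n0 + n) (carrier M))"
    by (rule family_ipow[OF II carrier_is_submodule]) (use y in simp)
  have zV: "z k \<in> ipow I (n0 + k) (carrier M)" for k
    unfolding z_def using family_mult_pow[OF famV _ y(2), of x 0 k] x(1) by simp
  have "colon (W k) (z k) \<subseteq> colon (W (Suc k)) (z (Suc k))" for k
  proof
    fix a assume "a \<in> colon (W k) (z k)"
    then have a: "a \<in> carrier R" "a \<bullet> z k \<in> W k" by (auto simp: colon_def)
    then show "a \<in> colon (W (Suc k)) (z (Suc k))"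
      using WS[OF a(2)] smult_commute[OF a(1) y(2) zc] by (simp add: colon_def zS)
  qed
  then obtain k0 where k0: "\<And>k. k \<ge> k0 \<Longrightarrow> colon (W k) (z k) = colon (W k0) (z k0)"
    using noetherian_ring.ideal_chain_stabilizes[OF noeth_R, of "\<lambda>k. colon (W k) (z k)"]
      ideal_colon[OF Ws zc] by blast
  obtain r where r: "r \<in> carrier R" "primeideal (colon (W k0) (r \<bullet> z k0)) R"
    using prime_colon_exists[OF noeth_R Ws[of k0] zc[of k0]] per[of k0] by (auto simp: z_def W_def)
  define q where "q = colon (W k0) (r \<bullet> z k0)"
  have rzc: "r \<bullet> z k0 \<in> carrier M" using r zc by simp
  \<comment> \<open>Primality allows passing to a component of \<open>r z_k0\<close> with the same
    colon ideal, and that component is a homogeneous multiple of \<open>z_k0\<close>.\<close>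
  obtain w where w: "colon (W k0) (mcomp (r \<bullet> z k0) w) = q"
    using prime_colon_component[OF grW rzc r(2)] by (auto simp: q_def)
  obtain s i where s: "s \<in> A i" "mcomp (r \<bullet> z k0) w = s \<bullet> z k0"
    using mcomp_smult_homogeneous[OF r(1) zD] by blast
  have sC: "s \<in> carrier R" using s(1) by (rule A_carrier)
  \<comment> \<open>This colon ideal depends on \<open>k\<close> only through
    \<open>(W k : z k)\<close>, which is constant from \<open>k0\<close> on; so the scalar
    \<open>s\<close> found at \<open>k0\<close> serves all larger \<open>k\<close>.\<close>
  have colon_s: "colon (W k) (s \<bullet> z k) = {a \<in> carrier R. a \<otimes> s \<in> colon (W k) (z k)}" for k
    using sC zc by (auto simp: colon_def smult_assoc1)
  have q: "colon (W k) (s \<bullet> z k) = q" if "k \<ge> k0" for k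
    using w s(2) colon_s[of k] colon_s[of k0] k0[OF that] by simp
  \<comment> \<open>The degree of \<open>s y_\<gamma>^k x\<close> is
    \<open>i + d_\<gamma> k + u\<close>, rewritten with \<open>k = n - n0\<close>.\<close>
  define C where "C = int i + u - int (dy \<gamma>) * int n0"
  have "\<forall>\<^sub>F n in sequentially. \<exists>p\<in>ass_set (ipow I n (carrier M)) (ipow I (Suc n) N).
    int (dy \<gamma>) * int n + C \<in> v_degrees p (ipow I n (carrier M)) (ipow I (Suc n) N)"
    using eventually_ge_at_top[of "n0 + k0"]
  proof eventually_elim
    case (elim n)
    define k where "k = n - n0"
    have n: "n = n0 + k" "k \<ge> k0" using elim by (auto simp: k_def)
    have "s \<bullet> z k \<in> ipow I n (carrier M)"
      using sub_smult[OF ipow_sub[OF graded_sub_carrier] sC zV[of k]] n by simp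
    moreover have "s \<bullet> z k \<in> D (int (dy \<gamma>) * int n + C)"
      using graded_smult[OF s(1) zD[of k]] by (simp add: n C_def algebra_simps)
    moreover have "q = colon (ipow I (Suc n) N) (s \<bullet> z k)" using q[OF n(2)] by (simp add: W_def n)
    moreover have "primeideal q R" using r(2) by (simp add: q_def)
    ultimately show ?case unfolding ass_set_def v_degrees_def by blast
  qed
  then show ?thesis by blast
qed

section \<open>The common slope in claim (2)\<close>

definition v_inf :: "'b set \<Rightarrow> 'b set \<Rightarrow> ereal" where
  "v_inf L K = (INF p\<in>ass_set L K. INF u\<in>v_degrees p L K. ereal (of_int u))"

text \<open>Applying \<open>I^n\<close> to the hypothesis gives \<open>I^(n+n0) M\<close> inside
  \<open>I^n N\<close>, so a power of every element of \<open>I\<close> lies in each associated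
  prime.\<close>

lemma power_in_primes:
  assumes N: "graded_sub N" and n0: "ipow I n0 (carrier M) \<subseteq> N" and p: "p \<in> ass_set (carrier M) (ipow I n N)"
  shows "I \<subseteq> p"
proof
  fix a assume a: "a \<in> I"
  obtain x where x: "x \<in> carrier M" "p = colon (ipow I n N) x" "primeideal p R"
    using p by (auto simp: ass_set_def)
  have aC: "a \<in> carrier R" using a ideal.Icarr[OF II] by blast
  have "(a [^] (n + n0)) \<bullet> x \<in> ipow I (n + n0) (carrier M)" by (rule pow_mem_ipow[OF graded_sub_carrier a x(1)])
  also have "\<dots> = ipow I n (ipow I n0 (carrier M))" by (rule ipow_add[OF II carrier_is_submodule])
  also have "\<dots> \<subseteq> ipow I n N" by (rule ipow_mono[OF II graded_subD[OF N] n0])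
  finally have "a [^] (n + n0) \<in> p" using aC by (simp add: x(2) colon_def)
  then show "a \<in> p" using pow_notin_prime[OF x(3) aC] by blast
qed

text \<open>All primes in \<open>P\<close> contain \<open>I\<close>, so the v-number is a minimum of
  finitely many eventually linear functions. Its slope is then compared with that of the initial
  degree in both directions.\<close>

lemma v_power_linear:
  assumes N: "graded_sub N" and n0: "ipow I n0 (carrier M) \<subseteq> N"
    and P: "\<forall>\<^sub>F n in sequentially. ass_set (carrier M) (ipow I n N) = P" "P \<noteq> {}"
  shows "\<forall>\<^sub>F n in sequentially. v_inf (ipow I n (carrier M)) (ipow I (Suc n) N) = v_inf (carrier M) (ipow I (Suc n) N)"
    and "\<exists>\<gamma>\<in>Y. \<exists>b b'.
      (\<forall>\<^sub>F n in sequentially. is_least (degrees (ipow I n (carrier M)) (ipow I (Suc n) N)) (int (dy \<gamma>) * int n + b)) \<and>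
      (\<forall>\<^sub>F n in sequentially. v_inf (carrier M) (ipow I (Suc n) N) = ereal (of_int (int (dy \<gamma>) * int n + b')))"
proof -
  have NM: "N \<subseteq> carrier M" using graded_mem[OF N] by blast
  have PS: "\<forall>\<^sub>F n in sequentially. ass_set (carrier M) (ipow I (Suc n) N) = P"
    using P(1) by (simp only: eventually_sequentially_Suc[of "\<lambda>n. ass_set (carrier M) (ipow I n N) = P"])
  have "I \<subseteq> p" if "p \<in> P" for p
    using eventually_happens[OF P(1)] power_in_primes[OF N n0] that by auto
  note PI = this
  have "finite P"
  proof -
    obtain Q where Q: "finite {p \<in> Q. I \<subseteq> p}" "\<forall>\<^sub>F n in sequentially. ass_set (carrier M) (ipow I n N) = Q"
      using ass_power_stabilizes[OF N] by blast
    have "\<forall>\<^sub>F n::nat in sequentially. P = Q" using P(1) Q(2) by eventually_elim simp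
    then show ?thesis using Q(1) PI by (simp add: Collect_conj_eq Int_absorb2 subsetI)
  qed
  have subset: "ass_set (ipow I n (carrier M)) K \<subseteq> ass_set (carrier M) K" for n K
    using sub_carrier[OF ipow_sub[OF graded_sub_carrier]] by (auto simp: ass_set_def)
  have eqs: "\<forall>\<^sub>F n in sequentially. ass_set (ipow I n (carrier M)) (ipow I (Suc n) N) = P \<and>
    (\<forall>p\<in>P. v_degrees p (ipow I n (carrier M)) (ipow I (Suc n) N) = v_degrees p (carrier M) (ipow I (Suc n) N))"
    using PS local_v_power_eq[OF N]
  proof eventually_elim
    case (elim n)
    then show ?case using PI subset[of n "ipow I (Suc n) N"] by blast
  qed
  show ev: "\<forall>\<^sub>F n in sequentially. v_inf (ipow I n (carrier M)) (ipow I (Suc n) N) = v_inf (carrier M) (ipow I (Suc n) N)"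
    using PS eqs by eventually_elim (simp add: v_inf_def cong: INF_cong)
  have each: "\<exists>a\<in>(int \<circ> dy) ` Y. \<exists>b. \<forall>\<^sub>F n in sequentially.
      (INF u\<in>v_degrees p (carrier M) (ipow I (Suc n) N). ereal (of_int u)) = ereal (of_int (a * int n + b))"
    if p: "p \<in> P" for p
  proof -
    have "\<forall>\<^sub>F n in sequentially. p \<in> ass_set (carrier M) (ipow I n N)"
      using P(1) by eventually_elim (use p in simp)
    then obtain \<gamma> b where g: "\<gamma> \<in> Y" "\<forall>\<^sub>F n in sequentially.
       is_least (v_degrees p (carrier M) (ipow I (Suc n) N)) (int (dy \<gamma>) * int n + b)"
      using local_v_power_linear[OF N _ PI[OF p]] by blast
    have "\<forall>\<^sub>F n in sequentially.
      (INF u\<in>v_degrees p (carrier M) (ipow I (Suc n) N). ereal (of_int u)) = ereal (of_int (int (dy \<gamma>) * int n + b))"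
      using g(2) by eventually_elim (rule INF_is_least)
    then show ?thesis using g(1) by (intro bexI[of _ "int (dy \<gamma>)"] exI[of _ b]) auto
  qed
  obtain a b' where ab: "a \<in> (int \<circ> dy) ` Y" "\<forall>\<^sub>F n in sequentially.
      (INF p\<in>P. INF u\<in>v_degrees p (carrier M) (ipow I (Suc n) N). ereal (of_int u)) = ereal (of_int (a * int n + b'))"
    using linear_INF[OF \<open>finite P\<close> P(2), of "(int \<circ> dy) ` Y"
        "\<lambda>p n. INF u\<in>v_degrees p (carrier M) (ipow I (Suc n) N). ereal (of_int u)"] each by blast
  have vlin: "\<forall>\<^sub>F n in sequentially. v_inf (carrier M) (ipow I (Suc n) N) = ereal (of_int (a * int n + b'))"
    using PS ab(2) by eventually_elim (simp add: v_inf_def)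
  \<comment> \<open>A zero quotient has no associated primes, whereas \<open>P\<close> is
    nonempty.\<close>
  have "\<not> (\<forall>\<^sub>F n in sequentially. ipow I n (carrier M) = ipow I (Suc n) N)"
  proof
    assume "\<forall>\<^sub>F n in sequentially. ipow I n (carrier M) = ipow I (Suc n) N"
    with eqs have "\<forall>\<^sub>F n::nat in sequentially. False"
    proof eventually_elim
      case (elim n)
      obtain p where p: "p \<in> P" using P(2) by blast
      then have "p \<in> ass_set (ipow I (Suc n) N) (ipow I (Suc n) N)" using elim by simp
      then obtain x where x: "x \<in> ipow I (Suc n) N" "p = colon (ipow I (Suc n) N) x" "primeideal p R"
        by (auto simp: ass_set_def)
      then have "p = carrier R" using sub_smult[OF ipow_sub[OF N]] by (auto simp: colon_def)
      then show ?case using primeideal.I_notcarr[OF x(3)] by simp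
    qed
    then show False by simp
  qed
  then obtain \<gamma> b n1 u x where g: "\<gamma> \<in> Y"
    "\<forall>\<^sub>F n in sequentially. is_least (degrees (ipow I n (carrier M)) (ipow I (Suc n) N)) (int (dy \<gamma>) * int n + b)"
    and x: "x \<in> ipow I n1 (carrier M) \<inter> D u" "\<forall>k. (y \<gamma> [^] k) \<bullet> x \<notin> ipow I (Suc (n1 + k)) N"
    using indeg_ipow[OF graded_sub_carrier N NM] by blast
  obtain C where C: "\<forall>\<^sub>F n in sequentially. \<exists>p\<in>ass_set (ipow I n (carrier M)) (ipow I (Suc n) N).
    int (dy \<gamma>) * int n + C \<in> v_degrees p (ipow I n (carrier M)) (ipow I (Suc n) N)"
    using persistent_bound[OF N g(1), of x n1 u] x by blast
  \<comment> \<open>Upper bound: the persistent element realizes an associated prime in a degree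
    that is linear with slope \<open>d_\<gamma>\<close>.\<close>
  have "\<forall>\<^sub>F n in sequentially. a * int n + b' \<le> int (dy \<gamma>) * int n + C"
    using C vlin ev
  proof eventually_elim
    case (elim n)
    then obtain p where p: "p \<in> ass_set (ipow I n (carrier M)) (ipow I (Suc n) N)"
      "int (dy \<gamma>) * int n + C \<in> v_degrees p (ipow I n (carrier M)) (ipow I (Suc n) N)" by blast
    have "v_inf (ipow I n (carrier M)) (ipow I (Suc n) N) \<le> ereal (of_int (int (dy \<gamma>) * int n + C))"
      unfolding v_inf_def by (rule INF_lower2[OF p(1)], rule INF_lower[OF p(2)])
    then have "ereal (of_int (a * int n + b')) \<le> ereal (of_int (int (dy \<gamma>) * int n + C))"
      using elim by simp
    then show ?case by (simp only: ereal_less_eq of_int_le_iff)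
  qed
  then have le1: "a \<le> int (dy \<gamma>)" by (rule linear_le_slope)
  \<comment> \<open>Lower bound: an element with prime colon ideal is nonzero in the quotient, so
    its degree is at least the initial degree.\<close>
  have "\<forall>\<^sub>F n in sequentially. int (dy \<gamma>) * int n + b \<le> a * int n + b'"
    using g(2) vlin ev
  proof eventually_elim
    case (elim n)
    have "ereal (of_int (int (dy \<gamma>) * int n + b)) \<le> v_inf (ipow I n (carrier M)) (ipow I (Suc n) N)"
      unfolding v_inf_def
    proof (intro INF_greatest)
      fix p v assume p: "p \<in> ass_set (ipow I n (carrier M)) (ipow I (Suc n) N)"
        and v: "v \<in> v_degrees p (ipow I n (carrier M)) (ipow I (Suc n) N)"
      obtain t where t: "t \<in> ipow I n (carrier M)" "t \<in> D v" "p = colon (ipow I (Suc n) N) t"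
        using v by (auto simp: v_degrees_def)
      have "t \<notin> ipow I (Suc n) N"
      proof
        assume "t \<in> ipow I (Suc n) N"
        then have "p = carrier R" using sub_smult[OF ipow_sub[OF N]] t by (auto simp: colon_def)
        then show False using p primeideal.I_notcarr by (auto simp: ass_set_def)
      qed
      then have "v \<in> degrees (ipow I n (carrier M)) (ipow I (Suc n) N)" using t by (auto simp: degrees_def)
      then have "int (dy \<gamma>) * int n + b \<le> v" using elim(1) by (simp add: is_least_def)
      then show "ereal (of_int (int (dy \<gamma>) * int n + b)) \<le> ereal (of_int v)"
        by (simp only: ereal_less_eq of_int_le_iff)
    qed
    then have "ereal (of_int (int (dy \<gamma>) * int n + b)) \<le> ereal (of_int (a * int n + b'))"
      using elim by simp
    then show ?case by (simp only: ereal_less_eq of_int_le_iff)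
  qed
  then have "int (dy \<gamma>) \<le> a" by (rule linear_le_slope)
  then have "a = int (dy \<gamma>)" using le1 by simp
  then show "\<exists>\<gamma>\<in>Y. \<exists>b b'.
      (\<forall>\<^sub>F n in sequentially. is_least (degrees (ipow I n (carrier M)) (ipow I (Suc n) N)) (int (dy \<gamma>) * int n + b)) \<and>
      (\<forall>\<^sub>F n in sequentially. v_inf (carrier M) (ipow I (Suc n) N) = ereal (of_int (int (dy \<gamma>) * int n + b')))"
    using g vlin by blast
qed

section \<open>The slope when \<open>y_1\<close> is regular on \<open>M\<close>\<close>

lemma power_degrees_grow:
  assumes u0: "\<And>u x. u < u0 \<Longrightarrow> x \<in> carrier M \<Longrightarrow> mcomp x u = \<zero>\<^bsub>M\<^esub>"
    and e: "\<And>i. i \<in> Y \<Longrightarrow> e \<le> dy i"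
  shows "ipow I (m + j) (carrier M) \<subseteq> comps_in {..<u0 + int (e * j)} {\<zero>\<^bsub>M\<^esub>}"
proof (induct j)
  case 0
  then show ?case using sub_carrier[OF ipow_sub[OF graded_sub_carrier]] u0 by (auto simp: comps_in_def)
next
  case (Suc j)
  have "ipow I (m + Suc j) (carrier M) = ideal_smult R M (Idl (y ` Y)) (ipow I (m + j) (carrier M))"
    using reduction_ipow[OF II genideal_ideal[OF yC] red carrier_is_submodule, of "m + j"] by simp
  also have "\<dots> \<subseteq> comps_in {..<u0 + int (e * Suc j)} {\<zero>\<^bsub>M\<^esub>}"
  proof (rule ideal_smult_Idl_least[OF yC])
    show "ipow I (m + j) (carrier M) \<subseteq> carrier M" using sub_carrier[OF ipow_sub[OF graded_sub_carrier]] by blast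
    show "submodule (comps_in {..<u0 + int (e * Suc j)} {\<zero>\<^bsub>M\<^esub>}) R M"
      by (rule submodule_comps_in[OF submodule_zero]) auto
    fix a z assume a: "a \<in> y ` Y" and z: "z \<in> ipow I (m + j) (carrier M)"
    obtain i where i: "i \<in> Y" "a = y i" using a by blast
    have zh: "z \<in> comps_in {..<u0 + int (e * j)} {\<zero>\<^bsub>M\<^esub>}" using z Suc by blast
    have zc: "z \<in> carrier M" using zh by (simp add: comps_in_def)
    have aC: "a \<in> carrier R" using a yC by blast
    have "mcomp (a \<bullet> z) v = \<zero>\<^bsub>M\<^esub>" if v: "v < u0 + int (e * Suc j)" for v
    proof -
      have "v - int (dy i) < u0 + int (e * j)" using v e[OF i(1)] by (simp add: algebra_simps)
      then have "mcomp z (v - int (dy i)) = \<zero>\<^bsub>M\<^esub>" using zh by (simp add: comps_in_def)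
      then show ?thesis using mcomp_smult[OF yA[OF i(1)] zc, of v] i aC by simp
    qed
    then show "a \<bullet> z \<in> comps_in {..<u0 + int (e * Suc j)} {\<zero>\<^bsub>M\<^esub>}" using aC zc by (simp add: comps_in_def)
  qed
  finally show ?case .
qed

text \<open>If the slope exceeded \<open>d\<^sub>1\<close>, then \<open>y\<^sub>1\<^sup>n x\<close> would, for degree reasons, lie in all \<open>I\<^sup>jM\<close>;
  but the degrees of \<open>I\<^sup>jM\<close> tend to infinity.\<close>

lemma slope_regular:
  assumes N: "graded_sub N" and one: "i1 \<in> Y" "\<And>i. i \<in> Y \<Longrightarrow> dy i1 \<le> dy i" "1 \<le> dy i1"
    and reg: "zero_colon M {y i1} = {\<zero>\<^bsub>M\<^esub>}" and M0: "carrier M \<noteq> {\<zero>\<^bsub>M\<^esub>}" and g: "\<gamma> \<in> Y"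
    and lin: "\<forall>\<^sub>F n in sequentially. is_least (degrees (ipow I n (carrier M)) (ipow I (Suc n) N)) (int (dy \<gamma>) * int n + b)"
  shows "dy \<gamma> = dy i1"
proof (rule ccontr)
  assume "dy \<gamma> \<noteq> dy i1"
  then have gt: "Suc (dy i1) \<le> dy \<gamma>" using one(2)[OF g] by simp
  obtain x0 where x0: "x0 \<in> carrier M" "x0 \<noteq> \<zero>\<^bsub>M\<^esub>" using M0 by blast
  obtain u where "mcomp x0 u \<noteq> \<zero>\<^bsub>M\<^esub>" using mcomp_induct[OF x0(1), of "{\<zero>\<^bsub>M\<^esub>}"] x0(2) by auto
  then obtain x where x: "x \<in> D u" "x \<noteq> \<zero>\<^bsub>M\<^esub>" using mcomp_in[OF x0(1)] by blast
  have xc: "x \<in> carrier M" using x D_carrier by blast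
  have y1: "y i1 \<in> A (dy i1)" "y i1 \<in> carrier R" "y i1 \<in> I" using one yA yC yI by auto
  obtain n1 where n1: "\<And>n. n \<ge> n1 \<Longrightarrow>
      is_least (degrees (ipow I n (carrier M)) (ipow I (Suc n) N)) (int (dy \<gamma>) * int n + b)"
    using lin unfolding eventually_sequentially by blast
  \<comment> \<open>Ensures \<open>n > u - b\<close>. Since the slopes differ by at least 1, the
    degree \<open>d_1 n + u\<close> of \<open>z n\<close> then lies below the initial degree at
    every level from \<open>n\<close> on.\<close>
  define n where "n = max n1 (Suc (nat (u - b)))"
  define z where "z k = (y i1 [^] k) \<bullet> x" for k :: nat
  have zD: "z n \<in> D (int (dy i1 * n) + u)" unfolding z_def by (rule pow_smult_D[OF y1(1) x(1)])
  have z0: "z k \<noteq> \<zero>\<^bsub>M\<^esub>" for k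
  proof (induct k)
    case 0
    then show ?case using x xc by (simp add: z_def)
  next
    case (Suc k)
    have "z (Suc k) = y i1 \<bullet> z k" unfolding z_def by (rule smult_pow_Suc[OF y1(2) xc])
    moreover have "z k \<in> carrier M" using xc y1 by (simp add: z_def)
    moreover have "z k \<notin> zero_colon M {y i1}" unfolding reg using Suc by simp
    ultimately show ?case by (simp add: zero_colon_def)
  qed
  have lt: "int (dy i1 * n) + u < int (dy \<gamma>) * int (n + j) + b" for j
  proof -
    have "int (Suc (dy i1)) * int n \<le> int (dy \<gamma>) * int n" using gt by (intro mult_right_mono) auto
    also have "\<dots> \<le> int (dy \<gamma>) * int (n + j)" by (intro mult_left_mono) auto
    finally have "int (dy i1 * n) + int n \<le> int (dy \<gamma>) * int (n + j)" by (simp add: algebra_simps)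
    moreover have "u - b < int n" by (simp add: n_def)
    ultimately show ?thesis by linarith
  qed
  \<comment> \<open>At each level the degree of \<open>z n\<close> is too small for it to be nonzero
    in the quotient, so it lies in the denominator and thus in the next power.\<close>
  have all: "z n \<in> ipow I (n + j) (carrier M)" for j
  proof (induct j)
    case 0
    then show ?case using pow_mem_ipow[OF graded_sub_carrier y1(3) xc, of n] by (simp add: z_def)
  next
    case (Suc j)
    have "z n \<in> ipow I (Suc (n + j)) N"
    proof (rule ccontr)
      assume "z n \<notin> ipow I (Suc (n + j)) N"
      then have "int (dy i1 * n) + u \<in> degrees (ipow I (n + j) (carrier M)) (ipow I (Suc (n + j)) N)"
        using Suc zD by (auto simp: degrees_def)
      moreover have "n1 \<le> n + j" by (simp add: n_def)
      ultimately have "int (dy \<gamma>) * int (n + j) + b \<le> int (dy i1 * n) + u"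
        using n1[of "n + j"] unfolding is_least_def by blast
      then show False using lt[of j] by linarith
    qed
    then show ?case
      using ipow_mono[OF II carrier_is_submodule, of N "Suc (n + j)"] graded_mem[OF N] by auto
  qed
  obtain u0 where u0: "\<And>u x. u < u0 \<Longrightarrow> x \<in> carrier M \<Longrightarrow> mcomp x u = \<zero>\<^bsub>M\<^esub>"
    using degrees_bounded_below[OF fg] by blast
  define v where "v = int (dy i1 * n) + u"
  \<comment> \<open>Large enough that \<open>u0 + d_1 j\<close> exceeds the degree \<open>v\<close>
    of \<open>z n\<close>; this works because \<open>d_1 \<ge> 1\<close>.\<close>
  define j where "j = n + nat (v - u0 + 1)"
  have "z n \<in> ipow I (n + (m + j)) (carrier M)" by (rule all)
  also have "\<dots> \<subseteq> ipow I (m + j) (carrier M)" by (rule ipow_decreasing[OF II carrier_is_submodule]) simp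
  also have "\<dots> \<subseteq> comps_in {..<u0 + int (dy i1 * j)} {\<zero>\<^bsub>M\<^esub>}" by (rule power_degrees_grow[OF u0 one(2)])
  finally have zh: "z n \<in> comps_in {..<u0 + int (dy i1 * j)} {\<zero>\<^bsub>M\<^esub>}" .
  have "v - u0 + 1 \<le> int j" unfolding j_def by linarith
  moreover have "1 * int j \<le> int (dy i1) * int j" using one(3) by (intro mult_right_mono) auto
  ultimately have "v < u0 + int (dy i1 * j)" by simp
  then have "mcomp (z n) v = \<zero>\<^bsub>M\<^esub>" using zh by (simp add: comps_in_def)
  then show False using mcomp_homogeneous[OF zD, of v] z0[of n] by (simp add: v_def)
qed

end

theorem theorem1p9:
  fixes R :: "('a, 'r) ring_scheme" and A :: "nat \<Rightarrow> 'a set"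
    and M :: "('a, 'b, 'm) module_scheme" and D :: "int \<Rightarrow> 'b set"
    and x :: "nat \<Rightarrow> 'a" and e :: "nat \<Rightarrow> nat" and d :: nat
    and y :: "nat \<Rightarrow> 'a" and dy :: "nat \<Rightarrow> nat" and c :: nat
    and I J :: "'a set" and N :: "'b set"
  assumes "graded_cring R A"
    and "noetherian_ring R"
    and "\<forall>i\<in>{1..d}. 1 \<le> e i \<and> x i \<in> A (e i)"
    and "carrier R = generate_ring R (A 0 \<union> x ` {1..d})"
    and "graded_module R A M D"
    and "fin_gen_module R M"
    and "graded_submodule R M D N"
    and "homogeneous_ideal R A I"
    and "reduction R I J"
    and "J = Idl\<^bsub>R\<^esub> (y ` {1..c})"
    and "\<forall>i\<in>{1..c}. y i \<in> A (dy i)"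
    and "mono_on {1..c} dy"
    and "zero_colon M I = {\<zero>\<^bsub>M\<^esub>}"
  shows
    \<comment> \<open>(1)\<close>
    "(\<forall>p\<in>A_ass R M N I. I \<subseteq> p \<longrightarrow>
        (\<exists>a\<in>dy ` {1..c}. \<exists>b::int. \<forall>\<^sub>F n in sequentially.
           local_v_subquot R M D (carrier M) (pow_smult R M I n N) p
             = ereal (of_int (int a * int n + b))) \<and>
        (B_ass R M (ideal_smult R M I N) I = A_ass R M N I \<longrightarrow>
           (\<forall>\<^sub>F n in sequentially.
              local_v_subquot R M D (pow_smult R M I n (carrier M)) (pow_smult R M I (n + 1) N) p
              = local_v_subquot R M D (carrier M) (pow_smult R M I (n + 1) N) p)))
     \<and>
     \<comment> \<open>(2)\<close>
     (A_ass R M N I \<noteq> {} \<and> (\<exists>n0. pow_smult R M I n0 (carrier M) \<subseteq> N) \<longrightarrow>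
        (\<exists>\<gamma>\<in>{1..c}.
           eventually_linear (\<lambda>n. indeg_subquot M D
             (pow_smult R M I n (carrier M)) (pow_smult R M I (n + 1) N)) (int (dy \<gamma>)) \<and>
           eventually_linear (\<lambda>n. v_subquot R M D
             (pow_smult R M I n (carrier M)) (pow_smult R M I (n + 1) N)) (int (dy \<gamma>)) \<and>
           eventually_linear (\<lambda>n. v_subquot R M D
             (carrier M) (pow_smult R M I (n + 1) N)) (int (dy \<gamma>))) \<and>
        (B_ass R M (ideal_smult R M I N) I = A_ass R M N I \<longrightarrow>
           (\<forall>\<^sub>F n in sequentially.
              v_subquot R M D (pow_smult R M I n (carrier M)) (pow_smult R M I (n + 1) N)
              = v_subquot R M D (carrier M) (pow_smult R M I (n + 1) N))))
     \<and>
     \<comment> \<open>(3)\<close>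
     (A_ass R M N I \<noteq> {} \<and> (\<exists>n0. pow_smult R M I n0 (carrier M) \<subseteq> N) \<and>
      zero_colon M {y 1} = {\<zero>\<^bsub>M\<^esub>} \<and> 1 \<le> dy 1 \<longrightarrow>
        eventually_linear (\<lambda>n. indeg_subquot M D
          (pow_smult R M I n (carrier M)) (pow_smult R M I (n + 1) N)) (int (dy 1)) \<and>
        eventually_linear (\<lambda>n. v_subquot R M D
          (pow_smult R M I n (carrier M)) (pow_smult R M I (n + 1) N)) (int (dy 1)) \<and>
        eventually_linear (\<lambda>n. v_subquot R M D
          (carrier M) (pow_smult R M I (n + 1) N)) (int (dy 1)))"
proof -
  interpret graded_module R A M D by fact
  have II: "ideal I R" using assms(8) by (simp add: homogeneous_ideal_def)
  define Y where "Y = {1..c}"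
  have yA: "y i \<in> A (dy i)" if "i \<in> Y" for i using that assms(11) by (simp add: Y_def)
  obtain m where J: "J \<subseteq> I" "ideal_prod R J (ideal_pow R I m) = ideal_pow R I (m + 1)"
    using assms(9) unfolding reduction_def by blast
  have J_eq: "Idl\<^bsub>R\<^esub> (y ` Y) = J" unfolding assms(10) Y_def ..
  interpret reduction_setting R A M D I y dy Y m
  proof (intro reduction_setting.intro reduction_setting_axioms.intro assms(2,5,6,8,13))
    show "finite Y" by (simp add: Y_def)
    show "y i \<in> A (dy i)" if "i \<in> Y" for i by (rule yA[OF that])
    show "Idl\<^bsub>R\<^esub> (y ` Y) \<subseteq> I" unfolding J_eq by (rule J(1))
    show "ideal_prod R (Idl\<^bsub>R\<^esub> (y ` Y)) (ideal_pow R I m) = ideal_pow R I (Suc m)"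
      unfolding J_eq using J(2) by (simp only: Suc_eq_plus1)
  qed
  have N: "graded_sub N" by (rule graded_submodule_graded_sub[OF assms(7)])
  have Ns: "submodule N R M" by (rule graded_subD[OF N])
  have NM: "N \<subseteq> carrier M" using sub_carrier[OF Ns] by blast
  have subM: "ipow I n N \<subseteq> carrier M" and subP: "ipow I (Suc n) N \<subseteq> ipow I n (carrier M)" for n
    using sub_carrier[OF ipow_sub[OF N]] ipow_Suc_subset[OF graded_sub_carrier N NM] by blast+
  note csub = carrier_is_submodule and psub = ipow_sub[OF N] and cpsub = ipow_sub[OF graded_sub_carrier]
  have AssM: "Ass R (subquot M (carrier M) (ipow I n N)) = ass_set (carrier M) (ipow I n N)" for n
    by (rule Ass_subquot[OF csub psub subM])
  have locM: "local_v_subquot R M D (carrier M) (ipow I n N) p =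
      (INF u\<in>v_degrees p (carrier M) (ipow I n N). ereal (of_int u))" for n p
    by (rule local_v_subquot_eq[OF csub psub subM])
  have locP: "local_v_subquot R M D (ipow I n (carrier M)) (ipow I (Suc n) N) p =
      (INF u\<in>v_degrees p (ipow I n (carrier M)) (ipow I (Suc n) N). ereal (of_int u))" for n p
    by (rule local_v_subquot_eq[OF cpsub psub subP])
  have vM: "v_subquot R M D (carrier M) (ipow I n N) = v_inf (carrier M) (ipow I n N)" for n
    unfolding v_inf_def by (rule v_subquot_eq[OF csub psub subM])
  have vP: "v_subquot R M D (ipow I n (carrier M)) (ipow I (Suc n) N) = v_inf (ipow I n (carrier M)) (ipow I (Suc n) N)" for n
    unfolding v_inf_def by (rule v_subquot_eq[OF cpsub psub subP])
  have inP: "indeg_subquot M D (ipow I n (carrier M)) (ipow I (Suc n) N) =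
      (INF u\<in>degrees (ipow I n (carrier M)) (ipow I (Suc n) N). ereal (of_int u))" for n
    by (rule indeg_subquot_eq[OF cpsub psub subP])
  \<comment> \<open>Stabilization identifies the limit defining \<open>A_ass\<close> with the actual
    set \<open>P\<close>.\<close>
  obtain P where P: "\<forall>\<^sub>F n in sequentially. ass_set (carrier M) (ipow I n N) = P"
    using ass_power_stabilizes[OF N] by blast
  have A_eq: "A_ass R M N I = P"
    unfolding A_ass_def ipow_def[symmetric] AssM by (rule eventual_value_eqI[OF P])
  have part1: "(\<exists>a\<in>dy ` {1..c}. \<exists>b::int. \<forall>\<^sub>F n in sequentially.
        local_v_subquot R M D (carrier M) (ipow I n N) p = ereal (of_int (int a * int n + b))) \<and>
      (\<forall>\<^sub>F n in sequentially. local_v_subquot R M D (ipow I n (carrier M)) (ipow I (n + 1) N) p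
        = local_v_subquot R M D (carrier M) (ipow I (n + 1) N) p)"
    if p: "p \<in> P" "I \<subseteq> p" for p
  proof
    have "\<forall>\<^sub>F n in sequentially. p \<in> ass_set (carrier M) (ipow I n N)"
      using P by eventually_elim (use p in simp)
    then obtain \<gamma> b where g: "\<gamma> \<in> Y" "\<forall>\<^sub>F n in sequentially.
        is_least (v_degrees p (carrier M) (ipow I (Suc n) N)) (int (dy \<gamma>) * int n + b)"
      using local_v_power_linear[OF N _ p(2)] by blast
    \<comment> \<open>Linearity is known for \<open>I^(n+1) N\<close>. Passing to
      \<open>I^n N\<close> changes the constant by \<open>d_\<gamma>\<close> and keeps the
      slope.\<close>
    have "\<forall>\<^sub>F n in sequentially. local_v_subquot R M D (carrier M) (ipow I (Suc n) N) p
        = ereal (of_int (int (dy \<gamma>) * int (Suc n) + (b - int (dy \<gamma>))))"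
      using g(2)
    proof eventually_elim
      case (elim n)
      have eq: "int (dy \<gamma>) * int (Suc n) + (b - int (dy \<gamma>)) = int (dy \<gamma>) * int n + b"
        by (simp add: algebra_simps)
      show ?case unfolding locM eq by (rule INF_is_least[OF elim])
    qed
    then have "\<forall>\<^sub>F n in sequentially. local_v_subquot R M D (carrier M) (ipow I n N) p
        = ereal (of_int (int (dy \<gamma>) * int n + (b - int (dy \<gamma>))))"
      by (rule eventually_sequentially_Suc[THEN iffD1])
    then show "\<exists>a\<in>dy ` {1..c}. \<exists>b::int. \<forall>\<^sub>F n in sequentially.
        local_v_subquot R M D (carrier M) (ipow I n N) p = ereal (of_int (int a * int n + b))"
      using g(1) unfolding Y_def by blast
    show "\<forall>\<^sub>F n in sequentially. local_v_subquot R M D (ipow I n (carrier M)) (ipow I (n + 1) N) p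
        = local_v_subquot R M D (carrier M) (ipow I (n + 1) N) p"
      using local_v_power_eq[OF N]
    proof eventually_elim
      case (elim n)
      show ?case unfolding Suc_eq_plus1[symmetric] locM locP using elim p(2) by simp
    qed
  qed
  have part2: "\<exists>\<gamma>\<in>{1..c}. \<exists>b.
      (\<forall>\<^sub>F n in sequentially. is_least (degrees (ipow I n (carrier M)) (ipow I (Suc n) N)) (int (dy \<gamma>) * int n + b)) \<and>
      eventually_linear (\<lambda>n. indeg_subquot M D (ipow I n (carrier M)) (ipow I (n + 1) N)) (int (dy \<gamma>)) \<and>
      eventually_linear (\<lambda>n. v_subquot R M D (ipow I n (carrier M)) (ipow I (n + 1) N)) (int (dy \<gamma>)) \<and>
      eventually_linear (\<lambda>n. v_subquot R M D (carrier M) (ipow I (n + 1) N)) (int (dy \<gamma>)) \<and>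
      (\<forall>\<^sub>F n in sequentially. v_subquot R M D (ipow I n (carrier M)) (ipow I (n + 1) N)
        = v_subquot R M D (carrier M) (ipow I (n + 1) N))"
    if ne: "P \<noteq> {}" and n0: "ipow I n0 (carrier M) \<subseteq> N" for n0
  proof -
    note eqv = v_power_linear(1)[OF N n0 P ne]
    obtain \<gamma> b b' where g: "\<gamma> \<in> Y"
      "\<forall>\<^sub>F n in sequentially. is_least (degrees (ipow I n (carrier M)) (ipow I (Suc n) N)) (int (dy \<gamma>) * int n + b)"
      "\<forall>\<^sub>F n in sequentially. v_inf (carrier M) (ipow I (Suc n) N) = ereal (of_int (int (dy \<gamma>) * int n + b'))"
      using v_power_linear(2)[OF N n0 P ne] by blast
    have "\<forall>\<^sub>F n in sequentially. indeg_subquot M D (ipow I n (carrier M)) (ipow I (Suc n) N)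
        = ereal (of_int (int (dy \<gamma>) * int n + b))"
      using g(2) by eventually_elim (simp only: inP INF_is_least)
    moreover have "\<forall>\<^sub>F n in sequentially. v_inf (ipow I n (carrier M)) (ipow I (Suc n) N)
        = ereal (of_int (int (dy \<gamma>) * int n + b'))"
      using g(3) eqv by eventually_elim simp
    ultimately show ?thesis
      using g eqv unfolding Suc_eq_plus1[symmetric] eventually_linear_def vM vP Y_def by blast
  qed
  have part3: "eventually_linear (\<lambda>n. indeg_subquot M D (ipow I n (carrier M)) (ipow I (n + 1) N)) (int (dy 1)) \<and>
      eventually_linear (\<lambda>n. v_subquot R M D (ipow I n (carrier M)) (ipow I (n + 1) N)) (int (dy 1)) \<and>
      eventually_linear (\<lambda>n. v_subquot R M D (carrier M) (ipow I (n + 1) N)) (int (dy 1))"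
    if ne: "P \<noteq> {}" and n0: "ipow I n0 (carrier M) \<subseteq> N"
      and reg: "zero_colon M {y 1} = {\<zero>\<^bsub>M\<^esub>}" and d1: "1 \<le> dy 1" for n0
  proof -
    obtain \<gamma> b where g: "\<gamma> \<in> {1..c}"
      "\<forall>\<^sub>F n in sequentially. is_least (degrees (ipow I n (carrier M)) (ipow I (Suc n) N)) (int (dy \<gamma>) * int n + b)"
      "eventually_linear (\<lambda>n. indeg_subquot M D (ipow I n (carrier M)) (ipow I (n + 1) N)) (int (dy \<gamma>))"
      "eventually_linear (\<lambda>n. v_subquot R M D (ipow I n (carrier M)) (ipow I (n + 1) N)) (int (dy \<gamma>))"
      "eventually_linear (\<lambda>n. v_subquot R M D (carrier M) (ipow I (n + 1) N)) (int (dy \<gamma>))"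
      using part2[OF ne n0] by blast
    have one: "1 \<in> Y" using g(1) by (simp add: Y_def)
    have min: "dy 1 \<le> dy i" if "i \<in> Y" for i
      using assms(12) that one by (auto simp: Y_def monotone_on_def)
    \<comment> \<open>An associated prime needs a nonzero element in some quotient of
      \<open>M\<close>, so \<open>M\<close> is nonzero.\<close>
    have M0: "carrier M \<noteq> {\<zero>\<^bsub>M\<^esub>}"
    proof
      assume M0: "carrier M = {\<zero>\<^bsub>M\<^esub>}"
      obtain p where p: "p \<in> P" using ne by blast
      obtain n where "ass_set (carrier M) (ipow I n N) = P" using eventually_happens[OF P] by auto
      then obtain z where z: "z \<in> carrier M" "p = colon (ipow I n N) z" "primeideal p R"
        using p by (auto simp: ass_set_def)
      then have "z = \<zero>\<^bsub>M\<^esub>" using M0 by simp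
      then have "p = carrier R" using z(2) sub_zero[OF psub] by (auto simp: colon_def)
      then show False using primeideal.I_notcarr[OF z(3)] by simp
    qed
    have "dy \<gamma> = dy 1"
      by (rule slope_regular[OF N one min d1 reg M0 _ g(2)]) (use g(1) in \<open>simp_all add: Y_def\<close>)
    then show ?thesis using g(3-5) by simp
  qed
  show ?thesis
    unfolding A_eq ipow_def[symmetric] using part1 part2 part3 by meson
qed

end
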